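(* Let $L$ be a Legendrian knot in standard contact $\mathbb{R}^3$ whose front projection is nearly plat, and let $\mathcal{C}$ be a Morse complex sequence (MCS) for $L$. Then $(\mathcal{A}_{\mathcal{C}}, d)$ is a differential graded algebra; that is, $d:\mathcal{A}_{\mathcal{C}}\to\mathcal{A}_{\mathcal{C}}$ has degree $-1$, satisfies the Leibniz rule, and satisfies $d^2=0$.
   Context: **Fronts.** The contact structure on $\mathbb{R}^3$ is $\ker(dz-y\,dx)$; the front projection is the projection to the $xz$-plane, with singularities only transverse crossings and semicubical cusps. A front is in plat position if all left cusps have the same $x$-coordinate, all right cusps have the same $x$-coordinate, and no two crossings have the same $x$-coordinate; it is nearly plat if it is obtained by slightly perturbing a plat front so that the cusps have distinct $x$-coordinates. A Maslov potential is a map $\mu:L\to\mathbb{Z}$, constant except at cusps, where the value on the upper strand is one more than the value on the lower strand; one is fixed (rotation number $0$). Along a vertical line the strands of $L$ are numbered $1,2,\dots$ from top to bottom. $\langle\cdot,\cdot\rangle$ is the pairing for which the given basis is orthonormal. Let $Q(L)$ be the set of crossings and right cusps; a right cusp has degree $1$, and a crossing has degree $\mu(T)-\mu(B)$, where $T,B$ are the crossing strands and $T$ has smaller slope. **MCS.** A handleslide mark is a vertical segment in the $xz$-plane connecting two strands of $L$ with equal Maslov potential, missing crossings and cusps. An MCS $\mathcal{C}=(\{(C_m,\delta_m)\},\{x_m\},H)$ consists of values $x_1<\dots<x_M$, $\mathbb{Z}$-graded complexes $(C_m,\delta_m)$ of $\mathbb{Z}_2$-vector spaces ($1\le m\le M$),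 and a collection $H$ of handleslide marks such that: (1) each line $x=x_m$ meets $L$, misses crossings, cusps and handleslide marks, and these lines cut $L$ into pieces each containing exactly one crossing, left cusp, right cusp or handleslide mark (put $x_{M+1}=+\infty$); (2) $C_m$ has basis the points $e_1,e_2,\dots$ of $L\cap\{x=x_m\}$ numbered from top to bottom, with $|e_i|=\mu(e_i)$; (3) $\delta_m$ has degree $-1$ and $\delta_m e_i=\sum_{j>i}c_{ij}e_j$, $c_{ij}\in\mathbb{Z}_2$; (4) if a crossing or cusp between strands $k,k+1$ lies in $x_m\le x\le x_{m+1}$, then $\langle\delta_{m+1}e_k,e_{k+1}\rangle=1$ for a left cusp, $\langle\delta_m e_k,e_{k+1}\rangle=1$ for a right cusp, $\langle\delta_m e_k,e_{k+1}\rangle=0$ for a crossing; and $\langle\delta_1e_1,e_2\rangle=1$; (5) consecutive complexes are related as follows. (a) Crossing of strands $k,k+1$: the linear map $C_m\to C_{m+1}$ interchanging the indices $k$ and $k+1$ and fixing the other $e_i$ is an isomorphism of complexes. (b) Left cusp with strands $k,k+1$: the map $e_i\mapsto[e_i]$ for $i<k$, $e_i\mapsto[e_{i+2}]$ for $i\ge k$ is an isomorphism from $(C_m,\delta_m)$ to the quotient of $(C_{m+1},\delta_{m+1})$ by the subcomplex spanned by $\{e_k,\delta_{m+1}e_k\}$. (c) Right cusp: as in (b) with the roles of $m$ and $m+1$ reversed. (d) Handleslide mark between strands $k<l$: the map $h_{k,l}:C_m\to C_{m+1}$, $e_k\mapsto e_k+e_l$, $e_i\mapsto e_i$ for $i\ne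 k$, is an isomorphism of complexes. **Chord paths.** A chord $(x_0,[i,j])$, $i<j$, is the vertical segment at $x=x_0$ from strand $i$ to strand $j$. For $a\in Q(L)$ and a crossing $b$, a chord path with convex corners from $a$ to $b$ is a finite sequence of chords $\Lambda=(\lambda_1,\dots,\lambda_n)$ such that: (i) the $x$-values of the $\lambda_r$ belong to $\{x_m\}$, and the $x$-value of $\lambda_{r+1}$ is the element of $\{x_m\}$ immediately to the left of that of $\lambda_r$; (ii) if $a$ lies between $x_l$ and $x_{l+1}$ and involves strands $k,k+1$, then $\lambda_1=(x_l,[k,k+1])$; (iii) if $b$ lies between $x_p$ and $x_{p+1}$ and involves strands $k,k+1$, then either $\lambda_n=(x_{p+1},[i,k])$ with $\langle\delta_p e_i,e_k\rangle=1$, or $\lambda_n=(x_{p+1},[k+1,j])$ with $\langle\delta_pe_{k+1},e_j\rangle=1$; (iv) if $\lambda_r=(x_{m+1},[i,j])$ and $\lambda_{r+1}=(x_m,[i',j'])$, $1\le r<n$, then, according to what lies between $x_m$ and $x_{m+1}$: - crossing of strands $k,k+1$: $[i,j]\neq[k,k+1]$, and either $i'=\sigma(i)$, $j'=\sigma(j)$ with $\sigma=(k\ k{+}1)$, or the crossing is a convex corner of $\Lambda$, meaning that $\lambda_r=(x_{m+1},[i,k])$ and $\lambda_{r+1}=(x_m,[i,k])$ (corner at the bottom of the chord), or $\lambda_r=(x_{m+1},[k+1,j])$ and $\lambda_{r+1}=(x_m,[k+1,j])$ (corner at the top of the chord); - left cusp: does not occur since the front is nearly plat; - right cusp with strands $k,k+1$: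 $i'=\tau(i)$, $j'=\tau(j)$, where $\tau(l)=l$ for $l<k$ and $\tau(l)=l+2$ for $l\ge k$; - handleslide mark between strands $k<l$: $(i',j')=(i,j)$; or, if $i=k$ and $l<j$, also $(i',j')=(l,j)$ is allowed; or, if $j=l$ and $i<k$, also $(i',j')=(i,k)$ is allowed. Its word is $w(\Lambda)=f_1\cdots f_s\,b\,h_1\cdots h_t$, where $f_1,\dots,f_s$ are the convex corners at tops of chords read from right to left and $h_1,\dots,h_t$ are the convex corners at bottoms of chords read from left to right. $\mathcal{M}^{\mathcal{C}}(a;b_1,\dots,b_n)$ is the set of chord paths with convex corners beginning at $a$ with word $b_1\cdots b_n$. **The algebra.** $A_{\mathcal{C}}$ is the graded $\mathbb{Z}_2$-vector space with basis $Q(L)$, and $\mathcal{A}_{\mathcal{C}}=\bigoplus_{n\ge0}A_{\mathcal{C}}^{\otimes n}$ is its tensor algebra with the additively extended grading. The map $d$ is defined on generators by $da=\sum_{n\ge1}d_na$, $d_na=\sum\#\mathcal{M}^{\mathcal{C}}(a;b_1,\dots,b_n)\,b_1\cdots b_n$, the sum being over monomials with $|b_1\cdots b_n|=|a|-1$ and $\#$ denoting the count mod $2$, and is extended to $\mathcal{A}_{\mathcal{C}}$ by linearity and the Leibniz rule. *)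

theory Defs
  imports "HOL-Analysis.Analysis" "HOL-Library.Poly_Mapping" "HOL-Library.Z2"
    "HOL-Combinatorics.Transposition"
begin

section \<open>Legendrian knots and their fronts\<close>

type_synonym plane = "real \<times> real"
type_synonym space = "real \<times> real \<times> real"

definition xc :: "(real \<Rightarrow> space) \<Rightarrow> real \<Rightarrow> real" where
  "xc \<gamma> t = fst (\<gamma> t)"

definition yc :: "(real \<Rightarrow> space) \<Rightarrow> real \<Rightarrow> real" where
  "yc \<gamma> t = fst (snd (\<gamma> t))"

definition zc :: "(real \<Rightarrow> space) \<Rightarrow> real \<Rightarrow> real" where
  "zc \<gamma> t = snd (snd (\<gamma> t))"

definition smooth_fun :: "(real \<Rightarrow> real) \<Rightarrow> bool" where
  "smooth_fun f \<longleftrightarrow> (\<forall>n t. (deriv ^^ n) f differentiable (at t))"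

text \<open>A knot is given by a smooth embedding of the circle \<open>\<real>/\<int>\<close>, written as a
  1-periodic immersion \<open>\<gamma>\<close>; the knot itself is \<open>range \<gamma>\<close>. It is Legendrian for
  the contact structure \<open>ker (dz - y dx)\<close>.\<close>

definition legendrian_knot :: "(real \<Rightarrow> space) \<Rightarrow> bool" where
  "legendrian_knot \<gamma> \<longleftrightarrow>
     smooth_fun (xc \<gamma>) \<and> smooth_fun (yc \<gamma>) \<and> smooth_fun (zc \<gamma>) \<and>
     (\<forall>t. \<gamma> (t + 1) = \<gamma> t) \<and> inj_on \<gamma> {0..<1} \<and>
     (\<forall>t. (deriv (xc \<gamma>) t, deriv (yc \<gamma>) t, deriv (zc \<gamma>) t) \<noteq> (0, 0, 0)) \<and>
     (\<forall>t. deriv (zc \<gamma>) t = yc \<gamma> t * deriv (xc \<gamma>) t)"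

definition front :: "space \<Rightarrow> plane" where
  "front p = (fst p, snd (snd p))"

definition front_set :: "(real \<Rightarrow> space) \<Rightarrow> plane set" where
  "front_set \<gamma> = front ` range \<gamma>"

definition singular :: "(real \<Rightarrow> space) \<Rightarrow> real \<Rightarrow> bool" where
  "singular \<gamma> t \<longleftrightarrow> deriv (xc \<gamma>) t = 0 \<and> deriv (zc \<gamma>) t = 0"

text \<open>A singular point of a plane curve is a semicubical cusp iff the second and third
  derivatives of the curve are linearly independent there.\<close>

definition semicubical :: "(real \<Rightarrow> space) \<Rightarrow> real \<Rightarrow> bool" where
  "semicubical \<gamma> t \<longleftrightarrow>
     (deriv ^^ 2) (xc \<gamma>) t * (deriv ^^ 3) (zc \<gamma>) t
       \<noteq> (deriv ^^ 3) (xc \<gamma>) t * (deriv ^^ 2) (zc \<gamma>) t"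

definition crosses :: "(real \<Rightarrow> space) \<Rightarrow> real \<Rightarrow> real \<Rightarrow> bool" where
  "crosses \<gamma> s t \<longleftrightarrow> \<gamma> s \<noteq> \<gamma> t \<and> front (\<gamma> s) = front (\<gamma> t)"

text \<open>The only singularities of the front are semicubical cusps and transverse crossings;
  transversality also keeps cusps away from double points.\<close>

definition generic_front :: "(real \<Rightarrow> space) \<Rightarrow> bool" where
  "generic_front \<gamma> \<longleftrightarrow>
     (\<forall>t. singular \<gamma> t \<longrightarrow> semicubical \<gamma> t) \<and>
     (\<forall>s t. crosses \<gamma> s t \<longrightarrow>
        deriv (xc \<gamma>) s * deriv (zc \<gamma>) t \<noteq> deriv (xc \<gamma>) t * deriv (zc \<gamma>) s) \<and>
     (\<forall>r s t. \<not> (crosses \<gamma> r s \<and> crosses \<gamma> s t \<and> crosses \<gamma> r t))"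

text \<open>At a left cusp the front lies locally to the right of the cusp point, i.e.\ the
  \<open>x\<close>-coordinate has a nondegenerate local minimum.\<close>

definition left_cusp_at :: "(real \<Rightarrow> space) \<Rightarrow> real \<Rightarrow> bool" where
  "left_cusp_at \<gamma> t \<longleftrightarrow> singular \<gamma> t \<and> (deriv ^^ 2) (xc \<gamma>) t > 0"

definition right_cusp_at :: "(real \<Rightarrow> space) \<Rightarrow> real \<Rightarrow> bool" where
  "right_cusp_at \<gamma> t \<longleftrightarrow> singular \<gamma> t \<and> (deriv ^^ 2) (xc \<gamma>) t < 0"

definition left_cusps :: "(real \<Rightarrow> space) \<Rightarrow> plane set" where
  "left_cusps \<gamma> = {front (\<gamma> t) | t. left_cusp_at \<gamma> t}"

definition right_cusps :: "(real \<Rightarrow> space) \<Rightarrow> plane set" where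
  "right_cusps \<gamma> = {front (\<gamma> t) | t. right_cusp_at \<gamma> t}"

definition crossings :: "(real \<Rightarrow> space) \<Rightarrow> plane set" where
  "crossings \<gamma> = {front (\<gamma> t) | s t. crosses \<gamma> s t}"

definition plat :: "(real \<Rightarrow> space) \<Rightarrow> bool" where
  "plat \<gamma> \<longleftrightarrow>
     (\<forall>p\<in>left_cusps \<gamma>. \<forall>q\<in>left_cusps \<gamma>. fst p = fst q) \<and>
     (\<forall>p\<in>right_cusps \<gamma>. \<forall>q\<in>right_cusps \<gamma>. fst p = fst q) \<and>
     inj_on fst (crossings \<gamma>)"

text \<open>A slight perturbation of a front is a continuous family \<open>\<Gamma> s\<close>, \<open>s \<in> [0,1]\<close>, of
  Legendrian knots with generic fronts which is too small to let a crossing pass above,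
  below or through another crossing or a cusp. The family is parametrized so that each
  crossing and each cusp stays at constant parameter values. The cusps may move relative
  to each other, and \<open>\<Gamma> 0\<close> is allowed to have several cusps on one vertical line.\<close>

definition slight_perturbation :: "(real \<Rightarrow> real \<Rightarrow> space) \<Rightarrow> bool" where
  "slight_perturbation \<Gamma> \<longleftrightarrow>
     continuous_on ({0..1} \<times> UNIV) (\<lambda>(s, t). \<Gamma> s t) \<and>
     (\<forall>s\<in>{0..1}.
        legendrian_knot (\<Gamma> s) \<and> generic_front (\<Gamma> s) \<and>
        (\<forall>t. left_cusp_at (\<Gamma> s) t \<longleftrightarrow> left_cusp_at (\<Gamma> 0) t) \<and>
        (\<forall>t. right_cusp_at (\<Gamma> s) t \<longleftrightarrow> right_cusp_at (\<Gamma> 0) t) \<and>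
        (\<forall>t t'. crosses (\<Gamma> s) t t' \<longleftrightarrow> crosses (\<Gamma> 0) t t') \<and>
        inj_on fst (crossings (\<Gamma> s)) \<and>
        (\<forall>p\<in>crossings (\<Gamma> s). \<forall>q\<in>left_cusps (\<Gamma> s) \<union> right_cusps (\<Gamma> s). fst p \<noteq> fst q))"

definition nearly_plat :: "(real \<Rightarrow> space) \<Rightarrow> bool" where
  "nearly_plat \<gamma> \<longleftrightarrow>
     (\<exists>\<Gamma>. slight_perturbation \<Gamma> \<and> plat (\<Gamma> 0) \<and> \<Gamma> 1 = \<gamma>) \<and>
     inj_on fst (left_cusps \<gamma> \<union> right_cusps \<gamma>)"

text \<open>A Maslov potential is locally constant away from the cusps. Near a cusp, two points of
  the knot on the same vertical line lie on the two strands of the cusp. Values of \<open>\<mu>\<close>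
  outside \<open>range \<gamma>\<close> and at the cusp points themselves play no role.\<close>

definition maslov_potential :: "(real \<Rightarrow> space) \<Rightarrow> (space \<Rightarrow> int) \<Rightarrow> bool" where
  "maslov_potential \<gamma> \<mu> \<longleftrightarrow>
     (\<forall>t. \<not> singular \<gamma> t \<longrightarrow>
        (\<exists>e>0. \<forall>q \<in> range \<gamma> \<inter> ball (\<gamma> t) e. \<mu> q = \<mu> (\<gamma> t))) \<and>
     (\<forall>t. singular \<gamma> t \<longrightarrow>
        (\<exists>e>0. \<forall>q \<in> range \<gamma> \<inter> ball (\<gamma> t) e. \<forall>r \<in> range \<gamma> \<inter> ball (\<gamma> t) e.
           fst q = fst r \<and> snd (snd q) > snd (snd r) \<longrightarrow> \<mu> q = \<mu> r + 1))"

text \<open>One plus the number of points of the front above \<open>p\<close> on the vertical line through \<open>p\<close>.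
  If \<open>p\<close> is a crossing or a cusp and nothing else happens on this line, the strands
  meeting at \<open>p\<close> are those numbered \<open>strand \<gamma> p\<close> and \<open>strand \<gamma> p + 1\<close>.\<close>

definition strand :: "(real \<Rightarrow> space) \<Rightarrow> plane \<Rightarrow> nat" where
  "strand \<gamma> p = Suc (card {z. z > snd p \<and> (fst p, z) \<in> front_set \<gamma>})"

definition num_strands :: "(real \<Rightarrow> space) \<Rightarrow> real \<Rightarrow> nat" where
  "num_strands \<gamma> u = card {p \<in> range \<gamma>. fst p = u}"

definition strand_point :: "(real \<Rightarrow> space) \<Rightarrow> real \<Rightarrow> nat \<Rightarrow> space" where
  "strand_point \<gamma> u i = (THE p. p \<in> range \<gamma> \<and> fst p = u \<and> strand \<gamma> (front p) = i)"

definition generators :: "(real \<Rightarrow> space) \<Rightarrow> plane set" where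
  "generators \<gamma> = crossings \<gamma> \<union> right_cusps \<gamma>"

text \<open>Since \<open>dz = y dx\<close> on the knot, the slope of the front at a point is its \<open>y\<close>-coordinate.\<close>

definition gen_degree :: "(real \<Rightarrow> space) \<Rightarrow> (space \<Rightarrow> int) \<Rightarrow> plane \<Rightarrow> int" where
  "gen_degree \<gamma> \<mu> p =
     (if p \<in> right_cusps \<gamma> then 1
      else let ys = {y. (fst p, y, snd p) \<in> range \<gamma>}
           in \<mu> (fst p, Min ys, snd p) - \<mu> (fst p, Max ys, snd p))"


section \<open>Graded complexes over the field with two elements\<close>

type_synonym z2vec = "nat \<Rightarrow>\<^sub>0 bit"

definition basis_vec :: "nat \<Rightarrow> z2vec" where
  "basis_vec i = Poly_Mapping.single i 1"

text \<open>Linear extension of a map given on a basis; every nonzero coefficient is 1.\<close>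

definition linear_ext :: "('a \<Rightarrow> 'b \<Rightarrow>\<^sub>0 bit) \<Rightarrow> ('a \<Rightarrow>\<^sub>0 bit) \<Rightarrow> ('b \<Rightarrow>\<^sub>0 bit)" where
  "linear_ext f v = (\<Sum>a\<in>Poly_Mapping.keys v. f a)"

text \<open>A graded space with ordered basis \<open>e\<^sub>1, \<dots>, e\<^sub>n\<close> is described by \<open>n\<close> and the degree
  function of the basis; a complex adds its differential.\<close>

record graded_cx =
  cx_dim :: nat
  cx_deg :: "nat \<Rightarrow> int"
  cx_diff :: "z2vec \<Rightarrow> z2vec"

definition cx_space :: "graded_cx \<Rightarrow> z2vec set" where
  "cx_space C = {v. Poly_Mapping.keys v \<subseteq> {1..cx_dim C}}"

definition cx_homog :: "graded_cx \<Rightarrow> int \<Rightarrow> z2vec set" where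
  "cx_homog C g = {v \<in> cx_space C. \<forall>i\<in>Poly_Mapping.keys v. cx_deg C i = g}"

definition is_complex :: "graded_cx \<Rightarrow> bool" where
  "is_complex C \<longleftrightarrow>
     (\<forall>v\<in>cx_space C. \<forall>w\<in>cx_space C. cx_diff C (v + w) = cx_diff C v + cx_diff C w) \<and>
     (\<forall>g. \<forall>v\<in>cx_homog C g. cx_diff C v \<in> cx_homog C (g - 1)) \<and>
     (\<forall>v\<in>cx_space C. cx_diff C (cx_diff C v) = 0)"

definition cx_iso :: "graded_cx \<Rightarrow> graded_cx \<Rightarrow> (z2vec \<Rightarrow> z2vec) \<Rightarrow> bool" where
  "cx_iso C D f \<longleftrightarrow>
     bij_betw f (cx_space C) (cx_space D) \<and>
     (\<forall>v\<in>cx_space C. f (cx_diff C v) = cx_diff D (f v)) \<and>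
     (\<forall>g. \<forall>v\<in>cx_homog C g. f v \<in> cx_homog D g)"

definition coset :: "z2vec set \<Rightarrow> z2vec \<Rightarrow> z2vec set" where
  "coset S v = (+) v ` S"

text \<open>\<open>v \<mapsto> [f v]\<close> is an isomorphism of complexes from \<open>C\<close> to the quotient of \<open>D\<close> by the
  subcomplex \<open>S\<close>, whose elements are the cosets of \<open>S\<close> and whose differential is
  \<open>[w] \<mapsto> [\<delta> w]\<close>.\<close>

definition cx_iso_quotient :: "graded_cx \<Rightarrow> graded_cx \<Rightarrow> z2vec set \<Rightarrow> (z2vec \<Rightarrow> z2vec) \<Rightarrow> bool" where
  "cx_iso_quotient C D S f \<longleftrightarrow>
     bij_betw (\<lambda>v. coset S (f v)) (cx_space C) (coset S ` cx_space D) \<and>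
     (\<forall>v\<in>cx_space C. coset S (f (cx_diff C v)) = coset S (cx_diff D (f v))) \<and>
     (\<forall>g. \<forall>v\<in>cx_homog C g. coset S (f v) \<in> coset S ` cx_homog D g)"

text \<open>The span of \<open>e\<^sub>k\<close> and \<open>\<delta> e\<^sub>k\<close> over the field with two elements.\<close>

definition cusp_subcx :: "graded_cx \<Rightarrow> nat \<Rightarrow> z2vec set" where
  "cusp_subcx C k = (let e = basis_vec k; f = cx_diff C e in {0, e, f, e + f})"

definition pairing :: "graded_cx \<Rightarrow> nat \<Rightarrow> nat \<Rightarrow> bit" where
  "pairing C i j =
     (if i \<in> {1..cx_dim C} \<and> j \<in> {1..cx_dim C}
      then Poly_Mapping.lookup (cx_diff C (basis_vec i)) j else 0)"


section \<open>Morse complex sequences\<close>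

text \<open>A vertical segment \<open>{u} \<times> [z', z]\<close> is encoded as \<open>(u, z, z')\<close>, upper end first.\<close>

type_synonym segment = "real \<times> real \<times> real"

text \<open>The data of an MCS: the number \<open>M\<close>, the values \<open>x\<^sub>1, \<dots>, x\<^sub>M\<close>, the differentials
  \<open>\<delta>\<^sub>1, \<dots>, \<delta>\<^sub>M\<close>, and the handleslide marks. Indices outside \<open>{1..M}\<close> are irrelevant.\<close>

record mcs =
  mcs_len :: nat
  mcs_x :: "nat \<Rightarrow> real"
  mcs_diff :: "nat \<Rightarrow> z2vec \<Rightarrow> z2vec"
  mcs_marks :: "segment set"

definition handleslide_mark :: "(real \<Rightarrow> space) \<Rightarrow> (space \<Rightarrow> int) \<Rightarrow> segment \<Rightarrow> bool" where
  "handleslide_mark \<gamma> \<mu> = (\<lambda>(u, z, z').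
     z' < z \<and>
     (\<exists>p\<in>range \<gamma>. \<exists>q\<in>range \<gamma>. front p = (u, z) \<and> front q = (u, z') \<and> \<mu> p = \<mu> q) \<and>
     {u} \<times> {z'..z} \<inter> (crossings \<gamma> \<union> left_cusps \<gamma> \<union> right_cusps \<gamma>) = {})"

datatype event = Crossing plane | Left_Cusp plane | Right_Cusp plane | Handleslide segment

fun event_x :: "event \<Rightarrow> real" where
  "event_x (Crossing p) = fst p"
| "event_x (Left_Cusp p) = fst p"
| "event_x (Right_Cusp p) = fst p"
| "event_x (Handleslide h) = fst h"

definition events :: "(real \<Rightarrow> space) \<Rightarrow> mcs \<Rightarrow> event set" where
  "events \<gamma> C = Crossing ` crossings \<gamma> \<union> Left_Cusp ` left_cusps \<gamma> \<union>
     Right_Cusp ` right_cusps \<gamma> \<union> Handleslide ` mcs_marks C"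

text \<open>The pieces cut out by the lines \<open>x = x\<^sub>m\<close> are numbered \<open>0, \<dots>, M\<close>: piece \<open>m\<close> is
  \<open>x\<^sub>m < x < x\<^sub>m\<^sub>+\<^sub>1\<close>, with \<open>x\<^sub>0 = -\<infinity>\<close> and \<open>x\<^sub>M\<^sub>+\<^sub>1 = +\<infinity>\<close>.\<close>

definition in_piece :: "mcs \<Rightarrow> nat \<Rightarrow> real \<Rightarrow> bool" where
  "in_piece C m u \<longleftrightarrow>
     m \<le> mcs_len C \<and> (1 \<le> m \<longrightarrow> mcs_x C m < u) \<and> (m < mcs_len C \<longrightarrow> u < mcs_x C (Suc m))"

definition piece_event :: "(real \<Rightarrow> space) \<Rightarrow> mcs \<Rightarrow> nat \<Rightarrow> event" where
  "piece_event \<gamma> C m = (THE e. e \<in> events \<gamma> C \<and> in_piece C m (event_x e))"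

definition mcs_cx :: "(real \<Rightarrow> space) \<Rightarrow> (space \<Rightarrow> int) \<Rightarrow> mcs \<Rightarrow> nat \<Rightarrow> graded_cx" where
  "mcs_cx \<gamma> \<mu> C m =
     \<lparr>cx_dim = num_strands \<gamma> (mcs_x C m),
      cx_deg = (\<lambda>i. \<mu> (strand_point \<gamma> (mcs_x C m) i)),
      cx_diff = mcs_diff C m\<rparr>"

definition skip_two :: "nat \<Rightarrow> nat \<Rightarrow> nat" where
  "skip_two k i = (if i < k then i else i + 2)"

definition slide_vec :: "nat \<Rightarrow> nat \<Rightarrow> nat \<Rightarrow> z2vec" where
  "slide_vec k l i = (if i = k then basis_vec k + basis_vec l else basis_vec i)"

definition is_mcs :: "(real \<Rightarrow> space) \<Rightarrow> (space \<Rightarrow> int) \<Rightarrow> mcs \<Rightarrow> bool" where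
  "is_mcs \<gamma> \<mu> C \<longleftrightarrow>
     (let M = mcs_len C; cx = mcs_cx \<gamma> \<mu> C in
      1 \<le> M \<and> strict_mono_on {1..M} (mcs_x C) \<and>
      (\<forall>h\<in>mcs_marks C. handleslide_mark \<gamma> \<mu> h) \<and>
      (\<forall>m\<in>{1..M}. (\<exists>p\<in>range \<gamma>. fst p = mcs_x C m) \<and>
                   (\<forall>e\<in>events \<gamma> C. event_x e \<noteq> mcs_x C m)) \<and>
      (\<forall>m\<in>{0..M}. \<exists>!e. e \<in> events \<gamma> C \<and> in_piece C m (event_x e)) \<and>
      (\<forall>m\<in>{1..M}. is_complex (cx m) \<and>
         (\<forall>i\<in>{1..cx_dim (cx m)}.
            Poly_Mapping.keys (mcs_diff C m (basis_vec i)) \<subseteq> {i<..cx_dim (cx m)})) \<and>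
      pairing (cx 1) 1 2 = 1 \<and>
      (\<forall>m\<in>{1..M}.
         case piece_event \<gamma> C m of
           Crossing p \<Rightarrow> pairing (cx m) (strand \<gamma> p) (Suc (strand \<gamma> p)) = 0
         | Left_Cusp p \<Rightarrow> pairing (cx (Suc m)) (strand \<gamma> p) (Suc (strand \<gamma> p)) = 1
         | Right_Cusp p \<Rightarrow> pairing (cx m) (strand \<gamma> p) (Suc (strand \<gamma> p)) = 1
         | Handleslide h \<Rightarrow> True) \<and>
      (\<forall>m\<in>{1..<M}.
         case piece_event \<gamma> C m of
           Crossing p \<Rightarrow>
             (let k = strand \<gamma> p in
              cx_iso (cx m) (cx (Suc m))
                (linear_ext (\<lambda>i. basis_vec (Transposition.transpose k (Suc k) i))))
         | Left_Cusp p \<Rightarrow>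
             (let k = strand \<gamma> p in
              cx_iso_quotient (cx m) (cx (Suc m)) (cusp_subcx (cx (Suc m)) k)
                (linear_ext (\<lambda>i. basis_vec (skip_two k i))))
         | Right_Cusp p \<Rightarrow>
             (let k = strand \<gamma> p in
              cx_iso_quotient (cx (Suc m)) (cx m) (cusp_subcx (cx m) k)
                (linear_ext (\<lambda>i. basis_vec (skip_two k i))))
         | Handleslide (u, z, z') \<Rightarrow>
             cx_iso (cx m) (cx (Suc m))
               (linear_ext (slide_vec (strand \<gamma> (u, z)) (strand \<gamma> (u, z'))))))"


section \<open>Chord paths\<close>

text \<open>\<open>(m, i, j)\<close> stands for the chord \<open>(x\<^sub>m, [i, j])\<close>.\<close>

type_synonym chord = "nat \<times> nat \<times> nat"

definition is_chord :: "(real \<Rightarrow> space) \<Rightarrow> mcs \<Rightarrow> chord \<Rightarrow> bool" where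
  "is_chord \<gamma> C = (\<lambda>(m, i, j).
     m \<in> {1..mcs_len C} \<and> 1 \<le> i \<and> i < j \<and> j \<le> num_strands \<gamma> (mcs_x C m))"

text \<open>In the following, the second chord is the one further to the left.\<close>

definition top_corner :: "(real \<Rightarrow> space) \<Rightarrow> mcs \<Rightarrow> chord \<Rightarrow> chord \<Rightarrow> plane \<Rightarrow> bool" where
  "top_corner \<gamma> C = (\<lambda>(_, i, j) (m, i', j') p.
     piece_event \<gamma> C m = Crossing p \<and> i = Suc (strand \<gamma> p) \<and> i' = i \<and> j' = j)"

definition bottom_corner :: "(real \<Rightarrow> space) \<Rightarrow> mcs \<Rightarrow> chord \<Rightarrow> chord \<Rightarrow> plane \<Rightarrow> bool" where
  "bottom_corner \<gamma> C = (\<lambda>(_, i, j) (m, i', j') p.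
     piece_event \<gamma> C m = Crossing p \<and> j = strand \<gamma> p \<and> i' = i \<and> j' = j)"

definition chord_step :: "(real \<Rightarrow> space) \<Rightarrow> mcs \<Rightarrow> chord \<Rightarrow> chord \<Rightarrow> bool" where
  "chord_step \<gamma> C c c' = (case (c, c') of ((n, i, j), (m, i', j')) \<Rightarrow>
     n = Suc m \<and>
     (case piece_event \<gamma> C m of
        Crossing p \<Rightarrow>
          (let k = strand \<gamma> p in
           (i, j) \<noteq> (k, Suc k) \<and>
           ((i' = Transposition.transpose k (Suc k) i \<and> j' = Transposition.transpose k (Suc k) j) \<or>
            top_corner \<gamma> C c c' p \<or> bottom_corner \<gamma> C c c' p))
      | Left_Cusp p \<Rightarrow> False
      | Right_Cusp p \<Rightarrow>
          (let k = strand \<gamma> p in i' = skip_two k i \<and> j' = skip_two k j)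
      | Handleslide (u, z, z') \<Rightarrow>
          (let k = strand \<gamma> (u, z); l = strand \<gamma> (u, z') in
           (i' = i \<and> j' = j) \<or>
           (i = k \<and> l < j \<and> i' = l \<and> j' = j) \<or>
           (j = l \<and> i < k \<and> i' = i \<and> j' = k))))"

definition chord_path ::
  "(real \<Rightarrow> space) \<Rightarrow> (space \<Rightarrow> int) \<Rightarrow> mcs \<Rightarrow> plane \<Rightarrow> plane \<Rightarrow> chord list \<Rightarrow> bool" where
  "chord_path \<gamma> \<mu> C a b \<Lambda> \<longleftrightarrow>
     a \<in> generators \<gamma> \<and> b \<in> crossings \<gamma> \<and> \<Lambda> \<noteq> [] \<and> (\<forall>c\<in>set \<Lambda>. is_chord \<gamma> C c) \<and>
     (\<exists>l. in_piece C l (fst a) \<and> hd \<Lambda> = (l, strand \<gamma> a, Suc (strand \<gamma> a))) \<and>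
     (\<exists>p i j. in_piece C p (fst b) \<and> last \<Lambda> = (Suc p, i, j) \<and>
        (let k = strand \<gamma> b in
         (j = k \<and> pairing (mcs_cx \<gamma> \<mu> C p) i k = 1) \<or>
         (i = Suc k \<and> pairing (mcs_cx \<gamma> \<mu> C p) (Suc k) j = 1))) \<and>
     (\<forall>r. Suc r < length \<Lambda> \<longrightarrow> chord_step \<gamma> C (\<Lambda> ! r) (\<Lambda> ! Suc r))"

text \<open>The corners at which \<open>corner\<close> holds, in the order of the path, i.e.\ from right to left.\<close>

fun corners :: "(chord \<Rightarrow> chord \<Rightarrow> plane \<Rightarrow> bool) \<Rightarrow> chord list \<Rightarrow> plane list" where
  "corners corner (c # c' # cs) =
     (if \<exists>p. corner c c' p then [THE p. corner c c' p] else []) @ corners corner (c' # cs)"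
| "corners corner _ = []"

definition path_word :: "(real \<Rightarrow> space) \<Rightarrow> mcs \<Rightarrow> plane \<Rightarrow> chord list \<Rightarrow> plane list" where
  "path_word \<gamma> C b \<Lambda> =
     corners (top_corner \<gamma> C) \<Lambda> @ [b] @ rev (corners (bottom_corner \<gamma> C) \<Lambda>)"

definition chord_paths ::
  "(real \<Rightarrow> space) \<Rightarrow> (space \<Rightarrow> int) \<Rightarrow> mcs \<Rightarrow> plane \<Rightarrow> plane list \<Rightarrow> chord list set" where
  "chord_paths \<gamma> \<mu> C a w = {\<Lambda>. \<exists>b. chord_path \<gamma> \<mu> C a b \<Lambda> \<and> path_word \<gamma> C b \<Lambda> = w}"


section \<open>The tensor algebra and its differential\<close>

text \<open>The tensor algebra of a vector space with basis \<open>Q\<close> has the words in \<open>Q\<close> as a basis,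
  words of length \<open>n\<close> spanning the \<open>n\<close>-th tensor power, with concatenation as product.
  Written additively, words form a monoid, and \<open>'q word \<Rightarrow>\<^sub>0 bit\<close> is its monoid algebra.\<close>

datatype 'q word = Word (letters: "'q list")

instantiation word :: (type) monoid_add
begin

definition zero_word :: "'a word" where
  "zero_word = Word []"

definition plus_word :: "'a word \<Rightarrow> 'a word \<Rightarrow> 'a word" where
  "plus_word v w = Word (letters v @ letters w)"

instance
  by standard (simp_all add: zero_word_def plus_word_def)

end

type_synonym algebra = "plane word \<Rightarrow>\<^sub>0 bit"

definition monomial :: "plane list \<Rightarrow> algebra" where
  "monomial w = Poly_Mapping.single (Word w) 1"

definition word_degree :: "(real \<Rightarrow> space) \<Rightarrow> (space \<Rightarrow> int) \<Rightarrow> plane list \<Rightarrow> int" where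
  "word_degree \<gamma> \<mu> w = (\<Sum>b\<leftarrow>w. gen_degree \<gamma> \<mu> b)"

definition mcs_algebra :: "(real \<Rightarrow> space) \<Rightarrow> algebra set" where
  "mcs_algebra \<gamma> = {x. \<forall>w\<in>Poly_Mapping.keys x. set (letters w) \<subseteq> generators \<gamma>}"

definition mcs_algebra_deg :: "(real \<Rightarrow> space) \<Rightarrow> (space \<Rightarrow> int) \<Rightarrow> int \<Rightarrow> algebra set" where
  "mcs_algebra_deg \<gamma> \<mu> g =
     {x \<in> mcs_algebra \<gamma>. \<forall>w\<in>Poly_Mapping.keys x. word_degree \<gamma> \<mu> (letters w) = g}"

text \<open>\<open>d a = \<Sum> d\<^sub>n a\<close>: the sum runs over the words of all lengths \<open>n \<ge> 1\<close> that have the right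
  degree and occur as the word of a chord path from \<open>a\<close>.\<close>

definition d_gen ::
  "(real \<Rightarrow> space) \<Rightarrow> (space \<Rightarrow> int) \<Rightarrow> mcs \<Rightarrow> plane \<Rightarrow> algebra" where
  "d_gen \<gamma> \<mu> C a =
     (\<Sum>w\<in>{w. w \<noteq> [] \<and> chord_paths \<gamma> \<mu> C a w \<noteq> {} \<and>
              word_degree \<gamma> \<mu> w = gen_degree \<gamma> \<mu> a - 1}.
        Poly_Mapping.single (Word w) (of_nat (card (chord_paths \<gamma> \<mu> C a w))))"

fun d_word ::
  "(real \<Rightarrow> space) \<Rightarrow> (space \<Rightarrow> int) \<Rightarrow> mcs \<Rightarrow> plane list \<Rightarrow> algebra" where
  "d_word \<gamma> \<mu> C [] = 0"
| "d_word \<gamma> \<mu> C (b # w) = d_gen \<gamma> \<mu> C b * monomial w + monomial [b] * d_word \<gamma> \<mu> C w"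

definition mcs_d ::
  "(real \<Rightarrow> space) \<Rightarrow> (space \<Rightarrow> int) \<Rightarrow> mcs \<Rightarrow> algebra \<Rightarrow> algebra" where
  "mcs_d \<gamma> \<mu> C = linear_ext (\<lambda>w. d_word \<gamma> \<mu> C (letters w))"

text \<open>The conditions on \<open>d\<close> making a graded algebra \<open>A\<close> over the field with two elements, with
  homogeneous parts \<open>G g\<close>, a differential graded algebra. The signs in the Leibniz rule
  disappear in characteristic 2.\<close>

definition is_dga :: "algebra set \<Rightarrow> (int \<Rightarrow> algebra set) \<Rightarrow> (algebra \<Rightarrow> algebra) \<Rightarrow> bool" where
  "is_dga A G d \<longleftrightarrow>
     (\<forall>x\<in>A. d x \<in> A) \<and>
     (\<forall>x\<in>A. \<forall>y\<in>A. d (x + y) = d x + d y) \<and>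
     (\<forall>g. \<forall>x\<in>G g. d x \<in> G (g - 1)) \<and>
     (\<forall>x\<in>A. \<forall>y\<in>A. d (x * y) = d x * y + x * d y) \<and>
     (\<forall>x\<in>A. d (d x) = 0)"

end

theory Submission
  imports Defs
begin

text \<open>Only \<open>d \<circ> d = 0\<close> has content, and it comes from an equation between matrices. Let
\<open>D\<^sub>m\<close> be the matrix of the differential \<open>\<delta>\<^sub>m\<close> and let \<open>P\<^sub>m(i, j)\<close> be the sum of the words of
all chord paths whose first chord is \<open>(x\<^sub>m, [i, j])\<close>. If a generator \<open>a\<close> lies between \<open>x\<^sub>m\<close>
and \<open>x\<^sub>m\<^sub>+\<^sub>1\<close> and involves the strands \<open>k, k+1\<close>, then \<open>d a = P\<^sub>m(k, k+1)\<close>. Put \<open>X\<^sub>m = D\<^sub>m + P\<^sub>m\<close>,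
a strictly upper triangular matrix over the tensor algebra. As long as no right cusp lies
to the left of \<open>x\<^sub>m\<close>, it satisfies the Maurer--Cartan equation \<open>d X\<^sub>m = X\<^sub>m X\<^sub>m\<close>
(\<open>X_flat\<close>). A product contributing to the entry \<open>(k, k+1)\<close> of \<open>X\<^sub>m X\<^sub>m\<close> would need an index
strictly between \<open>k\<close> and \<open>k+1\<close>, so \<open>d (d a) = 0\<close> for crossings \<open>a\<close>.

The equation is carried from left to right. No path crosses a left cusp, so after one
\<open>X = D\<close>, and \<open>D\<^sup>2 = 0\<close>. A handleslide conjugates \<open>D\<close> by an elementary matrix, and the two
ways in which a path may jump along the mark conjugate \<open>P\<close> by the same matrix
(\<open>flat_slide\<close>). A crossing \<open>b\<close> of the strands \<open>k, k+1\<close> acts by the gauge transformation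
\<open>X \<mapsto> B\<^sup>-\<^sup>1 X B + B\<^sup>-\<^sup>1 (d B)\<close>, where \<open>B\<close> is the identity outside the rows and columns
\<open>k, k+1\<close> and has rows \<open>(b, 1)\<close> and \<open>(1, 0)\<close> there: the entries \<open>1\<close> transpose the strands,
the entries \<open>b\<close> are the convex corners and the path ends at \<open>b\<close>, and \<open>B\<^sup>-\<^sup>1 (d B)\<close> removes
the entry below the diagonal because \<open>d b = X\<^sub>m(k, k+1)\<close> (\<open>flat_crossing\<close>).

A right cusp does not preserve the equation. In a nearly plat front, however, all right
cusps lie to the right of all crossings, and an even number of strands lies above each of
them. A chord \<open>[k, k+1]\<close> with \<open>k\<close> odd therefore stays of this form while it moves left
through right cusps and handleslides, until it reaches the part of the front where
the equation holds (\<open>d_P_odd\<close>).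

The degree condition in the definition of \<open>d\<close> discards nothing: \<open>P\<^sub>m(i, j)\<close> is homogeneous
of degree \<open>\<mu>(i) - \<mu>(j) - 1\<close> (\<open>P_homogeneous\<close>), because the isomorphisms between
consecutive complexes preserve degrees.

The locale \<open>nearly_plat_mcs\<close> isolates what this argument needs to know about the front.
Two of these facts carry geometry. The first is that the degree of a crossing can be read
off from the strands \<open>k, k+1\<close> on the line to its left (\<open>crossing_data\<close>): both branches of
the crossing are followed to that line, where they are still adjacent, the one of smaller
slope above the other. The second is the parity at right cusps (\<open>right_cusp_strand_odd\<close>):
the points above a right cusp \<open>p\<close> come in pairs joined through a right cusp \<open>r\<close> further
right, and both points of a pair lie on the same side of \<open>p\<close>. The latter is invariant under
the perturbation, and it holds when \<open>p\<close> and \<open>r\<close> are on one vertical line, as in a plat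
front (\<open>right_cusps_not_nested\<close>).\<close>

section \<open>Vector spaces over the field with two elements\<close>

abbreviation (input) "lookup \<equiv> Poly_Mapping.lookup"
abbreviation (input) "keys \<equiv> Poly_Mapping.keys"

lemma char2 [simp]: "x + x = (0 :: 'a \<Rightarrow>\<^sub>0 bit)"
  by (rule poly_mapping_eqI) (simp add: lookup_add)

lemma char2_left [simp]: "x + (x + y) = (y :: 'a \<Rightarrow>\<^sub>0 bit)"
  by (simp add: add.assoc [symmetric])

text \<open>The support of a sum is not determined by the supports of the summands. Summing over a
fixed larger set, with coefficients, makes linear extensions additive.\<close>

lemma linear_ext_alt:
  assumes "finite A" "keys v \<subseteq> A"
  shows "linear_ext f v = (\<Sum>a\<in>A. if lookup v a = 1 then f a else 0)"
proof -
  have "linear_ext f v = (\<Sum>a\<in>keys v. if lookup v a = 1 then f a else 0)"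
    unfolding linear_ext_def by (rule sum.cong) (auto simp: in_keys_iff)
  also have "\<dots> = (\<Sum>a\<in>A. if lookup v a = 1 then f a else 0)"
    by (rule sum.mono_neutral_left) (use assms in \<open>auto simp: in_keys_iff\<close>)
  finally show ?thesis .
qed

lemma linear_ext_add: "linear_ext f (v + w) = linear_ext f v + linear_ext f w"
proof -
  let ?A = "keys v \<union> keys w"
  have f: "finite ?A" by simp
  have "linear_ext f (v + w) = (\<Sum>a\<in>?A. if lookup (v + w) a = 1 then f a else 0)"
    by (rule linear_ext_alt[OF f]) (rule keys_add)
  also have "\<dots> = (\<Sum>a\<in>?A. (if lookup v a = 1 then f a else 0)
      + (if lookup w a = 1 then f a else 0))"
    by (rule sum.cong) (auto simp: lookup_add)
  also have "\<dots> = linear_ext f v + linear_ext f w"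
    by (simp add: sum.distrib linear_ext_alt[OF f])
  finally show ?thesis .
qed

lemma linear_ext_0 [simp]: "linear_ext f 0 = 0"
  by (simp add: linear_ext_def)

lemma linear_ext_single [simp]: "linear_ext f (Poly_Mapping.single a 1) = f a"
  by (simp add: linear_ext_def)

lemma linear_ext_sum: "linear_ext f (\<Sum>i\<in>I. v i) = (\<Sum>i\<in>I. linear_ext f (v i))"
  by (induction I rule: infinite_finite_induct) (simp_all add: linear_ext_add)

lemma bit_vector_eq_sum: "(v :: 'a \<Rightarrow>\<^sub>0 bit) = (\<Sum>a\<in>keys v. Poly_Mapping.single a 1)"
proof (rule poly_mapping_eqI)
  fix k
  have "lookup (\<Sum>a\<in>keys v. Poly_Mapping.single a (1::bit)) k
      = (\<Sum>a\<in>keys v. if a = k then 1 else 0)"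
    by (simp add: lookup_sum lookup_single when_def)
  also have "\<dots> = lookup v k"
    by (auto simp: in_keys_iff)
  finally show "lookup v k = lookup (\<Sum>a\<in>keys v. Poly_Mapping.single a 1) k"
    by simp
qed

lemma bit_vector_induct [case_names 0 add]:
  assumes "P 0" and "\<And>a v. P v \<Longrightarrow> P (Poly_Mapping.single a 1 + v)"
  shows "P (v :: 'a \<Rightarrow>\<^sub>0 bit)"
proof -
  have "P (\<Sum>a\<in>A. Poly_Mapping.single a 1)" if "finite A" for A
    using that by (induction A) (simp_all add: assms)
  from this[OF finite_keys, of v] show ?thesis
    using bit_vector_eq_sum[of v] by simp
qed

lemma monomial_append: "monomial (v @ w) = monomial v * monomial w"
  by (simp add: monomial_def mult_single plus_word_def)

lemma monomial_Nil: "monomial [] = 1"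
  by (simp add: monomial_def flip: zero_word_def)

section \<open>The differential as a derivation\<close>

lemma d_word_append:
  "d_word \<gamma> \<mu> C (v @ w) = d_word \<gamma> \<mu> C v * monomial w + monomial v * d_word \<gamma> \<mu> C w"
proof (induction v)
  case (Cons b v)
  have "monomial (b # v) = monomial [b] * monomial v"
    using monomial_append[of "[b]" v] by simp
  with Cons show ?case
    by (simp add: monomial_append algebra_simps)
qed (simp add: monomial_Nil)

lemma mcs_d_add: "mcs_d \<gamma> \<mu> C (x + y) = mcs_d \<gamma> \<mu> C x + mcs_d \<gamma> \<mu> C y"
  by (simp add: mcs_d_def linear_ext_add)

lemma mcs_d_0 [simp]: "mcs_d \<gamma> \<mu> C 0 = 0"
  by (simp add: mcs_d_def)

lemma mcs_d_single: "mcs_d \<gamma> \<mu> C (Poly_Mapping.single w 1) = d_word \<gamma> \<mu> C (letters w)"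
  by (simp add: mcs_d_def)

lemma mcs_d_letter: "mcs_d \<gamma> \<mu> C (monomial [b]) = d_gen \<gamma> \<mu> C b"
proof -
  have "mcs_d \<gamma> \<mu> C (monomial [b]) = d_word \<gamma> \<mu> C [b]"
    by (simp add: monomial_def mcs_d_single)
  then show ?thesis by (simp add: monomial_Nil)
qed

lemma mcs_d_1 [simp]: "mcs_d \<gamma> \<mu> C 1 = 0"
  using mcs_d_single[of \<gamma> \<mu> C "Word []"] by (simp add: monomial_Nil flip: monomial_def)

lemma mcs_d_leibniz: "mcs_d \<gamma> \<mu> C (x * y) = mcs_d \<gamma> \<mu> C x * y + x * mcs_d \<gamma> \<mu> C y"
proof (induction x rule: bit_vector_induct)
  case (add v x)
  have "mcs_d \<gamma> \<mu> C (Poly_Mapping.single v 1 * y) =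
      mcs_d \<gamma> \<mu> C (Poly_Mapping.single v 1) * y + Poly_Mapping.single v 1 * mcs_d \<gamma> \<mu> C y"
  proof (induction y rule: bit_vector_induct)
    case (add w y)
    have "d_word \<gamma> \<mu> C (letters (v + w)) = d_word \<gamma> \<mu> C (letters v) * Poly_Mapping.single w 1
        + Poly_Mapping.single v 1 * d_word \<gamma> \<mu> C (letters w)"
      by (simp add: plus_word_def d_word_append monomial_def)
    with add show ?case
      by (simp add: distrib_left mcs_d_add mult_single mcs_d_single add_ac)
  qed simp
  with add show ?case
    by (simp add: distrib_right mcs_d_add add_ac)
qed simp

text \<open>In characteristic 2 the square of a derivation is again a derivation, since the two mixed
terms \<open>d x * d y\<close> cancel. It vanishes once it vanishes on letters.\<close>

lemma mcs_d_squared_zero: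
  assumes "\<And>b. mcs_d \<gamma> \<mu> C (d_gen \<gamma> \<mu> C b) = 0"
  shows "mcs_d \<gamma> \<mu> C (mcs_d \<gamma> \<mu> C x) = 0"
proof -
  have w: "mcs_d \<gamma> \<mu> C (d_word \<gamma> \<mu> C w) = 0" for w
  proof (induction w)
    case (Cons b w)
    have "mcs_d \<gamma> \<mu> C (monomial w) = d_word \<gamma> \<mu> C w"
      by (simp add: monomial_def mcs_d_single)
    then show ?case
      using Cons by (simp add: mcs_d_add mcs_d_leibniz assms mcs_d_letter)
  qed simp
  show ?thesis
    by (induction x rule: bit_vector_induct) (simp_all add: mcs_d_add mcs_d_single w)
qed

section \<open>Flat matrices in characteristic two\<close>

text \<open>The Maurer--Cartan equation \<open>d X = X X\<close> for a matrix with rows and columns indexed by \<open>N\<close>.\<close>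

definition flat :: "('r \<Rightarrow> 'r :: ring_1) \<Rightarrow> nat set \<Rightarrow> (nat \<Rightarrow> nat \<Rightarrow> 'r) \<Rightarrow> bool" where
  "flat d N X \<longleftrightarrow> (\<forall>i\<in>N. \<forall>j\<in>N. d (X i j) = (\<Sum>h\<in>N. X i h * X h j))"

locale char2_derivation =
  fixes d :: "'r \<Rightarrow> 'r :: ring_1"
  assumes d_add: "d (x + y) = d x + d y"
    and d_mult: "d (x * y) = d x * y + x * d y"
    and char_2: "x + x = (0::'r)"
begin

lemma d_0: "d 0 = 0"
  using d_add[of 0 0] by simp

lemma char_2': "x + (x + y) = (y::'r)"
  by (simp add: add.assoc[symmetric] char_2)

text \<open>A nonzero product \<open>X k h * X h (Suc k)\<close> would need \<open>k < h < Suc k\<close>.\<close>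

lemma flat_adjacent:
  assumes "flat d N X" and "\<And>i j. j \<le> i \<Longrightarrow> X i j = 0" and "k \<in> N" "Suc k \<in> N"
  shows "d (X k (Suc k)) = 0"
proof -
  have "X k h * X h (Suc k) = 0" for h
    using assms(2)[of h k] assms(2)[of "Suc k" h] by (cases "h \<le> k") auto
  then show ?thesis using assms by (simp add: flat_def)
qed

text \<open>Here \<open>Y = (1 + E) X (1 + E)\<close> for the elementary matrix \<open>E\<close> with its only entry at \<open>(k, l)\<close>;
\<open>E X E = 0\<close> because \<open>X l k = 0\<close>. Since \<open>E E = 0\<close>, the matrix \<open>1 + E\<close> is its own inverse
modulo 2, and its entries are constants, so conjugation by it respects the equation.\<close>

lemma flat_slide:
  assumes fl: "flat d N X" and up: "\<And>i j. j \<le> i \<Longrightarrow> X i j = 0" and N: "finite N"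
    and kl: "k \<in> N" "l \<in> N" "k < l"
    and Y: "\<And>i j. \<lbrakk>i \<in> N; j \<in> N\<rbrakk> \<Longrightarrow>
      Y i j = X i j + (if i = k then X l j else 0) + (if j = l then X i k else 0)"
  shows "flat d N Y"
  unfolding flat_def
proof (intro ballI)
  fix i j assume i: "i \<in> N" and j: "j \<in> N"
  define S where "S i j = (\<Sum>h\<in>N. X i h * X h j)" for i j
  have dX: "d (X i j) = S i j" if "i \<in> N" "j \<in> N" for i j
    using fl that by (simp add: flat_def S_def)
  have lk: "X l k = 0" "S l k = 0" using up kl dX[of l k] d_0 by auto
  \<comment> \<open>Multiply out; the two terms with \<open>X i k * X l j\<close> will cancel, and \<open>X l k = 0\<close> kills the rest.\<close>
  have "(\<Sum>h\<in>N. Y i h * Y h j) = (\<Sum>h\<in>N.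
     X i h * X h j + (if j = l then X i h * X h k else 0)
     + (if i = k then X l h * X h j else 0) + (if i = k \<and> j = l then X l h * X h k else 0)
     + (if h = k then X i h * X l j else 0) + (if h = l then X i k * X h j else 0)
     + (if h = k \<and> i = k then X l h * X l j else 0) + (if h = l \<and> j = l then X i k * X h k else 0))"
    by (rule sum.cong) (use kl in \<open>auto simp: Y i j algebra_simps\<close>)
  also have "\<dots> = S i j + (if j = l then S i k else 0)
     + (if i = k then S l j else 0) + (if i = k \<and> j = l then S l k else 0)
     + X i k * X l j + X i k * X l j
     + (if i = k then X l k * X l j else 0) + (if j = l then X i k * X l k else 0)"
  proof -
    have "(\<Sum>h\<in>N. if h = k \<and> i = k then X l h * X l j else 0) = (if i = k then X l k * X l j else 0)"
      and "(\<Sum>h\<in>N. if h = l \<and> j = l then X i k * X h k else 0) = (if j = l then X i k * X l k else 0)"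
      using kl N by (auto simp: if_distrib cong: if_cong)
    then show ?thesis
      using kl N by (simp add: sum.distrib S_def)
  qed
  also have "\<dots> = S i j + (if j = l then S i k else 0) + (if i = k then S l j else 0)"
    by (simp add: lk add.assoc char_2)
  also have "\<dots> = d (Y i j)"
    using i j kl by (auto simp: Y d_add dX d_0)
  finally show "d (Y i j) = (\<Sum>h\<in>N. Y i h * Y h j)" by simp
qed

text \<open>With \<open>B\<close> equal to the identity except for the rows \<open>(c, 1)\<close> and \<open>(1, 0)\<close> at \<open>k, Suc k\<close>, the
table for \<open>Y\<close> is the gauge transformation \<open>B\<^sup>-\<^sup>1 X B + B\<^sup>-\<^sup>1 (d B)\<close>. Conjugation
alone would move \<open>X k (Suc k)\<close> to the entry \<open>(Suc k, k)\<close>, and \<open>B\<^sup>-\<^sup>1 (d B)\<close> has the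
single entry \<open>d c\<close> there; the hypothesis on \<open>c\<close> makes the two cancel. The equation is checked
entry by entry, splitting the indices \<open>k\<close> and \<open>Suc k\<close> off the sum.\<close>

lemma flat_crossing:
  assumes fl: "flat d N X" and up: "\<And>i j. j \<le> i \<Longrightarrow> X i j = 0" and N: "finite N"
    and k: "k \<in> N" "Suc k \<in> N" and dc: "d c = X k (Suc k)"
    and Y: "\<And>i j. \<lbrakk>i \<in> N; j \<in> N\<rbrakk> \<Longrightarrow> Y i j =
      (if i \<in> {k, Suc k} \<and> j \<in> {k, Suc k} then 0
       else if j = k then X i (Suc k) + X i k * c
       else if j = Suc k then X i k
       else if i = k then X (Suc k) j
       else if i = Suc k then X k j + c * X (Suc k) j
       else X i j)"
  shows "flat d N Y"
  unfolding flat_def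
proof (intro ballI)
  fix i j assume i: "i \<in> N" and j: "j \<in> N"
  define N0 where "N0 = N - {k, Suc k}"
  have split: "(\<Sum>h\<in>N. f h) = f k + (f (Suc k) + (\<Sum>h\<in>N0. f h))" for f :: "nat \<Rightarrow> 'r"
  proof -
    have "N = insert k (insert (Suc k) N0)" using k by (auto simp: N0_def)
    moreover have "finite N0" "k \<notin> N0" "Suc k \<notin> N0" using N by (auto simp: N0_def)
    ultimately show ?thesis by simp
  qed
  define S where "S i j = (\<Sum>h\<in>N0. X i h * X h j)" for i j
  have dX: "d (X i j) = X i k * X k j + (X i (Suc k) * X (Suc k) j + S i j)" if "i \<in> N" "j \<in> N" for i j
    using fl that by (simp add: flat_def S_def split)
  have N0: "h \<in> N0 \<Longrightarrow> h \<in> N \<and> h \<noteq> k \<and> h \<noteq> Suc k" for h by (auto simp: N0_def)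
  have z: "X k k = 0" "X (Suc k) k = 0" "X (Suc k) (Suc k) = 0" using up by auto
  have Y00: "Y i j = X i j" if "i \<in> N0" "j \<in> N0" for i j using that N0 by (auto simp: Y)
  have Yk: "Y i k = X i (Suc k) + X i k * c" "Y i (Suc k) = X i k" if "i \<in> N0" for i
    using that N0 k by (auto simp: Y)
  have kY: "Y k j = X (Suc k) j" "Y (Suc k) j = X k j + c * X (Suc k) j" if "j \<in> N0" for j
    using that N0 k by (auto simp: Y)
  have Yz: "Y k k = 0" "Y (Suc k) k = 0" "Y k (Suc k) = 0" "Y (Suc k) (Suc k) = 0"
    using k by (auto simp: Y)
  have cases: "m \<in> N0 \<or> m = k \<or> m = Suc k" if "m \<in> N" for m
    using that by (auto simp: N0_def)
  consider "i \<in> N0" "j \<in> N0" | "i \<in> N0" "j = k" | "i \<in> N0" "j = Suc k"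
    | "i = k" "j \<in> N0" | "i = Suc k" "j \<in> N0" | "i \<in> {k, Suc k}" "j \<in> {k, Suc k}"
    using cases[OF i] cases[OF j] by blast
  then show "d (Y i j) = (\<Sum>h\<in>N. Y i h * Y h j)"
  proof cases
    case 1
    then have "(\<Sum>h\<in>N0. Y i h * Y h j) = S i j"
      unfolding S_def by (intro sum.cong) (auto simp: Y00)
    with 1 i j show ?thesis
      by (simp add: split Y00 Yk kY dX algebra_simps char_2 char_2')
  next
    case 2
    then have "(\<Sum>h\<in>N0. Y i h * Y h j) = S i (Suc k) + S i k * c"
      unfolding S_def by (simp add: Y00 Yk sum.distrib sum_distrib_right algebra_simps)
    with 2 i j k show ?thesis
      by (simp add: split Y00 Yk Yz z dX d_add d_mult dc algebra_simps char_2 char_2')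
  next
    case 3
    then have "(\<Sum>h\<in>N0. Y i h * Y h j) = S i k"
      unfolding S_def by (intro sum.cong) (auto simp: Y00 Yk)
    with 3 i j k show ?thesis
      by (simp add: split Y00 Yk Yz z dX)
  next
    case 4
    then have "(\<Sum>h\<in>N0. Y i h * Y h j) = S (Suc k) j"
      unfolding S_def by (intro sum.cong) (auto simp: Y00 kY)
    with 4 i j k show ?thesis
      by (simp add: split Y00 kY Yz z dX)
  next
    case 5
    then have "(\<Sum>h\<in>N0. Y i h * Y h j) = S k j + c * S (Suc k) j"
      unfolding S_def by (simp add: Y00 kY sum.distrib sum_distrib_left algebra_simps)
    with 5 i j k show ?thesis
      by (simp add: split Y00 kY Yz z dX d_add d_mult dc algebra_simps char_2 char_2')
  next
    case 6
    have "(\<Sum>h\<in>N0. Y i h * Y h j) = 0"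
    proof (rule sum.neutral, intro ballI)
      fix h assume h: "h \<in> N0"
      have "h < k \<or> Suc k < h" using N0[OF h] by auto
      then show "Y i h * Y h j = 0"
        using 6 h up by (auto simp: kY Yk)
    qed
    with 6 show ?thesis by (auto simp: split Yz d_0)
  qed
qed

end

section \<open>Chord paths grouped by their first chord\<close>

text \<open>The final crossing \<open>b\<close> is kept together with the path because it contributes a letter to the
word.\<close>

definition path_ends :: "(real \<Rightarrow> space) \<Rightarrow> (space \<Rightarrow> int) \<Rightarrow> mcs \<Rightarrow> plane \<Rightarrow> chord \<Rightarrow> bool" where
  "path_ends \<gamma> \<mu> C b = (\<lambda>(n, i, j). b \<in> crossings \<gamma> \<and>
     (\<exists>p. in_piece C p (fst b) \<and> n = Suc p \<and>
        (j = strand \<gamma> b \<and> pairing (mcs_cx \<gamma> \<mu> C p) i (strand \<gamma> b) = 1 \<or>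
         i = Suc (strand \<gamma> b) \<and> pairing (mcs_cx \<gamma> \<mu> C p) (Suc (strand \<gamma> b)) j = 1)))"

definition paths_from :: "(real \<Rightarrow> space) \<Rightarrow> (space \<Rightarrow> int) \<Rightarrow> mcs \<Rightarrow> chord \<Rightarrow> (plane \<times> chord list) set" where
  "paths_from \<gamma> \<mu> C c = {(b, \<Lambda>). \<Lambda> \<noteq> [] \<and> hd \<Lambda> = c \<and> (\<forall>c\<in>set \<Lambda>. is_chord \<gamma> C c) \<and>
     path_ends \<gamma> \<mu> C b (last \<Lambda>) \<and> (\<forall>r. Suc r < length \<Lambda> \<longrightarrow> chord_step \<gamma> C (\<Lambda> ! r) (\<Lambda> ! Suc r))}"

text \<open>Chord paths can be built up one chord at a time only if they may start at any chord, not
just at the chord of a generator. This series is the matrix \<open>P\<^sub>m\<close>.\<close>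

definition path_series :: "(real \<Rightarrow> space) \<Rightarrow> (space \<Rightarrow> int) \<Rightarrow> mcs \<Rightarrow> nat \<Rightarrow> nat \<Rightarrow> nat \<Rightarrow> algebra" where
  "path_series \<gamma> \<mu> C m i j =
     (\<Sum>(b, \<Lambda>)\<in>paths_from \<gamma> \<mu> C (m, i, j). monomial (path_word \<gamma> C b \<Lambda>))"

definition corner_word :: "(chord \<Rightarrow> chord \<Rightarrow> plane \<Rightarrow> bool) \<Rightarrow> chord \<Rightarrow> chord \<Rightarrow> plane list" where
  "corner_word corner c c' = (if \<exists>p. corner c c' p then [THE p. corner c c' p] else [])"

lemma paths_from_unfold:
  "paths_from \<gamma> \<mu> C c =
     (if is_chord \<gamma> C c then
        (\<lambda>b. (b, [c])) ` {b. path_ends \<gamma> \<mu> C b c} \<union>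
        (\<Union>c'\<in>{c'. chord_step \<gamma> C c c'}. (\<lambda>(b, \<Lambda>). (b, c # \<Lambda>)) ` paths_from \<gamma> \<mu> C c')
      else {})"
proof (intro set_eqI iffI)
  fix x assume "x \<in> paths_from \<gamma> \<mu> C c"
  then obtain b \<Lambda> where x: "x = (b, \<Lambda>)" and p: "\<Lambda> \<noteq> []" "hd \<Lambda> = c" "\<forall>c\<in>set \<Lambda>. is_chord \<gamma> C c"
    "path_ends \<gamma> \<mu> C b (last \<Lambda>)"
    and s: "\<forall>r. Suc r < length \<Lambda> \<longrightarrow> chord_step \<gamma> C (\<Lambda> ! r) (\<Lambda> ! Suc r)"
    by (auto simp: paths_from_def)
  from p obtain \<Lambda>' where \<Lambda>: "\<Lambda> = c # \<Lambda>'" by (cases \<Lambda>) auto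
  show "x \<in> (if is_chord \<gamma> C c then
        (\<lambda>b. (b, [c])) ` {b. path_ends \<gamma> \<mu> C b c} \<union>
        (\<Union>c'\<in>{c'. chord_step \<gamma> C c c'}. (\<lambda>(b, \<Lambda>). (b, c # \<Lambda>)) ` paths_from \<gamma> \<mu> C c')
      else {})"
  proof (cases \<Lambda>')
    case Nil then show ?thesis using p x \<Lambda> by auto
  next
    case (Cons c' cs)
    have "chord_step \<gamma> C c c'" using s[rule_format, of 0] \<Lambda> Cons by simp
    moreover have "(b, \<Lambda>') \<in> paths_from \<gamma> \<mu> C c'"
      using p s[rule_format, of "Suc r" for r] \<Lambda> Cons by (auto simp: paths_from_def)
    ultimately have "x \<in> (\<Union>c'\<in>{c'. chord_step \<gamma> C c c'}. (\<lambda>(b, \<Lambda>). (b, c # \<Lambda>)) ` paths_from \<gamma> \<mu> C c')"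
      using x \<Lambda> by (intro UN_I[of c']) (auto intro!: image_eqI[of _ _ "(b, \<Lambda>')"])
    moreover have "is_chord \<gamma> C c" using p \<Lambda> by simp
    ultimately show ?thesis by (simp only: if_True Un_iff) simp
  qed
next
  fix x assume x: "x \<in> (if is_chord \<gamma> C c then
        (\<lambda>b. (b, [c])) ` {b. path_ends \<gamma> \<mu> C b c} \<union>
        (\<Union>c'\<in>{c'. chord_step \<gamma> C c c'}. (\<lambda>(b, \<Lambda>). (b, c # \<Lambda>)) ` paths_from \<gamma> \<mu> C c')
      else {})"
  then have c: "is_chord \<gamma> C c" by (auto split: if_splits)
  with x consider b where "x = (b, [c])" "path_ends \<gamma> \<mu> C b c" |
    c' b \<Lambda> where "x = (b, c # \<Lambda>)" "chord_step \<gamma> C c c'" "(b, \<Lambda>) \<in> paths_from \<gamma> \<mu> C c'"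
    by auto
  then show "x \<in> paths_from \<gamma> \<mu> C c"
  proof cases
    case 1 then show ?thesis using c by (auto simp: paths_from_def)
  next
    case 2
    have "chord_step \<gamma> C ((c # \<Lambda>) ! r) ((c # \<Lambda>) ! Suc r)" if "Suc r < length (c # \<Lambda>)" for r
      using 2 that by (cases r) (auto simp: paths_from_def hd_conv_nth)
    then show ?thesis using 2 c by (auto simp: paths_from_def)
  qed
qed

lemma paths_from_not_chord: "\<not> is_chord \<gamma> C c \<Longrightarrow> paths_from \<gamma> \<mu> C c = {}"
  by (subst paths_from_unfold) simp

lemma path_series_not_chord: "\<not> is_chord \<gamma> C (m, i, j) \<Longrightarrow> path_series \<gamma> \<mu> C m i j = 0"
  by (simp add: path_series_def paths_from_not_chord)

lemma path_word_Cons: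
  assumes "(b, \<Lambda>) \<in> paths_from \<gamma> \<mu> C c'"
  shows "path_word \<gamma> C b (c # \<Lambda>) = corner_word (top_corner \<gamma> C) c c' @ path_word \<gamma> C b \<Lambda> @
    corner_word (bottom_corner \<gamma> C) c c'"
proof -
  obtain cs where "\<Lambda> = c' # cs" using assms by (cases \<Lambda>) (auto simp: paths_from_def)
  then show ?thesis by (simp add: path_word_def corner_word_def)
qed

lemma chord_step_index: "chord_step \<gamma> C (n, i, j) (m, i', j') \<Longrightarrow> n = Suc m"
  by (simp add: chord_step_def)

lemma finite_chord_steps: "finite {c'. chord_step \<gamma> C c c' \<and> is_chord \<gamma> C c'}"
proof -
  obtain n i j where c: "c = (n, i, j)" by (cases c)
  have "{c'. chord_step \<gamma> C c c' \<and> is_chord \<gamma> C c'} \<subseteq>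
    {n - 1} \<times> {..num_strands \<gamma> (mcs_x C (n - 1))} \<times> {..num_strands \<gamma> (mcs_x C (n - 1))}"
    by (auto simp: c is_chord_def dest: chord_step_index)
  then show ?thesis by (rule finite_subset) auto
qed

text \<open>The line index drops with every chord, and each line has finitely many chords.\<close>

lemma finite_paths_from:
  assumes "finite (crossings \<gamma>)"
  shows "finite (paths_from \<gamma> \<mu> C (n, i, j))"
proof (induction n arbitrary: i j)
  case 0
  show ?case by (subst paths_from_unfold) (simp add: is_chord_def)
next
  case (Suc n)
  let ?c = "(Suc n, i, j)"
  let ?f = "\<lambda>c'. (\<lambda>(b, \<Lambda>). (b, ?c # \<Lambda>)) ` paths_from \<gamma> \<mu> C c'"
  have "?f c' \<subseteq> (\<Union>c'\<in>{c'. chord_step \<gamma> C ?c c' \<and> is_chord \<gamma> C c'}. ?f c')"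
    if "chord_step \<gamma> C ?c c'" for c'
  proof (cases "is_chord \<gamma> C c'")
    case True
    with that show ?thesis by (intro UN_upper) simp
  qed (simp add: paths_from_not_chord)
  then have "(\<Union>c'\<in>{c'. chord_step \<gamma> C ?c c'}. ?f c') \<subseteq>
      (\<Union>c'\<in>{c'. chord_step \<gamma> C ?c c' \<and> is_chord \<gamma> C c'}. ?f c')"
    by (intro UN_least) simp
  moreover have "(\<lambda>b. (b, [?c])) ` {b. path_ends \<gamma> \<mu> C b ?c} \<subseteq> (\<lambda>b. (b, [?c])) ` crossings \<gamma>"
    by (auto simp: path_ends_def)
  ultimately have "paths_from \<gamma> \<mu> C ?c \<subseteq> (\<lambda>b. (b, [?c])) ` crossings \<gamma> \<union>
      (\<Union>c'\<in>{c'. chord_step \<gamma> C ?c c' \<and> is_chord \<gamma> C c'}. ?f c')"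
    by (subst paths_from_unfold) (simp add: subset_iff)
  moreover have "finite \<dots>"
    using assms finite_chord_steps Suc
    by (auto dest: chord_step_index)
  ultimately show ?case by (rule finite_subset)
qed

text \<open>A path either stops at its first chord or continues with a second one, at the cost of the
convex corner between the two, if there is one.\<close>

lemma path_series_unfold:
  assumes fin: "finite (crossings \<gamma>)" and c: "is_chord \<gamma> C (Suc m, i, j)"
    and S: "finite S" "{(i', j'). chord_step \<gamma> C (Suc m, i, j) (m, i', j')} = S"
    and E: "{b. path_ends \<gamma> \<mu> C b (Suc m, i, j)} = E"
  shows "path_series \<gamma> \<mu> C (Suc m) i j = (\<Sum>b\<in>E. monomial [b]) +
    (\<Sum>(i', j')\<in>S. monomial (corner_word (top_corner \<gamma> C) (Suc m, i, j) (m, i', j'))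
       * path_series \<gamma> \<mu> C m i' j'
       * monomial (corner_word (bottom_corner \<gamma> C) (Suc m, i, j) (m, i', j')))"
proof -
  let ?c = "(Suc m, i, j)"
  let ?f = "\<lambda>(b, \<Lambda>). monomial (path_word \<gamma> C b \<Lambda>)"
  let ?U = "\<lambda>(i', j'). (\<lambda>(b, \<Lambda>). (b, ?c # \<Lambda>)) ` paths_from \<gamma> \<mu> C (m, i', j')"
  have "{c'. chord_step \<gamma> C ?c c'} = (\<lambda>(i', j'). (m, i', j')) ` S"
    using S(2) by (auto dest: chord_step_index simp: image_iff)
  then have U: "paths_from \<gamma> \<mu> C ?c = (\<lambda>b. (b, [?c])) ` E \<union> (\<Union>s\<in>S. ?U s)"
    using c E by (subst paths_from_unfold) (auto simp: image_UN)
  have "E \<subseteq> crossings \<gamma>" using E by (auto simp: path_ends_def)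
  then have finE: "finite E" using fin finite_subset by blast
  have finU: "finite (?U s)" for s using finite_paths_from[OF fin] by (cases s) auto
  have ne: "\<Lambda> \<noteq> [] \<and> hd \<Lambda> = c'" if "(b, \<Lambda>) \<in> paths_from \<gamma> \<mu> C c'" for b \<Lambda> c'
    using that by (auto simp: paths_from_def)
  have "path_series \<gamma> \<mu> C (Suc m) i j = (\<Sum>x\<in>(\<lambda>b. (b, [?c])) ` E. ?f x) + (\<Sum>x\<in>(\<Union>s\<in>S. ?U s). ?f x)"
    unfolding path_series_def U
    by (rule sum.union_disjoint) (use finE finU S in \<open>auto simp: image_iff dest: ne\<close>)
  also have "(\<Sum>x\<in>(\<lambda>b. (b, [?c])) ` E. ?f x) = (\<Sum>b\<in>E. monomial [b])"
    by (subst sum.reindex) (auto simp: inj_on_def path_word_def)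
  also have "(\<Sum>x\<in>(\<Union>s\<in>S. ?U s). ?f x) = (\<Sum>s\<in>S. \<Sum>x\<in>?U s. ?f x)"
    by (rule sum.UNION_disjoint) (use S finU in \<open>auto dest!: ne\<close>)
  also have "\<dots> = (\<Sum>(i', j')\<in>S. monomial (corner_word (top_corner \<gamma> C) ?c (m, i', j'))
       * path_series \<gamma> \<mu> C m i' j'
       * monomial (corner_word (bottom_corner \<gamma> C) ?c (m, i', j')))"
  proof (rule sum.cong[OF refl])
    fix s assume "s \<in> S"
    obtain i' j' where s: "s = (i', j')" by (cases s)
    let ?P = "paths_from \<gamma> \<mu> C (m, i', j')"
    have "(\<Sum>x\<in>?U (i', j'). ?f x) = (\<Sum>(b, \<Lambda>)\<in>?P. monomial (path_word \<gamma> C b (?c # \<Lambda>)))"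
      by (simp, subst sum.reindex) (auto simp: inj_on_def case_prod_beta)
    also have "\<dots> = (\<Sum>(b, \<Lambda>)\<in>?P. monomial (corner_word (top_corner \<gamma> C) ?c (m, i', j'))
       * monomial (path_word \<gamma> C b \<Lambda>) * monomial (corner_word (bottom_corner \<gamma> C) ?c (m, i', j')))"
      by (rule sum.cong) (auto simp: path_word_Cons monomial_append mult.assoc)
    also have "\<dots> = monomial (corner_word (top_corner \<gamma> C) ?c (m, i', j'))
       * path_series \<gamma> \<mu> C m i' j' * monomial (corner_word (bottom_corner \<gamma> C) ?c (m, i', j'))"
      by (simp add: path_series_def sum_distrib_left sum_distrib_right case_prod_beta)
    finally show "(\<Sum>x\<in>?U s. ?f x) = (case s of (i', j') \<Rightarrow>
        monomial (corner_word (top_corner \<gamma> C) ?c (m, i', j')) * path_series \<gamma> \<mu> C m i' j'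
        * monomial (corner_word (bottom_corner \<gamma> C) ?c (m, i', j')))"
      by (simp add: s)
  qed
  finally show ?thesis .
qed

lemma path_series_lookup:
  assumes fin: "finite (crossings \<gamma>)"
  shows "lookup (path_series \<gamma> \<mu> C m i j) (Word w) =
    of_nat (card {x \<in> paths_from \<gamma> \<mu> C (m, i, j). path_word \<gamma> C (fst x) (snd x) = w})"
proof -
  have "lookup (path_series \<gamma> \<mu> C m i j) (Word w) =
    (\<Sum>x\<in>paths_from \<gamma> \<mu> C (m, i, j). if path_word \<gamma> C (fst x) (snd x) = w then 1 else 0)"
    unfolding path_series_def
    by (simp add: lookup_sum case_prod_beta monomial_def lookup_single when_def)
  also have "\<dots> = of_nat (card {x \<in> paths_from \<gamma> \<mu> C (m, i, j). path_word \<gamma> C (fst x) (snd x) = w})"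
    using finite_paths_from[OF fin] by (simp flip: sum.inter_filter)
  finally show ?thesis .
qed

section \<open>The pieces of a Morse complex sequence\<close>

locale morse_complex_sequence =
  fixes \<gamma> :: "real \<Rightarrow> space" and \<mu> :: "space \<Rightarrow> int" and C :: mcs
  assumes is_mcs: "is_mcs \<gamma> \<mu> C"
begin

abbreviation "M \<equiv> mcs_len C"
abbreviation "cx \<equiv> mcs_cx \<gamma> \<mu> C"
abbreviation "nstr m \<equiv> num_strands \<gamma> (mcs_x C m)"
abbreviation "sdeg m i \<equiv> \<mu> (strand_point \<gamma> (mcs_x C m) i)"
abbreviation "P \<equiv> path_series \<gamma> \<mu> C"
abbreviation "D m \<equiv> pairing (mcs_cx \<gamma> \<mu> C m)"

lemma cx_sel [simp]: "cx_dim (cx m) = nstr m" "cx_deg (cx m) i = sdeg m i" "cx_diff (cx m) = mcs_diff C m"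
  by (simp_all add: mcs_cx_def)

lemmas mcs_conditions = is_mcs[unfolded is_mcs_def Let_def]

lemma x_mono: "\<lbrakk>1 \<le> m; m < m'; m' \<le> M\<rbrakk> \<Longrightarrow> mcs_x C m < mcs_x C m'"
proof -
  have "strict_mono_on {1..M} (mcs_x C)"
    using mcs_conditions by (elim conjE)
  then show "\<lbrakk>1 \<le> m; m < m'; m' \<le> M\<rbrakk> \<Longrightarrow> mcs_x C m < mcs_x C m'"
    using strict_mono_onD[of "{1..M}" "mcs_x C" m m'] by auto
qed

lemma mark: "h \<in> mcs_marks C \<Longrightarrow> handleslide_mark \<gamma> \<mu> h"
proof -
  have "\<forall>h\<in>mcs_marks C. handleslide_mark \<gamma> \<mu> h"
    using mcs_conditions by (elim conjE)
  then show "h \<in> mcs_marks C \<Longrightarrow> handleslide_mark \<gamma> \<mu> h" by blast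
qed

lemma event_off_lines: "e \<in> events \<gamma> C \<Longrightarrow> m \<in> {1..M} \<Longrightarrow> event_x e \<noteq> mcs_x C m"
proof -
  have "\<forall>m\<in>{1..M}. (\<exists>p\<in>range \<gamma>. fst p = mcs_x C m) \<and> (\<forall>e\<in>events \<gamma> C. event_x e \<noteq> mcs_x C m)"
    using mcs_conditions by (elim conjE)
  then show "e \<in> events \<gamma> C \<Longrightarrow> m \<in> {1..M} \<Longrightarrow> event_x e \<noteq> mcs_x C m" by blast
qed

lemma unique_event: "m \<le> M \<Longrightarrow> \<exists>!e. e \<in> events \<gamma> C \<and> in_piece C m (event_x e)"
proof -
  have "\<forall>m\<in>{0..M}. \<exists>!e. e \<in> events \<gamma> C \<and> in_piece C m (event_x e)"
    using mcs_conditions by (elim conjE)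
  then show "m \<le> M \<Longrightarrow> \<exists>!e. e \<in> events \<gamma> C \<and> in_piece C m (event_x e)" by simp
qed

lemma piece_event: "m \<le> M \<Longrightarrow> piece_event \<gamma> C m \<in> events \<gamma> C \<and> in_piece C m (event_x (piece_event \<gamma> C m))"
  unfolding piece_event_def by (rule theI') (rule unique_event)

lemma piece_event_eqI: "\<lbrakk>e \<in> events \<gamma> C; in_piece C m (event_x e)\<rbrakk> \<Longrightarrow> piece_event \<gamma> C m = e"
  using piece_event[of m] unique_event[of m] by (auto simp: in_piece_def)

lemma in_piece_less: "\<lbrakk>in_piece C m u; in_piece C m' u'; m < m'\<rbrakk> \<Longrightarrow> u < u'"
  using x_mono[of "Suc m" m'] by (cases "Suc m = m'") (auto simp: in_piece_def)

lemma in_piece_unique: "\<lbrakk>in_piece C m u; in_piece C m' u\<rbrakk> \<Longrightarrow> m = m'"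
  using in_piece_less[of m u m' u] in_piece_less[of m' u m u] by (cases m m' rule: linorder_cases) auto

lemma event_in_some_piece:
  assumes "e \<in> events \<gamma> C"
  obtains m where "in_piece C m (event_x e)"
proof -
  let ?u = "event_x e"
  \<comment> \<open>The line just left of the event bounds the piece on the left; \<open>m = 0\<close> stands for \<open>-\<infinity>\<close>.\<close>
  define Q where "Q m \<longleftrightarrow> m \<le> M \<and> (1 \<le> m \<longrightarrow> mcs_x C m < ?u)" for m
  define m where "m = (GREATEST m. Q m)"
  have "Q 0" by (simp add: Q_def)
  then have m: "Q m" unfolding m_def by (rule GreatestI_nat) (auto simp: Q_def)
  have "\<not> Q (Suc m)"
  proof
    assume "Q (Suc m)"
    then have "Suc m \<le> Greatest Q"
      by (rule Greatest_le_nat[of Q _ M]) (simp add: Q_def)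
    then show False by (simp add: m_def)
  qed
  then have "in_piece C m ?u"
    using m event_off_lines[OF assms, of "Suc m"] by (auto simp: in_piece_def Q_def)
  then show ?thesis by (rule that)
qed

lemma finite_events: "finite (events \<gamma> C)"
proof -
  have "events \<gamma> C \<subseteq> piece_event \<gamma> C ` {..M}"
  proof
    fix e assume e: "e \<in> events \<gamma> C"
    then obtain m where "in_piece C m (event_x e)" by (rule event_in_some_piece)
    with e show "e \<in> piece_event \<gamma> C ` {..M}"
      using piece_event_eqI[of e m] by (auto simp: in_piece_def)
  qed
  then show ?thesis by (rule finite_subset) simp
qed

lemma finite_crossings: "finite (crossings \<gamma>)"
proof -
  have "finite (Crossing ` crossings \<gamma>)"
    using finite_events by (rule finite_subset[rotated]) (auto simp: events_def)
  then show ?thesis by (rule finite_imageD) (auto simp: inj_on_def)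
qed

lemma crossing_event: "b \<in> crossings \<gamma> \<Longrightarrow> in_piece C m (fst b) \<Longrightarrow> piece_event \<gamma> C m = Crossing b"
  by (rule piece_event_eqI) (auto simp: events_def)

lemma right_cusp_event: "b \<in> right_cusps \<gamma> \<Longrightarrow> in_piece C m (fst b) \<Longrightarrow> piece_event \<gamma> C m = Right_Cusp b"
  by (rule piece_event_eqI) (auto simp: events_def)

lemma piece_event_CrossingD:
  "m \<le> M \<Longrightarrow> piece_event \<gamma> C m = Crossing p \<Longrightarrow> p \<in> crossings \<gamma> \<and> in_piece C m (fst p)"
  using piece_event[of m] by (auto simp: events_def)

lemma piece_event_Right_CuspD:
  "m \<le> M \<Longrightarrow> piece_event \<gamma> C m = Right_Cusp p \<Longrightarrow> p \<in> right_cusps \<gamma> \<and> in_piece C m (fst p)"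
  using piece_event[of m] by (auto simp: events_def)

lemma piece_event_HandleslideD:
  "m \<le> M \<Longrightarrow> piece_event \<gamma> C m = Handleslide h \<Longrightarrow> handleslide_mark \<gamma> \<mu> h"
  using piece_event[of m] mark by (auto simp: events_def)

lemma path_ends_iff:
  assumes "Suc m \<le> M"
  shows "path_ends \<gamma> \<mu> C b (Suc m, i, j) \<longleftrightarrow> piece_event \<gamma> C m = Crossing b \<and>
    (j = strand \<gamma> b \<and> D m i j = 1 \<or> i = Suc (strand \<gamma> b) \<and> D m i j = 1)"
  using assms piece_event_CrossingD[of m b] by (auto simp: path_ends_def crossing_event)

lemma is_chord_iff: "is_chord \<gamma> C (m, i, j) \<longleftrightarrow> m \<in> {1..M} \<and> 1 \<le> i \<and> i < j \<and> j \<le> nstr m"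
  by (simp add: is_chord_def)

text \<open>Up to the degree condition, \<open>d a\<close> is the series of the first chord of \<open>a\<close>. The paths counted
in \<open>d a\<close> come without their final crossing, but this crossing is the only event in its
piece, so it is determined by the last chord and both counts agree.\<close>

lemma d_gen_eq_path_series_part:
  assumes a: "a \<in> generators \<gamma>" "in_piece C l (fst a)"
  shows "lookup (d_gen \<gamma> \<mu> C a) (Word w) =
    (if word_degree \<gamma> \<mu> w = gen_degree \<gamma> \<mu> a - 1
     then lookup (P l (strand \<gamma> a) (Suc (strand \<gamma> a))) (Word w) else 0)"
proof -
  let ?PF = "paths_from \<gamma> \<mu> C (l, strand \<gamma> a, Suc (strand \<gamma> a))"
  have cp: "chord_paths \<gamma> \<mu> C a w = snd ` {x \<in> ?PF. path_word \<gamma> C (fst x) (snd x) = w}" for w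
  proof -
    have "chord_path \<gamma> \<mu> C a b \<Lambda> \<longleftrightarrow> (b, \<Lambda>) \<in> ?PF" for b \<Lambda>
      using a in_piece_unique
      by (auto simp: chord_path_def paths_from_def path_ends_def Let_def split: prod.splits)
    then show ?thesis by (force simp: chord_paths_def image_iff)
  qed
  have inj: "inj_on snd ?PF"
  proof (rule inj_onI)
    fix x y assume "x \<in> ?PF" "y \<in> ?PF" "snd x = snd y"
    then obtain b b' \<Lambda> where xy: "x = (b, \<Lambda>)" "y = (b', \<Lambda>)"
      and p: "(b, \<Lambda>) \<in> ?PF" "(b', \<Lambda>) \<in> ?PF"
      by (cases x; cases y) auto
    obtain n i j where l: "last \<Lambda> = (n, i, j)" by (cases "last \<Lambda>")
    have e: "\<forall>c\<in>set \<Lambda>. is_chord \<gamma> C c" "\<Lambda> \<noteq> []"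
        "path_ends \<gamma> \<mu> C b (n, i, j)" "path_ends \<gamma> \<mu> C b' (n, i, j)"
      using p by (simp_all add: paths_from_def l)
    have "is_chord \<gamma> C (n, i, j)" using e(1) last_in_set[OF e(2)] l by simp
    moreover obtain m where "n = Suc m" using e(3) by (auto simp: path_ends_def)
    ultimately show "x = y" unfolding xy using e(3,4) by (auto simp: is_chord_iff path_ends_iff)
  qed
  have card: "of_nat (card (chord_paths \<gamma> \<mu> C a w)) =
      lookup (P l (strand \<gamma> a) (Suc (strand \<gamma> a))) (Word w)" for w
    unfolding cp path_series_lookup[OF finite_crossings]
    by (subst card_image) (use inj in \<open>auto intro: inj_on_subset\<close>)
  let ?W = "{w. w \<noteq> [] \<and> chord_paths \<gamma> \<mu> C a w \<noteq> {} \<and> word_degree \<gamma> \<mu> w = gen_degree \<gamma> \<mu> a - 1}"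
  have "?W \<subseteq> (\<lambda>x. path_word \<gamma> C (fst x) (snd x)) ` ?PF"
    by (auto simp: cp intro: rev_image_eqI)
  then have finW: "finite ?W"
    by (rule finite_subset) (simp add: finite_paths_from[OF finite_crossings])
  have "lookup (d_gen \<gamma> \<mu> C a) (Word w) =
    (\<Sum>v\<in>?W. if v = w then of_nat (card (chord_paths \<gamma> \<mu> C a w)) else 0)"
    unfolding d_gen_def lookup_sum
    by (rule sum.cong) (auto simp: lookup_single when_def)
  also have "\<dots> = (if w \<in> ?W then of_nat (card (chord_paths \<gamma> \<mu> C a w)) else 0)"
    using finW by simp
  also have "\<dots> = (if word_degree \<gamma> \<mu> w = gen_degree \<gamma> \<mu> a - 1
     then of_nat (card (chord_paths \<gamma> \<mu> C a w)) else 0)"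
  proof -
    have "chord_paths \<gamma> \<mu> C a [] = {}" by (auto simp: cp path_word_def)
    then show ?thesis by (cases "w = []") auto
  qed
  finally show ?thesis by (simp add: card)
qed

lemma d_gen_not_generator: "a \<notin> generators \<gamma> \<Longrightarrow> d_gen \<gamma> \<mu> C a = 0"
  by (simp add: d_gen_def chord_paths_def chord_path_def)

subsection \<open>One step to the left\<close>

lemma path_series_0: "P 0 i j = 0"
  by (rule path_series_not_chord) (simp add: is_chord_iff)

lemma path_series_left_cusp:
  assumes "Suc m \<le> M" "piece_event \<gamma> C m = Left_Cusp p"
  shows "P (Suc m) i j = 0"
proof (cases "is_chord \<gamma> C (Suc m, i, j)")
  case True
  have "P (Suc m) i j = (\<Sum>b\<in>{}. monomial [b]) + (\<Sum>(i', j')\<in>{}. monomial (corner_word (top_corner \<gamma> C) (Suc m, i, j) (m, i', j'))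
       * P m i' j' * monomial (corner_word (bottom_corner \<gamma> C) (Suc m, i, j) (m, i', j')))"
    by (rule path_series_unfold[OF finite_crossings True])
      (use assms in \<open>auto simp: path_ends_iff chord_step_def\<close>)
  then show ?thesis by simp
qed (rule path_series_not_chord)

lemma path_series_right_cusp:
  assumes "Suc m \<le> M" "piece_event \<gamma> C m = Right_Cusp p"
  shows "P (Suc m) i j = (if is_chord \<gamma> C (Suc m, i, j)
    then P m (skip_two (strand \<gamma> p) i) (skip_two (strand \<gamma> p) j) else 0)"
proof (cases "is_chord \<gamma> C (Suc m, i, j)")
  case True
  let ?k = "strand \<gamma> p"
  have "P (Suc m) i j = (\<Sum>b\<in>{}. monomial [b]) + (\<Sum>(i', j')\<in>{(skip_two ?k i, skip_two ?k j)}.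
      monomial (corner_word (top_corner \<gamma> C) (Suc m, i, j) (m, i', j'))
       * P m i' j' * monomial (corner_word (bottom_corner \<gamma> C) (Suc m, i, j) (m, i', j')))"
    by (rule path_series_unfold[OF finite_crossings True])
      (use assms in \<open>auto simp: path_ends_iff chord_step_def Let_def\<close>)
  with True show ?thesis
    using assms by (simp add: corner_word_def top_corner_def bottom_corner_def monomial_Nil)
qed (simp add: path_series_not_chord)

lemma path_series_handleslide:
  assumes m: "Suc m \<le> M" "piece_event \<gamma> C m = Handleslide (u, z, z')"
    and k: "k = strand \<gamma> (u, z)" and l: "l = strand \<gamma> (u, z')" and kl: "k < l"
  shows "P (Suc m) i j = (if is_chord \<gamma> C (Suc m, i, j) then
     P m i j + (if i = k \<and> l < j then P m l j else 0) + (if j = l \<and> i < k then P m i k else 0) else 0)"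
proof (cases "is_chord \<gamma> C (Suc m, i, j)")
  case True
  let ?S = "{(i, j)} \<union> (if i = k \<and> l < j then {(l, j)} else {}) \<union> (if j = l \<and> i < k then {(i, k)} else {})"
  have "P (Suc m) i j = (\<Sum>b\<in>{}. monomial [b]) + (\<Sum>(i', j')\<in>?S.
      monomial (corner_word (top_corner \<gamma> C) (Suc m, i, j) (m, i', j'))
       * P m i' j' * monomial (corner_word (bottom_corner \<gamma> C) (Suc m, i, j) (m, i', j')))"
    by (rule path_series_unfold[OF finite_crossings True])
      (use m k l in \<open>auto simp: path_ends_iff chord_step_def Let_def split: if_splits\<close>)
  also have "\<dots> = (\<Sum>(i', j')\<in>?S. P m i' j')"
    using m by (simp add: corner_word_def top_corner_def bottom_corner_def monomial_Nil)
  also have "\<dots> = P m i j + (if i = k \<and> l < j then P m l j else 0) + (if j = l \<and> i < k then P m i k else 0)"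
    using kl by (auto simp: add.assoc)
  finally show ?thesis using True by simp
qed (simp add: path_series_not_chord)

text \<open>A path ending at \<open>p\<close> is governed by the entry of \<open>D m\<close> at the very position whose series is
multiplied by \<open>p\<close> at a convex corner, and on the same side. This is why the sum \<open>D + P\<close>
transforms in a uniform way.\<close>

lemma path_series_crossing:
  assumes m: "Suc m \<le> M" "piece_event \<gamma> C m = Crossing p"
    and k: "k = strand \<gamma> p"
  shows "P (Suc m) i j = (if is_chord \<gamma> C (Suc m, i, j) \<and> (i, j) \<noteq> (k, Suc k) then
     P m (Transposition.transpose k (Suc k) i) (Transposition.transpose k (Suc k) j)
     + (if j = k then (P m i k + of_bit (D m i k)) * monomial [p] else 0)
     + (if i = Suc k then monomial [p] * (P m (Suc k) j + of_bit (D m (Suc k) j)) else 0) else 0)"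
proof (cases "is_chord \<gamma> C (Suc m, i, j)")
  case True
  then have ij: "i < j" by (simp add: is_chord_iff)
  let ?s = "Transposition.transpose k (Suc k)"
  let ?S = "if (i, j) = (k, Suc k) then {} else {(?s i, ?s j)} \<union> (if i = Suc k \<or> j = k then {(i, j)} else {})"
  let ?E = "if (j = k \<or> i = Suc k) \<and> D m i j = 1 then {p} else {}"
  let ?f = "\<lambda>(i', j'). monomial (corner_word (top_corner \<gamma> C) (Suc m, i, j) (m, i', j'))
       * P m i' j' * monomial (corner_word (bottom_corner \<gamma> C) (Suc m, i, j) (m, i', j'))"
  have un: "P (Suc m) i j = (\<Sum>b\<in>?E. monomial [b]) + sum ?f ?S"
    by (rule path_series_unfold[OF finite_crossings True])
      (use m k in \<open>auto simp: path_ends_iff chord_step_def Let_def top_corner_def bottom_corner_def split: if_splits\<close>)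
  have s: "?s i \<noteq> i \<or> ?s j \<noteq> j" if "i = Suc k \<or> j = k"
    using that by auto
  have t: "corner_word (top_corner \<gamma> C) (Suc m, i, j) (m, ?s i, ?s j) = []"
    "corner_word (bottom_corner \<gamma> C) (Suc m, i, j) (m, ?s i, ?s j) = []"
    using m k by (auto simp: corner_word_def top_corner_def bottom_corner_def)
  have c: "corner_word (top_corner \<gamma> C) (Suc m, i, j) (m, i, j) = (if i = Suc k then [p] else [])"
    "corner_word (bottom_corner \<gamma> C) (Suc m, i, j) (m, i, j) = (if j = k then [p] else [])"
    using m k by (auto simp: corner_word_def top_corner_def bottom_corner_def)
  show ?thesis
  proof (cases "i = Suc k \<or> j = k")
    case False
    then show ?thesis using True un t by (simp add: monomial_Nil)
  next
    case tr: True
    then have "(i, j) \<noteq> (k, Suc k)" using ij by auto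
    then have "sum ?f ?S = ?f (?s i, ?s j) + ?f (i, j)"
      using tr s[OF tr] by (auto simp del: transpose_apply_first transpose_apply_second)
    with tr True un t c ij \<open>(i, j) \<noteq> (k, Suc k)\<close> show ?thesis
      by (cases "D m i j") (auto simp: monomial_Nil algebra_simps)
  qed
qed (simp add: path_series_not_chord)

end

section \<open>The complexes of a Morse complex sequence\<close>

lemma lookup_basis_vec: "lookup (basis_vec i) j = (if i = j then 1 else 0)"
  by (simp add: basis_vec_def lookup_single when_def)

lemma keys_basis_vec [simp]: "keys (basis_vec i) = {i}"
  by (simp add: basis_vec_def)

lemma linear_ext_basis_vec [simp]: "linear_ext f (basis_vec i) = f i"
  by (simp add: basis_vec_def)

lemma basis_vec_in_cx_space: "basis_vec i \<in> cx_space X \<longleftrightarrow> i \<in> {1..cx_dim X}"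
  by (simp add: cx_space_def)

lemma cx_space_add: "\<lbrakk>v \<in> cx_space X; w \<in> cx_space X\<rbrakk> \<Longrightarrow> v + w \<in> cx_space X"
  using keys_add[of v w] by (auto simp: cx_space_def)

text \<open>Counting vectors recovers the dimension, so a mere bijection between two of these spaces
forces the numbers of strands to agree.\<close>

lemma card_cx_space: "finite (cx_space X)" "card (cx_space X) = 2 ^ cx_dim X"
proof -
  have "bij_betw keys (cx_space X) (Pow {1..cx_dim X})"
  proof (rule bij_betwI')
    fix v w :: z2vec
    show "(keys v = keys w) = (v = w)"
      using bit_vector_eq_sum[of v] bit_vector_eq_sum[of w] by metis
  next
    fix A assume A: "A \<in> Pow {1..cx_dim X}"
    then have "finite A" using finite_subset by blast
    define v where "v = (\<Sum>a\<in>A. basis_vec a)"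
    have "lookup v a = (if a \<in> A then 1 else 0)" for a
      using \<open>finite A\<close> by (simp add: v_def lookup_sum lookup_basis_vec)
    then have "keys v = A" by (auto simp: in_keys_iff split: if_splits)
    with A show "\<exists>v\<in>cx_space X. A = keys v"
      by (intro bexI[of _ v]) (auto simp: cx_space_def)
  qed (auto simp: cx_space_def)
  then have "finite (cx_space X) = finite (Pow {1..cx_dim X})"
    and c: "card (cx_space X) = card (Pow {1..cx_dim X})"
    by (rule bij_betw_finite, rule bij_betw_same_card)
  then show "finite (cx_space X)" by simp
  show "card (cx_space X) = 2 ^ cx_dim X" using c by (simp add: card_Pow)
qed

lemma cx_iso_dim: "cx_iso X Y f \<Longrightarrow> cx_dim X = cx_dim Y"
  using card_cx_space[of X] card_cx_space[of Y] bij_betw_same_card[of f "cx_space X" "cx_space Y"]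
  by (simp add: cx_iso_def)

lemma complex_diff_expand:
  assumes "is_complex X" "v \<in> cx_space X"
  shows "cx_diff X v = (\<Sum>i\<in>keys v. cx_diff X (basis_vec i))"
proof -
  have 0: "0 \<in> cx_space X" by (simp add: cx_space_def)
  have add: "cx_diff X (v + w) = cx_diff X v + cx_diff X w" if "v \<in> cx_space X" "w \<in> cx_space X" for v w
    using assms that by (auto simp: is_complex_def)
  have d0: "cx_diff X 0 = 0" using add[OF 0 0] by simp
  have "cx_diff X (\<Sum>i\<in>A. basis_vec i) = (\<Sum>i\<in>A. cx_diff X (basis_vec i)) \<and> (\<Sum>i\<in>A. basis_vec i) \<in> cx_space X"
    if "finite A" "A \<subseteq> {1..cx_dim X}" for A
    using that
  proof (induction A)
    case (insert i A)
    then show ?case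
      using add[of "basis_vec i"] basis_vec_in_cx_space[of i X] cx_space_add[of "basis_vec i"] by auto
  qed (simp_all add: d0 0)
  from this[of "keys v"] show ?thesis
    using assms bit_vector_eq_sum[of v] by (simp add: cx_space_def basis_vec_def)
qed

lemma pairing_expand:
  assumes "is_complex X" "v \<in> cx_space X" "j \<in> {1..cx_dim X}"
  shows "lookup (cx_diff X v) j = (\<Sum>i\<in>{1..cx_dim X}. lookup v i * pairing X i j)"
proof -
  have v: "i \<in> {1..cx_dim X}" "lookup v i = 1" if "i \<in> keys v" for i
    using that assms(2) unfolding cx_space_def by (blast, simp add: in_keys_iff)
  have "lookup (cx_diff X v) j = (\<Sum>i\<in>keys v. lookup v i * pairing X i j)"
    unfolding complex_diff_expand[OF assms(1,2)] lookup_sum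
    by (rule sum.cong) (use assms v in \<open>auto simp: pairing_def\<close>)
  also have "\<dots> = (\<Sum>i\<in>{1..cx_dim X}. lookup v i * pairing X i j)"
    by (rule sum.mono_neutral_left) (use assms in \<open>auto simp: cx_space_def in_keys_iff\<close>)
  finally show ?thesis .
qed

lemma complex_basis:
  assumes "is_complex X" "i \<in> {1..cx_dim X}"
  shows "cx_diff X (basis_vec i) \<in> cx_homog X (cx_deg X i - 1)"
proof -
  have "basis_vec i \<in> cx_homog X (cx_deg X i)"
    using assms by (simp add: cx_homog_def cx_space_def)
  then show ?thesis using assms by (auto simp: is_complex_def)
qed

lemma pairing_degree:
  assumes "is_complex X" "pairing X i j = 1"
  shows "cx_deg X i = cx_deg X j + 1"
proof -
  have i: "i \<in> {1..cx_dim X}" and "lookup (cx_diff X (basis_vec i)) j = 1"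
    using assms by (auto simp: pairing_def split: if_splits)
  with complex_basis[OF assms(1) i] show ?thesis by (auto simp: cx_homog_def in_keys_iff)
qed

lemma pairing_square:
  assumes X: "is_complex X" and ij: "i \<in> {1..cx_dim X}" "j \<in> {1..cx_dim X}"
  shows "(\<Sum>h\<in>{1..cx_dim X}. pairing X i h * pairing X h j) = 0"
proof -
  have e: "basis_vec i \<in> cx_space X" using ij by (simp add: basis_vec_in_cx_space)
  have "cx_diff X (basis_vec i) \<in> cx_space X"
    using complex_basis[OF X ij(1)] by (simp add: cx_homog_def)
  from pairing_expand[OF X this ij(2)]
  have "(\<Sum>h\<in>{1..cx_dim X}. pairing X i h * pairing X h j) = lookup (cx_diff X (cx_diff X (basis_vec i))) j"
    using ij by (simp add: pairing_def)
  then show ?thesis using X e by (simp add: is_complex_def)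
qed

context morse_complex_sequence
begin

lemma complex: "m \<in> {1..M} \<Longrightarrow> is_complex (cx m)"
  and upper: "m \<in> {1..M} \<Longrightarrow> i \<in> {1..nstr m} \<Longrightarrow>
    keys (mcs_diff C m (basis_vec i)) \<subseteq> {i<..nstr m}"
proof -
  have "\<forall>m\<in>{1..M}. is_complex (cx m) \<and> (\<forall>i\<in>{1..cx_dim (cx m)}.
            keys (mcs_diff C m (basis_vec i)) \<subseteq> {i<..cx_dim (cx m)})"
    using mcs_conditions by (elim conjE)
  then show "m \<in> {1..M} \<Longrightarrow> is_complex (cx m)" "m \<in> {1..M} \<Longrightarrow> i \<in> {1..nstr m} \<Longrightarrow>
    keys (mcs_diff C m (basis_vec i)) \<subseteq> {i<..nstr m}"
    by auto
qed

lemma D_range: "D m i j = 1 \<Longrightarrow> i \<in> {1..nstr m} \<and> j \<in> {1..nstr m}"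
  by (auto simp: pairing_def split: if_splits)

lemma D_upper:
  assumes "m \<in> {1..M}" "D m i j = 1" shows "i < j"
proof -
  have "i \<in> {1..nstr m}" using D_range[OF assms(2)] by simp
  moreover have "j \<in> keys (mcs_diff C m (basis_vec i))"
    using assms by (auto simp: pairing_def in_keys_iff split: if_splits)
  ultimately show ?thesis using upper[OF assms(1)] by (meson greaterThanAtMost_iff subsetD)
qed

lemma diff_lookup_0:
  assumes "m \<in> {1..M}" "i \<in> {1..nstr m}" "k \<notin> {i<..nstr m}"
  shows "lookup (mcs_diff C m (basis_vec i)) k = 0"
proof -
  have "k \<notin> keys (mcs_diff C m (basis_vec i))"
    using upper[OF assms(1,2)] assms(3) by blast
  then show ?thesis by (simp add: in_keys_iff)
qed

lemma D_degree: "m \<in> {1..M} \<Longrightarrow> D m i j = 1 \<Longrightarrow> sdeg m i = sdeg m j + 1"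
  using pairing_degree[OF complex, of m i j] by simp

lemma D_square: "\<lbrakk>m \<in> {1..M}; i \<in> {1..nstr m}; j \<in> {1..nstr m}\<rbrakk> \<Longrightarrow>
  (\<Sum>h\<in>{1..nstr m}. D m i h * D m h j) = 0"
  using pairing_square[OF complex, of m i j] by simp

lemma D_crossing_0: "\<lbrakk>m \<in> {1..M}; piece_event \<gamma> C m = Crossing p\<rbrakk> \<Longrightarrow>
    D m (strand \<gamma> p) (Suc (strand \<gamma> p)) = 0"
  and D_right_cusp_1: "\<lbrakk>m \<in> {1..M}; piece_event \<gamma> C m = Right_Cusp p\<rbrakk> \<Longrightarrow>
    D m (strand \<gamma> p) (Suc (strand \<gamma> p)) = 1"
proof -
  have *: "\<forall>m\<in>{1..M}.
         case piece_event \<gamma> C m of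
           Crossing p \<Rightarrow> D m (strand \<gamma> p) (Suc (strand \<gamma> p)) = 0
         | Left_Cusp p \<Rightarrow> D (Suc m) (strand \<gamma> p) (Suc (strand \<gamma> p)) = 1
         | Right_Cusp p \<Rightarrow> D m (strand \<gamma> p) (Suc (strand \<gamma> p)) = 1
         | Handleslide h \<Rightarrow> True"
    using mcs_conditions by (elim conjE)
  then show "\<lbrakk>m \<in> {1..M}; piece_event \<gamma> C m = Crossing p\<rbrakk> \<Longrightarrow> D m (strand \<gamma> p) (Suc (strand \<gamma> p)) = 0"
    by (auto dest!: bspec[of _ _ m])
  show "\<lbrakk>m \<in> {1..M}; piece_event \<gamma> C m = Right_Cusp p\<rbrakk> \<Longrightarrow> D m (strand \<gamma> p) (Suc (strand \<gamma> p)) = 1"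
    using * by (auto dest!: bspec[of _ _ m])
qed

lemma transitions:
  assumes "m \<in> {1..<M}"
  shows "piece_event \<gamma> C m = Crossing p \<Longrightarrow> cx_iso (cx m) (cx (Suc m))
      (linear_ext (\<lambda>i. basis_vec (Transposition.transpose (strand \<gamma> p) (Suc (strand \<gamma> p)) i)))" (is "PROP ?C")
    and "piece_event \<gamma> C m = Right_Cusp p \<Longrightarrow> cx_iso_quotient (cx (Suc m)) (cx m) (cusp_subcx (cx m) (strand \<gamma> p))
      (linear_ext (\<lambda>i. basis_vec (skip_two (strand \<gamma> p) i)))" (is "PROP ?R")
    and "piece_event \<gamma> C m = Handleslide (u, z, z') \<Longrightarrow> cx_iso (cx m) (cx (Suc m))
      (linear_ext (slide_vec (strand \<gamma> (u, z)) (strand \<gamma> (u, z'))))" (is "PROP ?S")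
proof -
  have *: "\<forall>m\<in>{1..<M}.
         case piece_event \<gamma> C m of
           Crossing p \<Rightarrow>
              cx_iso (cx m) (cx (Suc m))
                (linear_ext (\<lambda>i. basis_vec (Transposition.transpose (strand \<gamma> p) (Suc (strand \<gamma> p)) i)))
         | Left_Cusp p \<Rightarrow>
              cx_iso_quotient (cx m) (cx (Suc m)) (cusp_subcx (cx (Suc m)) (strand \<gamma> p))
                (linear_ext (\<lambda>i. basis_vec (skip_two (strand \<gamma> p) i)))
         | Right_Cusp p \<Rightarrow>
              cx_iso_quotient (cx (Suc m)) (cx m) (cusp_subcx (cx m) (strand \<gamma> p))
                (linear_ext (\<lambda>i. basis_vec (skip_two (strand \<gamma> p) i)))
         | Handleslide (u, z, z') \<Rightarrow>
             cx_iso (cx m) (cx (Suc m))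
               (linear_ext (slide_vec (strand \<gamma> (u, z)) (strand \<gamma> (u, z'))))"
    using mcs_conditions by (elim conjE)
  from bspec[OF this assms] show "PROP ?C" "PROP ?R" "PROP ?S"
    by simp_all
qed

lemma homog_basis: "i \<in> {1..nstr m} \<Longrightarrow> basis_vec i \<in> cx_homog (cx m) (sdeg m i)"
  by (simp add: cx_homog_def cx_space_def)

lemma crossing_transition:
  assumes m: "m \<in> {1..<M}" "piece_event \<gamma> C m = Crossing p" and k: "k = strand \<gamma> p"
    and kn: "k \<in> {1..nstr m}" "Suc k \<in> {1..nstr m}"
  shows "nstr (Suc m) = nstr m"
    and "i \<in> {1..nstr m} \<Longrightarrow> sdeg (Suc m) (Transposition.transpose k (Suc k) i) = sdeg m i"
    and "\<lbrakk>i \<in> {1..nstr m}; j \<in> {1..nstr m}\<rbrakk> \<Longrightarrow>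
      D (Suc m) (Transposition.transpose k (Suc k) i) (Transposition.transpose k (Suc k) j) = D m i j"
proof -
  let ?s = "Transposition.transpose k (Suc k)"
  let ?f = "linear_ext (\<lambda>i. basis_vec (?s i))"
  have iso: "cx_iso (cx m) (cx (Suc m)) ?f" using transitions(1)[OF m] k by simp
  show n: "nstr (Suc m) = nstr m" using cx_iso_dim[OF iso] by simp
  have s: "?s i \<in> {1..nstr m}" if "i \<in> {1..nstr m}" for i
    using that kn by (auto simp: Transposition.transpose_def)
  show "sdeg (Suc m) (?s i) = sdeg m i" if "i \<in> {1..nstr m}"
    using iso homog_basis[OF that] by (auto simp: cx_iso_def cx_homog_def dest!: spec bspec)
  show "D (Suc m) (?s i) (?s j) = D m i j" if ij: "i \<in> {1..nstr m}" "j \<in> {1..nstr m}"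
  proof -
    have l: "lookup (?f v) (?s j) = lookup v j" for v
    proof -
      have "lookup (?f v) (?s j) = (\<Sum>a\<in>keys v. if a = j then 1 else 0)"
        unfolding linear_ext_def lookup_sum
        by (rule sum.cong) (auto simp: lookup_basis_vec transpose_eq_iff)
      then show ?thesis by (simp add: in_keys_iff)
    qed
    have "basis_vec i \<in> cx_space (cx m)" using ij by (simp add: basis_vec_in_cx_space)
    then have "?f (mcs_diff C m (basis_vec i)) = mcs_diff C (Suc m) (basis_vec (?s i))"
      using iso by (auto simp: cx_iso_def)
    then show ?thesis using l[of "mcs_diff C m (basis_vec i)"] s ij n by (auto simp: pairing_def)
  qed
qed

text \<open>In row vector form the isomorphism is multiplication by \<open>1 + E\<close> from the right, so
commuting with the differentials means \<open>D\<^sub>m\<^sub>+\<^sub>1 = (1 + E) D\<^sub>m (1 + E)\<close>. The degree of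
\<open>e\<^sub>k + e\<^sub>l\<close> shows that both ends of the mark have equal degree.\<close>

lemma slide_transition:
  assumes m: "m \<in> {1..<M}" "piece_event \<gamma> C m = Handleslide (u, z, z')"
    and k: "k = strand \<gamma> (u, z)" and l: "l = strand \<gamma> (u, z')" and kl: "k < l"
  shows "nstr (Suc m) = nstr m"
    and "k \<in> {1..nstr m} \<Longrightarrow> l \<in> {1..nstr m} \<and> sdeg m k = sdeg m l"
    and "i \<in> {1..nstr m} \<Longrightarrow> sdeg (Suc m) i = sdeg m i"
    and "\<lbrakk>i \<in> {1..nstr m}; j \<in> {1..nstr m}\<rbrakk> \<Longrightarrow> D (Suc m) i j =
      D m i j + (if i = k then D m l j else 0) + (if j = l then D m i k else 0)"
proof -
  let ?f = "linear_ext (slide_vec k l)"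
  have iso: "cx_iso (cx m) (cx (Suc m)) ?f" using transitions(3)[OF m] k l by simp
  show n: "nstr (Suc m) = nstr m" using cx_iso_dim[OF iso] by simp
  have hom: "slide_vec k l i \<in> cx_homog (cx (Suc m)) (sdeg m i)" if "i \<in> {1..nstr m}" for i
    using iso homog_basis[OF that] unfolding cx_iso_def by fastforce
  have kkl: "keys (basis_vec k + basis_vec l) = {k, l}"
    using kl by (auto simp: in_keys_iff lookup_add lookup_basis_vec split: if_splits)
  have kdeg: "l \<in> {1..nstr m} \<and> sdeg (Suc m) l = sdeg m k \<and> sdeg (Suc m) k = sdeg m k" if "k \<in> {1..nstr m}"
    using hom[OF that] n by (simp add: slide_vec_def cx_homog_def kkl cx_space_def)
  show sd: "sdeg (Suc m) i = sdeg m i" if "i \<in> {1..nstr m}" for i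
    using hom[OF that] kdeg that by (cases "i = k") (auto simp: slide_vec_def cx_homog_def)
  show ln: "l \<in> {1..nstr m} \<and> sdeg m k = sdeg m l" if "k \<in> {1..nstr m}"
    using kdeg[OF that] sd[of l] by simp
  show "D (Suc m) i j = D m i j + (if i = k then D m l j else 0) + (if j = l then D m i k else 0)"
    if ij: "i \<in> {1..nstr m}" "j \<in> {1..nstr m}"
  proof -
    have look: "lookup (?f v) j = lookup v j + (if j = l then lookup v k else 0)" for v
    proof -
      have "lookup (?f v) j = (\<Sum>a\<in>keys v. (if a = j then 1 else 0) + (if a = k \<and> j = l then 1 else 0))"
        unfolding linear_ext_def lookup_sum
        by (rule sum.cong) (use kl in \<open>auto simp: lookup_add slide_vec_def lookup_basis_vec\<close>)
      also have "\<dots> = (\<Sum>a\<in>keys v. if a = j then 1 else 0)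
          + (\<Sum>a\<in>keys v. if a = k \<and> j = l then 1 else 0)"
        by (rule sum.distrib)
      finally show ?thesis by (cases "j = l") (simp_all add: in_keys_iff)
    qed
    have comm: "lookup (mcs_diff C (Suc m) (slide_vec k l i)) j
        = lookup (mcs_diff C m (basis_vec i)) j
          + (if j = l then lookup (mcs_diff C m (basis_vec i)) k else 0)"
    proof -
      have "basis_vec i \<in> cx_space (cx m)" using ij by (simp add: basis_vec_in_cx_space)
      then have "?f (mcs_diff C m (basis_vec i)) = mcs_diff C (Suc m) (slide_vec k l i)"
        using iso by (auto simp: cx_iso_def)
      then show ?thesis using look[of "mcs_diff C m (basis_vec i)"] by simp
    qed
    have Dno: "D (Suc m) i' j = D m i' j + (if j = l then D m i' k else 0)"
      if i': "i' \<noteq> k" "i' \<in> {1..nstr m}" for i'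
    proof -
      have "basis_vec i' \<in> cx_space (cx m)" using i' by (simp add: basis_vec_in_cx_space)
      then have "?f (mcs_diff C m (basis_vec i')) = mcs_diff C (Suc m) (slide_vec k l i')"
        using iso by (auto simp: cx_iso_def)
      then have "lookup (mcs_diff C (Suc m) (basis_vec i')) j
        = lookup (mcs_diff C m (basis_vec i')) j
          + (if j = l then lookup (mcs_diff C m (basis_vec i')) k else 0)"
        using look[of "mcs_diff C m (basis_vec i')"] i' by (simp add: slide_vec_def)
      moreover have "k \<in> {1..nstr m} \<or> lookup (mcs_diff C m (basis_vec i')) k = 0"
        using diff_lookup_0[of m i' k] i' m by (cases "k \<in> {i'<..nstr m}") auto
      ultimately show ?thesis using ij i' n by (auto simp: pairing_def)
    qed
    have zero: "D m k k = 0" "D m l k = 0" using D_upper[of m k k] D_upper[of m l k] m kl by force+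
    show ?thesis
    proof (cases "i = k")
      case False then show ?thesis using Dno ij by simp
    next
      case True
      then have l: "l \<in> {1..nstr m}" using ln ij by simp
      have add: "mcs_diff C (Suc m) (basis_vec k + basis_vec l) =
          mcs_diff C (Suc m) (basis_vec k) + mcs_diff C (Suc m) (basis_vec l)"
        using complex[of "Suc m"] m True ij l n
          basis_vec_in_cx_space[of k "cx (Suc m)"] basis_vec_in_cx_space[of l "cx (Suc m)"]
        by (auto simp: is_complex_def)
      have "D (Suc m) k j + D (Suc m) l j = D m k j + (if j = l then D m k k else 0)"
        using comm True add ij l n by (simp add: slide_vec_def pairing_def lookup_add)
      moreover have "D (Suc m) l j = D m l j" using Dno[of l] l kl zero by simp
      ultimately show ?thesis using True zero
        by (cases "D (Suc m) k j"; cases "D m l j"; cases "D m k j") (auto split: if_splits)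
    qed
  qed
qed

text \<open>The isomorphism onto the quotient replaces \<open>e\<^sub>t\<close> by a homogeneous \<open>w\<close> in the same coset. If
\<open>t\<close> has dropped out of \<open>w\<close>, then it was cancelled against \<open>\<delta> e\<^sub>k\<close>. As \<open>\<delta> e\<^sub>k\<close> is homogeneous and
contains \<open>e\<^sub>k\<^sub>+\<^sub>1\<close>, which survives in \<open>w\<close>, the degrees still agree.\<close>

lemma right_cusp_transition:
  assumes m: "m \<in> {1..<M}" "piece_event \<gamma> C m = Right_Cusp p" and i: "i \<in> {1..nstr (Suc m)}"
  shows "sdeg m (skip_two (strand \<gamma> p) i) = sdeg (Suc m) i"
proof -
  define k where "k = strand \<gamma> p"
  let ?t = "skip_two k i"
  let ?e = "basis_vec k" and ?d = "mcs_diff C m (basis_vec k)"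
  have cq: "cx_iso_quotient (cx (Suc m)) (cx m) (cusp_subcx (cx m) k) (linear_ext (\<lambda>i. basis_vec (skip_two k i)))"
    using transitions(2)[OF m] by (simp add: k_def)
  have "coset (cusp_subcx (cx m) k) (basis_vec ?t) \<in> coset (cusp_subcx (cx m) k) ` cx_homog (cx m) (sdeg (Suc m) i)"
    using cq homog_basis[OF i] unfolding cx_iso_quotient_def by (metis linear_ext_basis_vec)
  then obtain w where w: "w \<in> cx_homog (cx m) (sdeg (Suc m) i)"
    and c: "coset (cusp_subcx (cx m) k) (basis_vec ?t) = coset (cusp_subcx (cx m) k) w" by blast
  have "0 \<in> cusp_subcx (cx m) k" by (simp add: cusp_subcx_def Let_def)
  then have "basis_vec ?t \<in> coset (cusp_subcx (cx m) k) (basis_vec ?t)"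
    unfolding coset_def by (auto intro: image_eqI[of _ _ 0])
  then obtain s where s: "s \<in> cusp_subcx (cx m) k" "basis_vec ?t = w + s"
    unfolding c unfolding coset_def by (elim imageE) (rule that)
  from s(1) have s_cases: "s \<in> {0, ?e, ?d, ?e + ?d}"
    by (simp add: cusp_subcx_def Let_def)
  have D1: "D m k (Suc k) = 1" using D_right_cusp_1[of m p] m by (simp add: k_def)
  then have k: "k \<in> {1..nstr m}" "Suc k \<in> {1..nstr m}" using D_range by auto
  have t: "?t \<noteq> k" "?t \<noteq> Suc k" by (auto simp: skip_two_def)
  have dk: "lookup ?d (Suc k) = 1" using D1 k by (simp add: pairing_def)
  have dhom: "?d \<in> cx_homog (cx m) (sdeg m k - 1)"
    using complex_basis[OF complex, of m k] k m by simp
  have eq: "lookup (basis_vec ?t) h = lookup w h + lookup s h" for h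
    using s(2) by (simp add: lookup_add)
  have wh: "lookup w h = 1 \<Longrightarrow> sdeg m h = sdeg (Suc m) i" for h
    using w by (auto simp: cx_homog_def in_keys_iff)
  have dh: "lookup ?d h = 1 \<Longrightarrow> sdeg m h = sdeg m k - 1" for h
    using dhom by (auto simp: cx_homog_def in_keys_iff)
  show ?thesis
  proof (cases "lookup w ?t = 1")
    case True then show ?thesis using wh by (simp add: k_def)
  next
    case False
    then have st: "lookup s ?t = 1" using eq[of ?t] by (simp add: lookup_basis_vec)
    then have s': "s = ?d \<or> s = ?e + ?d" "lookup ?d ?t = 1"
      using s_cases t by (auto simp: lookup_basis_vec lookup_add split: if_splits)
    then have "lookup s (Suc k) = 1" using dk by (auto simp: lookup_add lookup_basis_vec)
    then have "lookup w (Suc k) = 1" using eq[of "Suc k"] t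
      by (cases "lookup w (Suc k)") (auto simp: lookup_basis_vec split: if_splits)
    then have "sdeg m (Suc k) = sdeg (Suc m) i" by (rule wh)
    then show ?thesis using dh[OF s'(2)] dh[OF dk] by (simp add: k_def)
  qed
qed

end

section \<open>The square of the differential\<close>

lemma mcs_algebra_deg_iff:
  "x \<in> mcs_algebra_deg \<gamma> \<mu> g \<longleftrightarrow>
     (\<forall>w\<in>keys x. set (letters w) \<subseteq> generators \<gamma> \<and> word_degree \<gamma> \<mu> (letters w) = g)"
  by (auto simp: mcs_algebra_deg_def mcs_algebra_def)

lemma mcs_algebra_deg_0 [simp]: "0 \<in> mcs_algebra_deg \<gamma> \<mu> g"
  by (simp add: mcs_algebra_deg_iff)

lemma mcs_algebra_deg_add:
  "\<lbrakk>x \<in> mcs_algebra_deg \<gamma> \<mu> g; y \<in> mcs_algebra_deg \<gamma> \<mu> g\<rbrakk> \<Longrightarrow> x + y \<in> mcs_algebra_deg \<gamma> \<mu> g"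
  unfolding mcs_algebra_deg_iff using keys_add[of x y] by blast

lemma mcs_algebra_deg_sum:
  "(\<And>i. i \<in> I \<Longrightarrow> x i \<in> mcs_algebra_deg \<gamma> \<mu> g) \<Longrightarrow> (\<Sum>i\<in>I. x i) \<in> mcs_algebra_deg \<gamma> \<mu> g"
  by (induction I rule: infinite_finite_induct) (auto intro: mcs_algebra_deg_add)

lemma mcs_algebra_deg_mult:
  assumes "x \<in> mcs_algebra_deg \<gamma> \<mu> g" "y \<in> mcs_algebra_deg \<gamma> \<mu> h"
  shows "x * y \<in> mcs_algebra_deg \<gamma> \<mu> (g + h)"
proof -
  have "set (letters w) \<subseteq> generators \<gamma> \<and> word_degree \<gamma> \<mu> (letters w) = g + h"
    if w: "w \<in> keys (x * y)" for w
  proof -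
    obtain u v where "w = u + v" "u \<in> keys x" "v \<in> keys y"
      using subsetD[OF keys_mult w] by auto
    then show ?thesis
      using assms by (auto simp: mcs_algebra_deg_iff plus_word_def word_degree_def)
  qed
  then show ?thesis by (simp add: mcs_algebra_deg_iff)
qed

lemma mcs_algebra_deg_monomial:
  "set w \<subseteq> generators \<gamma> \<Longrightarrow> monomial w \<in> mcs_algebra_deg \<gamma> \<mu> (word_degree \<gamma> \<mu> w)"
  by (simp add: mcs_algebra_deg_def mcs_algebra_def monomial_def)

lemma mcs_algebra_deg_letter:
  "p \<in> generators \<gamma> \<Longrightarrow> monomial [p] \<in> mcs_algebra_deg \<gamma> \<mu> (gen_degree \<gamma> \<mu> p)"
  using mcs_algebra_deg_monomial[of "[p]" \<gamma> \<mu>] by (simp add: word_degree_def)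

lemma of_bit_add: "of_bit (a + b) = (of_bit a + of_bit b :: 'a::monoid_add \<Rightarrow>\<^sub>0 bit)"
  by (cases a; cases b) simp_all

lemma of_bit_mult: "of_bit (a * b) = (of_bit a * of_bit b :: 'a::monoid_add \<Rightarrow>\<^sub>0 bit)"
  by (cases a; cases b) simp_all

lemma of_bit_sum: "of_bit (\<Sum>i\<in>I. f i) = (\<Sum>i\<in>I. of_bit (f i) :: 'a::monoid_add \<Rightarrow>\<^sub>0 bit)"
proof (induction I rule: infinite_finite_induct)
  case (insert i I)
  then show ?case unfolding sum.insert[OF insert.hyps] of_bit_add by simp
qed simp_all

text \<open>What the algebraic argument uses about the front. Only lines \<open>x\<^sub>m\<close> with \<open>m \<ge> 1\<close> carry a
complex, so a crossing must not lie to the left of all of them. Without crossings \<open>d = 0\<close>,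
so \<open>right_odd\<close> may assume that there is one.\<close>

locale nearly_plat_mcs = morse_complex_sequence +
  assumes no_crossing_0: "piece_event \<gamma> C 0 \<noteq> Crossing p"
    and crossing_strand_le: "\<lbrakk>m \<in> {1..M}; piece_event \<gamma> C m = Crossing p\<rbrakk> \<Longrightarrow> Suc (strand \<gamma> p) \<le> nstr m"
    and crossing_degree: "\<lbrakk>m \<in> {1..M}; piece_event \<gamma> C m = Crossing p\<rbrakk> \<Longrightarrow>
      gen_degree \<gamma> \<mu> p = sdeg m (strand \<gamma> p) - sdeg m (Suc (strand \<gamma> p))"
    and slide_order: "\<lbrakk>m \<le> M; piece_event \<gamma> C m = Handleslide (u, z, z')\<rbrakk> \<Longrightarrow>
      strand \<gamma> (u, z) < strand \<gamma> (u, z')"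
    and right_order: "\<lbrakk>b \<in> crossings \<gamma>; p \<in> right_cusps \<gamma>\<rbrakk> \<Longrightarrow> fst b < fst p"
    and right_odd: "\<lbrakk>crossings \<gamma> \<noteq> {}; p \<in> right_cusps \<gamma>\<rbrakk> \<Longrightarrow> odd (strand \<gamma> p)"
begin

abbreviation "d \<equiv> mcs_d \<gamma> \<mu> C"
abbreviation "G \<equiv> mcs_algebra_deg \<gamma> \<mu>"

sublocale char2_derivation d
  by standard (simp_all add: mcs_d_add mcs_d_leibniz)

lemma d_of_bit: "d (of_bit c) = 0"
  by (cases c) simp_all

lemma P_1: "P (Suc 0) i j = 0"
proof (cases "is_chord \<gamma> C (Suc 0, i, j)")
  case True
  then have M: "Suc 0 \<le> M" by (simp add: is_chord_iff)
  show ?thesis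
  proof (cases "piece_event \<gamma> C 0")
    case (Handleslide h)
    then obtain u z z' where "piece_event \<gamma> C 0 = Handleslide (u, z, z')" by (cases h) auto
    then show ?thesis
      using path_series_handleslide[OF M] slide_order[of 0] by (simp add: path_series_0)
  qed (use M no_crossing_0 in \<open>simp_all add: path_series_left_cusp path_series_right_cusp path_series_0\<close>)
qed (rule path_series_not_chord)

lemma crossing_degree_transition:
  assumes "m \<in> {1..<M}" "piece_event \<gamma> C m = Crossing p" "k = strand \<gamma> p"
  shows "nstr (Suc m) = nstr m" "k \<in> {1..nstr m}" "Suc k \<in> {1..nstr m}"
    "sdeg (Suc m) k = sdeg m (Suc k)" "sdeg (Suc m) (Suc k) = sdeg m k"
    "i \<in> {1..nstr m} \<Longrightarrow> i \<noteq> k \<Longrightarrow> i \<noteq> Suc k \<Longrightarrow> sdeg (Suc m) i = sdeg m i"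
proof -
  show k: "k \<in> {1..nstr m}" "Suc k \<in> {1..nstr m}"
    using crossing_strand_le[of m p] assms by (auto simp: strand_def)
  note t = crossing_transition[OF assms k]
  show "nstr (Suc m) = nstr m" by (rule t(1))
  show "sdeg (Suc m) k = sdeg m (Suc k)" "sdeg (Suc m) (Suc k) = sdeg m k"
    using t(2)[of k] t(2)[of "Suc k"] k by simp_all
  show "i \<in> {1..nstr m} \<Longrightarrow> i \<noteq> k \<Longrightarrow> i \<noteq> Suc k \<Longrightarrow> sdeg (Suc m) i = sdeg m i"
    using t(2)[of i] by simp
qed

text \<open>Each step to the left either keeps both degrees, or replaces a strand by one of the same
degree along a handleslide mark, or passes a crossing \<open>p\<close> with \<open>|p| = \<mu>(k) - \<mu>(k+1)\<close>, which
is the degree lost by the chord at a convex corner. A path ending at \<open>p\<close> is accounted for by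
\<open>D\<close>, which has degree \<open>-1\<close>.\<close>

lemma P_homogeneous: "m \<in> {1..M} \<Longrightarrow> P m i j \<in> G (sdeg m i - sdeg m j - 1)"
proof (induction m arbitrary: i j)
  case (Suc m)
  show ?case
  proof (cases "m = 0 \<or> \<not> is_chord \<gamma> C (Suc m, i, j)")
    case True
    then have "P (Suc m) i j = 0" using P_1 by (auto simp: path_series_not_chord)
    then show ?thesis by simp
  next
    case False
    then have m: "m \<in> {1..<M}" "m \<in> {1..M}" "m \<le> M" and SmM: "Suc m \<le> M"
      and ch: "is_chord \<gamma> C (Suc m, i, j)" using Suc.prems by auto
    note IH = Suc.IH[OF m(2)]
    show ?thesis
    proof (cases "piece_event \<gamma> C m")
      case (Left_Cusp p)
      then show ?thesis using SmM by (simp add: path_series_left_cusp)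
    next
      case (Right_Cusp p)
      have "sdeg m (skip_two (strand \<gamma> p) i) = sdeg (Suc m) i"
        "sdeg m (skip_two (strand \<gamma> p) j) = sdeg (Suc m) j"
        using right_cusp_transition[OF m(1) Right_Cusp] ch by (auto simp: is_chord_iff)
      then show ?thesis
        using SmM Right_Cusp ch IH[of "skip_two (strand \<gamma> p) i" "skip_two (strand \<gamma> p) j"]
        by (simp add: path_series_right_cusp)
    next
      case (Handleslide h)
      then obtain u z z' where e: "piece_event \<gamma> C m = Handleslide (u, z, z')" by (cases h) auto
      define k l where "k = strand \<gamma> (u, z)" and "l = strand \<gamma> (u, z')"
      have kl: "k < l" using slide_order[OF m(3) e] by (simp add: k_def l_def)
      note t = slide_transition[OF m(1) e k_def l_def kl]
      have ij: "i \<in> {1..nstr m}" "j \<in> {1..nstr m}" "i < j" using ch t(1) by (auto simp: is_chord_iff)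
      have deg: "sdeg (Suc m) i = sdeg m i" "sdeg (Suc m) j = sdeg m j" using t(3) ij by auto
      have "P m l j \<in> G (sdeg m i - sdeg m j - 1)" if "i = k" using IH[of l j] t(2) that ij by simp
      moreover have "P m i k \<in> G (sdeg m i - sdeg m j - 1)" if "j = l" "i < k"
        using IH[of i k] t(2) that ij kl by simp
      ultimately show ?thesis
        using path_series_handleslide[OF SmM e k_def l_def kl, of i j] ch IH[of i j] deg
        by (auto intro!: mcs_algebra_deg_add)
    next
      case (Crossing p)
      define k where "k = strand \<gamma> p"
      note t = crossing_degree_transition[OF m(1) Crossing k_def]
      have p: "p \<in> generators \<gamma>" using piece_event_CrossingD[OF m(3) Crossing] by (simp add: generators_def)
      have gp: "gen_degree \<gamma> \<mu> p = sdeg m k - sdeg m (Suc k)"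
        using crossing_degree[OF m(2) Crossing] by (simp add: k_def)
      have ij: "i \<in> {1..nstr m}" "j \<in> {1..nstr m}" "i < j" using ch t(1) by (auto simp: is_chord_iff)
      let ?s = "Transposition.transpose k (Suc k)"
      have sd: "sdeg m (?s i) = sdeg (Suc m) i" if "i \<in> {1..nstr m}" for i
        using t that by (cases "i = k"; cases "i = Suc k") auto
      have bit: "of_bit (D m i' j') \<in> G (sdeg m i' - sdeg m j' - 1)" for i' j'
        using D_degree[OF m(2), of i' j'] mcs_algebra_deg_monomial[of "[]" \<gamma> \<mu>]
        by (cases "D m i' j' = 1") (simp_all add: monomial_Nil word_degree_def)
      have sum: "P m i' j' + of_bit (D m i' j') \<in> G (sdeg m i' - sdeg m j' - 1)" for i' j'
        using IH bit by (rule mcs_algebra_deg_add)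
      have 1: "P m (?s i) (?s j) \<in> G (sdeg (Suc m) i - sdeg (Suc m) j - 1)"
        using IH[of "?s i" "?s j"] sd ij by simp
      have 2: "(P m i k + of_bit (D m i k)) * monomial [p] \<in> G (sdeg (Suc m) i - sdeg (Suc m) j - 1)"
        if "j = k"
      proof -
        have eq: "sdeg (Suc m) i - sdeg (Suc m) j - 1 = (sdeg m i - sdeg m k - 1) + gen_degree \<gamma> \<mu> p"
          using t ij that gp by simp
        show ?thesis
          unfolding eq by (rule mcs_algebra_deg_mult[OF sum mcs_algebra_deg_letter[OF p]])
      qed
      have 3: "monomial [p] * (P m (Suc k) j + of_bit (D m (Suc k) j)) \<in> G (sdeg (Suc m) i - sdeg (Suc m) j - 1)"
        if "i = Suc k"
      proof -
        have eq: "sdeg (Suc m) i - sdeg (Suc m) j - 1 = gen_degree \<gamma> \<mu> p + (sdeg m (Suc k) - sdeg m j - 1)"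
          using t ij that gp by simp
        show ?thesis
          unfolding eq by (rule mcs_algebra_deg_mult[OF mcs_algebra_deg_letter[OF p] sum])
      qed
      show ?thesis
        unfolding path_series_crossing[OF SmM Crossing k_def]
        using 1 2 3 by (auto intro!: mcs_algebra_deg_add simp del: transpose_apply_first transpose_apply_second)
    qed
  qed
qed simp

lemma d_gen_eq:
  assumes a: "a \<in> generators \<gamma>" "in_piece C l (fst a)"
  shows "d_gen \<gamma> \<mu> C a = P l (strand \<gamma> a) (Suc (strand \<gamma> a))"
    and "l \<in> {1..M} \<Longrightarrow> gen_degree \<gamma> \<mu> a = sdeg l (strand \<gamma> a) - sdeg l (Suc (strand \<gamma> a))"
proof -
  show deg: "gen_degree \<gamma> \<mu> a = sdeg l (strand \<gamma> a) - sdeg l (Suc (strand \<gamma> a))" if l: "l \<in> {1..M}"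
  proof (cases "a \<in> right_cusps \<gamma>")
    case True
    then have "piece_event \<gamma> C l = Right_Cusp a" using a by (intro right_cusp_event)
    from D_degree[OF l D_right_cusp_1[OF l this]] True show ?thesis by (simp add: gen_degree_def)
  next
    case False
    then show ?thesis using a l crossing_event[of a l] crossing_degree[of l a] by (auto simp: generators_def)
  qed
  show "d_gen \<gamma> \<mu> C a = P l (strand \<gamma> a) (Suc (strand \<gamma> a))"
  proof (rule poly_mapping_eqI)
    fix w :: "plane word"
    obtain v where w: "w = Word v" by (cases w)
    show "lookup (d_gen \<gamma> \<mu> C a) w = lookup (P l (strand \<gamma> a) (Suc (strand \<gamma> a))) w"
    proof (cases "l \<in> {1..M}")
      case True
      then have "lookup (P l (strand \<gamma> a) (Suc (strand \<gamma> a))) (Word v) = 0"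
        if "word_degree \<gamma> \<mu> v \<noteq> gen_degree \<gamma> \<mu> a - 1"
        using P_homogeneous[OF True, of "strand \<gamma> a" "Suc (strand \<gamma> a)"] that
        unfolding mcs_algebra_deg_iff deg[OF True] by (metis in_keys_iff word.sel)
      then show ?thesis
        unfolding w d_gen_eq_path_series_part[OF a] by simp
    next
      case False
      then have "P l (strand \<gamma> a) (Suc (strand \<gamma> a)) = 0"
        by (intro path_series_not_chord) (auto simp: is_chord_iff)
      then show ?thesis
        unfolding w d_gen_eq_path_series_part[OF a] by simp
    qed
  qed
qed

lemma d_gen_homogeneous:
  assumes "a \<in> generators \<gamma>"
  shows "d_gen \<gamma> \<mu> C a \<in> G (gen_degree \<gamma> \<mu> a - 1)"
proof -
  have "\<exists>e\<in>events \<gamma> C. event_x e = fst a"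
    using assms by (force simp: generators_def events_def)
  then obtain l where l: "in_piece C l (fst a)"
    using event_in_some_piece by metis
  show ?thesis
  proof (cases "l \<in> {1..M}")
    case True
    then show ?thesis using d_gen_eq[OF assms l] P_homogeneous[OF True] by simp
  next
    case False
    then have "P l (strand \<gamma> a) (Suc (strand \<gamma> a)) = 0"
      by (intro path_series_not_chord) (auto simp: is_chord_iff)
    then show ?thesis using d_gen_eq(1)[OF assms l] by simp
  qed
qed

text \<open>The entries of the differential enter as constants of the tensor algebra.\<close>

definition X :: "nat \<Rightarrow> nat \<Rightarrow> nat \<Rightarrow> algebra" where
  "X m i j = of_bit (D m i j) + P m i j"

lemma X_upper: "m \<in> {1..M} \<Longrightarrow> j \<le> i \<Longrightarrow> X m i j = 0"
  using D_upper[of m i j] by (cases "D m i j = 1") (auto simp: X_def path_series_not_chord is_chord_iff)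

lemma flat_of_P_0:
  assumes "m \<in> {1..M}" "\<And>i j. P m i j = 0"
  shows "flat d {1..nstr m} (X m)"
  unfolding flat_def
proof (intro ballI)
  fix i j assume ij: "i \<in> {1..nstr m}" "j \<in> {1..nstr m}"
  have "(\<Sum>h\<in>{1..nstr m}. X m i h * X m h j) = of_bit (\<Sum>h\<in>{1..nstr m}. D m i h * D m h j)"
    unfolding of_bit_sum of_bit_mult by (simp add: X_def assms)
  then show "d (X m i j) = (\<Sum>h\<in>{1..nstr m}. X m i h * X m h j)"
    unfolding D_square[OF assms(1) ij] by (simp add: X_def assms d_of_bit)
qed

text \<open>Induction from left to right. The first piece contains no crossing, so there \<open>P = 0\<close> and the
equation reduces to \<open>D\<^sup>2 = 0\<close>; the same happens after each left cusp.\<close>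

lemma X_flat:
  "\<lbrakk>m \<in> {1..M}; \<And>m' p. m' < m \<Longrightarrow> piece_event \<gamma> C m' \<noteq> Right_Cusp p\<rbrakk> \<Longrightarrow> flat d {1..nstr m} (X m)"
proof (induction m)
  case (Suc m)
  show ?case
  proof (cases "m = 0")
    case True
    then show ?thesis using Suc.prems P_1 by (intro flat_of_P_0) auto
  next
    case False
    then have m: "m \<in> {1..<M}" "m \<in> {1..M}" "m \<le> M" and SmM: "Suc m \<le> M" using Suc.prems by auto
    have IH: "flat d {1..nstr m} (X m)" using Suc.IH m(2) Suc.prems(2) by simp
    show ?thesis
    proof (cases "piece_event \<gamma> C m")
      case (Left_Cusp p)
      then show ?thesis using SmM by (intro flat_of_P_0) (simp_all add: path_series_left_cusp)
    next
      case (Right_Cusp p)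
      then show ?thesis using Suc.prems(2)[of m p] by simp
    next
      case (Handleslide h)
      then obtain u z z' where e: "piece_event \<gamma> C m = Handleslide (u, z, z')" by (cases h) auto
      define k l where "k = strand \<gamma> (u, z)" and "l = strand \<gamma> (u, z')"
      have kl: "k < l" using slide_order[OF m(3) e] by (simp add: k_def l_def)
      note t = slide_transition[OF m(1) e k_def l_def kl]
      have Y: "X (Suc m) i j = X m i j + (if i = k then X m l j else 0) + (if j = l then X m i k else 0)"
        if ij: "i \<in> {1..nstr m}" "j \<in> {1..nstr m}" for i j
      proof (cases "i < j")
        case False
        then show ?thesis
          using X_upper[OF m(2)] X_upper[of "Suc m" j i] SmM kl by auto
      next
        case True
        then have ch: "is_chord \<gamma> C (Suc m, i, j)" using ij SmM t(1) by (simp add: is_chord_iff)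
        have "P (Suc m) i j = P m i j + (if i = k then P m l j else 0) + (if j = l then P m i k else 0)"
          using path_series_handleslide[OF SmM e k_def l_def kl, of i j] ch
          by (auto simp: path_series_not_chord is_chord_iff)
        moreover have "of_bit (D (Suc m) i j) =
            (of_bit (D m i j) + (if i = k then of_bit (D m l j) else 0) + (if j = l then of_bit (D m i k) else 0) :: algebra)"
          unfolding t(4)[OF ij] of_bit_add by simp
        ultimately show ?thesis by (simp add: X_def algebra_simps)
      qed
      show ?thesis
      proof (cases "k \<in> {1..nstr m}")
        case True
        then have l: "l \<in> {1..nstr m}" using t(2) by simp
        show ?thesis unfolding t(1)
          by (rule flat_slide[OF IH X_upper[OF m(2)] _ True l kl Y]) simp_all
      next
        case False
        \<comment> \<open>Then \<open>k\<close> exceeds the number of strands, and the mark acts trivially.\<close>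
        have "k \<ge> 1" by (simp add: k_def strand_def)
        with False have "X (Suc m) i j = X m i j" if "i \<in> {1..nstr m}" "j \<in> {1..nstr m}" for i j
          using Y[OF that] that kl by auto
        with IH show ?thesis unfolding t(1) flat_def by simp
      qed
    next
      case (Crossing p)
      define k where "k = strand \<gamma> p"
      note t = crossing_degree_transition[OF m(1) Crossing k_def]
      note D' = crossing_transition(3)[OF m(1) Crossing k_def t(2,3)]
      let ?s = "Transposition.transpose k (Suc k)"
      have s: "?s i \<in> {1..nstr m}" if "i \<in> {1..nstr m}" for i
        using that t(2,3) by (auto simp: Transposition.transpose_def)
      have DS: "D (Suc m) i j = D m (?s i) (?s j)" if "i \<in> {1..nstr m}" "j \<in> {1..nstr m}" for i j
        using D'[OF s[OF that(1)] s[OF that(2)]] by simp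
      have D0: "D m k (Suc k) = 0" using D_crossing_0[OF m(2) Crossing] by (simp add: k_def)
      have "p \<in> generators \<gamma>" "in_piece C m (fst p)"
        using piece_event_CrossingD[OF m(3) Crossing] by (auto simp: generators_def)
      then have dc: "d (monomial [p]) = X m k (Suc k)"
        unfolding X_def D0 by (simp add: mcs_d_letter d_gen_eq(1) k_def)
      have Y: "X (Suc m) i j = (if i \<in> {k, Suc k} \<and> j \<in> {k, Suc k} then 0
       else if j = k then X m i (Suc k) + X m i k * monomial [p]
       else if j = Suc k then X m i k
       else if i = k then X m (Suc k) j
       else if i = Suc k then X m k j + monomial [p] * X m (Suc k) j
       else X m i j)" if ij: "i \<in> {1..nstr m}" "j \<in> {1..nstr m}" for i j
      proof (cases "i < j")
        case False
        then show ?thesis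
          using X_upper[OF m(2)] X_upper[of "Suc m" j i] SmM by auto
      next
        case True
        then have ch: "is_chord \<gamma> C (Suc m, i, j)" using ij SmM t(1) by (simp add: is_chord_iff)
        have D00: "D m (Suc k) k = 0" using D_upper[OF m(2), of "Suc k" k] by (cases "D m (Suc k) k = 1") simp_all
        show ?thesis
          using True ch
          unfolding X_def DS[OF ij] path_series_crossing[OF SmM Crossing k_def]
          by (auto simp: D00 algebra_simps)
      qed
      show ?thesis unfolding t(1)
        by (rule flat_crossing[OF IH X_upper[OF m(2)] _ t(2,3) dc Y]) simp_all
    qed
  qed
qed simp

lemma d_P_adjacent:
  assumes "m \<in> {1..M}" "\<And>m' p. m' < m \<Longrightarrow> piece_event \<gamma> C m' \<noteq> Right_Cusp p"
  shows "d (P m k (Suc k)) = 0"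
proof (cases "is_chord \<gamma> C (m, k, Suc k)")
  case True
  then have "d (X m k (Suc k)) = 0"
    using X_upper[OF assms(1)] by (intro flat_adjacent[OF X_flat[OF assms]]) (auto simp: is_chord_iff)
  then show ?thesis unfolding X_def d_add d_of_bit by simp
qed (simp add: path_series_not_chord)

lemma no_right_cusp_before_crossing:
  assumes "m \<le> M" "piece_event \<gamma> C m = Crossing b" "m' < m"
  shows "piece_event \<gamma> C m' \<noteq> Right_Cusp p"
proof
  assume "piece_event \<gamma> C m' = Right_Cusp p"
  with assms have "p \<in> right_cusps \<gamma>" "in_piece C m' (fst p)" "b \<in> crossings \<gamma>" "in_piece C m (fst b)"
    using piece_event_Right_CuspD[of m' p] piece_event_CrossingD[of m b] by auto
  then show False using right_order[of b p] in_piece_less[of m' "fst p" m "fst b"] assms by auto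
qed

text \<open>A chord \<open>[k, k+1]\<close> is too short to jump along a handleslide mark. Passing a right cusp at
strand \<open>q\<close>, it would become longer only if \<open>q = k+1\<close>, which parity excludes. To the left of a
crossing there are no right cusps, so the Maurer--Cartan equation takes over at the
rightmost crossing.\<close>

lemma d_P_odd:
  assumes "crossings \<gamma> \<noteq> {}"
  shows "m \<le> M \<Longrightarrow> odd k \<Longrightarrow> d (P m k (Suc k)) = 0"
proof (induction m arbitrary: k)
  case 0
  then show ?case by (simp add: path_series_0)
next
  case (Suc m)
  show ?case
  proof (cases "piece_event \<gamma> C m")
    case (Left_Cusp p)
    then show ?thesis using Suc by (simp add: path_series_left_cusp)
  next
    case (Right_Cusp p)
    let ?q = "strand \<gamma> p"
    have "odd ?q"
      using piece_event_Right_CuspD[of m p] Right_Cusp Suc.prems right_odd[OF assms] by simp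
    with Suc.prems have "?q \<noteq> Suc k" by auto
    then have "skip_two ?q (Suc k) = Suc (skip_two ?q k)" by (auto simp: skip_two_def)
    moreover have "odd (skip_two ?q k)" using Suc.prems by (simp add: skip_two_def)
    ultimately show ?thesis
      using Suc Right_Cusp by (simp add: path_series_right_cusp)
  next
    case (Handleslide h)
    then obtain u z z' where e: "piece_event \<gamma> C m = Handleslide (u, z, z')" by (cases h) auto
    show ?thesis
      using path_series_handleslide[OF Suc.prems(1) e refl refl slide_order[OF _ e], of k "Suc k"] Suc
        slide_order[OF _ e]
      by auto
  next
    case (Crossing b)
    have "d (P (Suc m) k (Suc k)) = 0"
    proof (rule d_P_adjacent)
      fix m' p assume "m' < Suc m"
      then show "piece_event \<gamma> C m' \<noteq> Right_Cusp p"
        using no_right_cusp_before_crossing[of m b m' p] Crossing Suc.prems by (cases "m' = m") auto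
    qed (use Suc.prems in auto)
    then show ?thesis .
  qed
qed

lemma d_d_gen: "d (d_gen \<gamma> \<mu> C a) = 0"
proof (cases "a \<in> generators \<gamma>")
  case a: True
  show ?thesis
  proof (cases "a \<in> crossings \<gamma>")
    case True
    obtain l where l: "in_piece C l (fst a)"
      using event_in_some_piece[of "Crossing a"] True by (auto simp: events_def)
    have e: "piece_event \<gamma> C l = Crossing a" by (rule crossing_event[OF True l])
    have "l \<in> {1..M}" using l e no_crossing_0 by (cases l) (auto simp: in_piece_def)
    then show ?thesis
      unfolding d_gen_eq(1)[OF a l] using no_right_cusp_before_crossing[OF _ e]
      by (intro d_P_adjacent) auto
  next
    case False
    then have r: "a \<in> right_cusps \<gamma>" using a by (simp add: generators_def)
    then obtain l where l: "in_piece C l (fst a)"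
      using event_in_some_piece[of "Right_Cusp a"] by (auto simp: events_def)
    show ?thesis
    proof (cases "crossings \<gamma> = {}")
      case True
      then have "P m i j = 0" for m i j
        by (auto simp: path_series_def paths_from_def path_ends_def)
      then show ?thesis unfolding d_gen_eq(1)[OF a l] by simp
    next
      case False
      then show ?thesis unfolding d_gen_eq(1)[OF a l]
        using l right_odd[OF False r] by (intro d_P_odd) (auto simp: in_piece_def)
    qed
  qed
qed (simp add: d_gen_not_generator)

lemma d_homogeneous: "x \<in> G g \<Longrightarrow> d x \<in> G (g - 1)"
proof -
  have w: "d_word \<gamma> \<mu> C w \<in> G (word_degree \<gamma> \<mu> w - 1)" if "set w \<subseteq> generators \<gamma>" for w
    using that
  proof (induction w)
    case (Cons b w)
    have "d_gen \<gamma> \<mu> C b * monomial w \<in> G (gen_degree \<gamma> \<mu> b - 1 + word_degree \<gamma> \<mu> w)"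
      using Cons.prems by (intro mcs_algebra_deg_mult d_gen_homogeneous mcs_algebra_deg_monomial) auto
    moreover have "monomial [b] * d_word \<gamma> \<mu> C w \<in> G (gen_degree \<gamma> \<mu> b + (word_degree \<gamma> \<mu> w - 1))"
      using Cons by (intro mcs_algebra_deg_mult mcs_algebra_deg_letter) auto
    ultimately show ?case
      by (auto simp: word_degree_def algebra_simps intro!: mcs_algebra_deg_add)
  qed simp
  assume x: "x \<in> G g"
  show ?thesis
    unfolding mcs_d_def linear_ext_def
    by (rule mcs_algebra_deg_sum) (use x w in \<open>force simp: mcs_algebra_deg_def mcs_algebra_def\<close>)
qed

lemma d_mcs_algebra: "x \<in> mcs_algebra \<gamma> \<Longrightarrow> d x \<in> mcs_algebra \<gamma>"
proof -
  assume x: "x \<in> mcs_algebra \<gamma>"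
  have sub: "G g \<subseteq> mcs_algebra \<gamma>" for g by (auto simp: mcs_algebra_deg_def)
  have sum: "(\<Sum>i\<in>I. y i) \<in> mcs_algebra \<gamma>" if "\<And>i. i \<in> I \<Longrightarrow> y i \<in> mcs_algebra \<gamma>"
    for I :: "plane word set" and y :: "plane word \<Rightarrow> algebra"
    using that
  proof (induction I rule: infinite_finite_induct)
    case (insert i I)
    then show ?case using keys_add[of "y i" "\<Sum>i\<in>I. y i"] by (auto simp: mcs_algebra_def)
  qed (simp_all add: mcs_algebra_def)
  have "d (Poly_Mapping.single w 1) \<in> mcs_algebra \<gamma>" if "w \<in> keys x" for w
  proof -
    have "monomial (letters w) \<in> G (word_degree \<gamma> \<mu> (letters w))"
      using x that by (intro mcs_algebra_deg_monomial) (auto simp: mcs_algebra_def)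
    from d_homogeneous[OF this] sub show ?thesis by (auto simp: monomial_def)
  qed
  then show "d x \<in> mcs_algebra \<gamma>"
    unfolding mcs_d_def linear_ext_def by (intro sum) (simp add: mcs_d_single[symmetric])
qed

theorem is_dga: "is_dga (mcs_algebra \<gamma>) (mcs_algebra_deg \<gamma> \<mu>) (mcs_d \<gamma> \<mu> C)"
  unfolding is_dga_def
  using d_mcs_algebra d_homogeneous mcs_d_squared_zero[of \<gamma> \<mu> C, OF d_d_gen]
  by (simp add: mcs_d_add mcs_d_leibniz)

end

section \<open>Generic fronts and their cusps\<close>

lemma deriv_translate: "deriv (\<lambda>s. f (s + c)) t = deriv f (t + c)" for f :: "real \<Rightarrow> real"
  by (simp add: deriv_def DERIV_shift)

lemma deriv_shift_invariant: "(\<And>t. f (t + c) = f t) \<Longrightarrow> deriv f (t + c) = deriv f t" for f :: "real \<Rightarrow> real"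
  using deriv_translate[of f c t] by simp

lemma smooth_funD:
  assumes "smooth_fun f"
  shows "(f has_real_derivative deriv f t) (at t)"
    and "(deriv f has_real_derivative (deriv ^^ 2) f t) (at t)"
proof -
  have "(deriv ^^ n) f differentiable (at t)" for n using assms by (simp add: smooth_fun_def)
  from this[of 0] this[of 1]
  show "(f has_real_derivative deriv f t) (at t)"
    "(deriv f has_real_derivative (deriv ^^ 2) f t) (at t)"
    by (simp_all add: DERIV_deriv_iff_real_differentiable numeral_2_eq_2)
qed

locale generic_knot =
  fixes \<gamma> :: "real \<Rightarrow> space"
  assumes legendrian: "legendrian_knot \<gamma>" and generic: "generic_front \<gamma>"
begin

abbreviation "x \<equiv> xc \<gamma>"
abbreviation "y \<equiv> yc \<gamma>"
abbreviation "z \<equiv> zc \<gamma>"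
abbreviation "x' \<equiv> deriv (xc \<gamma>)"
abbreviation "x'' \<equiv> (deriv ^^ 2) (xc \<gamma>)"

lemma smooth: "smooth_fun x" "smooth_fun y" "smooth_fun z"
  using legendrian by (simp_all add: legendrian_knot_def)

lemma has_deriv:
  "(x has_real_derivative x' t) (at t)" "(y has_real_derivative deriv y t) (at t)"
  "(z has_real_derivative deriv z t) (at t)" "(x' has_real_derivative x'' t) (at t)"
  "(deriv z has_real_derivative (deriv ^^ 2) z t) (at t)"
  using smooth smooth_funD by blast+

lemma cont: "continuous_on S x" "continuous_on S y" "continuous_on S z" "continuous_on S x'"
  by (rule continuous_at_imp_continuous_on, use has_deriv DERIV_isCont in blast)+

lemma isCont: "isCont x t" "isCont y t" "isCont z t" "isCont x' t"
  using has_deriv DERIV_isCont by blast+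

lemma gamma_eq: "\<gamma> t = (x t, y t, z t)"
  by (simp add: xc_def yc_def zc_def)

lemma isCont_gamma: "isCont \<gamma> t"
proof -
  have "isCont (\<lambda>t. (x t, y t, z t)) t" by (intro isCont_Pair isCont)
  then show ?thesis by (simp flip: gamma_eq)
qed

lemma front_gamma: "front (\<gamma> t) = (x t, z t)"
  by (simp add: gamma_eq front_def)

lemma z_deriv: "deriv z t = y t * x' t"
  using legendrian by (simp add: legendrian_knot_def)

lemma singular_iff: "singular \<gamma> t \<longleftrightarrow> x' t = 0"
  by (auto simp: singular_def z_deriv)

text \<open>Differentiating \<open>z\<^sub>t = y x\<^sub>t\<close> at a point with \<open>x\<^sub>t = 0\<close> gives \<open>z\<^sub>t\<^sub>t = y x\<^sub>t\<^sub>t\<close>. If \<open>x\<^sub>t\<^sub>t\<close> vanished, so would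
\<open>z\<^sub>t\<^sub>t\<close>, and the point would not be a semicubical cusp.\<close>

lemma second_deriv_nonzero: "x' t = 0 \<Longrightarrow> x'' t \<noteq> 0"
proof
  assume t: "x' t = 0" "x'' t = 0"
  have "((\<lambda>t. y t * x' t) has_real_derivative deriv y t * x' t + x'' t * y t) (at t)"
    by (rule DERIV_mult[OF has_deriv(2,4)])
  then have "(deriv z has_real_derivative deriv y t * x' t + x'' t * y t) (at t)"
    by (simp add: z_deriv[abs_def])
  then have "(deriv ^^ 2) z t = 0" using DERIV_unique[OF has_deriv(5)] t by fastforce
  moreover have "semicubical \<gamma> t" using generic t by (simp add: generic_front_def singular_iff)
  ultimately show False using t by (simp add: semicubical_def)
qed

lemma left_cusp_iff: "left_cusp_at \<gamma> t \<longleftrightarrow> x' t = 0 \<and> x'' t > 0"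
  by (simp add: left_cusp_at_def singular_iff)

lemma right_cusp_iff: "right_cusp_at \<gamma> t \<longleftrightarrow> x' t = 0 \<and> x'' t < 0"
  by (simp add: right_cusp_at_def singular_iff)

lemma cusp_cases: "x' t = 0 \<Longrightarrow> left_cusp_at \<gamma> t \<or> right_cusp_at \<gamma> t"
  using second_deriv_nonzero[of t] by (auto simp: left_cusp_iff right_cusp_iff)

lemma cusps_isolated: "\<exists>e>0. \<forall>s. s \<noteq> t \<and> \<bar>s - t\<bar> < e \<longrightarrow> x' s \<noteq> 0"
proof -
  have "\<forall>\<^sub>F s in at t. x' s \<noteq> 0"
  proof (cases "x' t = 0")
    case False
    then show ?thesis using isCont(4)[of t] tendsto_imp_eventually_ne unfolding isCont_def by blast
  next
    case True
    have "((\<lambda>s. (x' s - x' t) / (s - t)) \<longlongrightarrow> x'' t) (at t)"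
      using has_deriv(4) by (simp add: has_field_derivative_iff)
    from tendsto_imp_eventually_ne[OF this second_deriv_nonzero[OF True]]
    show ?thesis by eventually_elim (auto simp: True)
  qed
  then show ?thesis by (auto simp: eventually_at dist_real_def)
qed

subsection \<open>Periodicity\<close>

lemma periodic: "\<gamma> (t + of_int n) = \<gamma> t"
proof -
  have 1: "\<gamma> (t + 1) = \<gamma> t" for t using legendrian by (simp add: legendrian_knot_def)
  show ?thesis
  proof (induction n rule: int_induct[of _ 0])
    case (step1 n)
    then show ?case using 1[of "t + of_int n"] by (simp add: add.assoc)
  next
    case (step2 n)
    then show ?case using 1[of "t + of_int n - 1"] by (simp add: algebra_simps)
  qed simp
qed

lemma periodic_coords [simp]: "x (t + of_int n) = x t" "y (t + of_int n) = y t" "z (t + of_int n) = z t"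
  using periodic[of t n] by (simp_all add: gamma_eq)

lemma periodic_derivs [simp]: "x' (t + of_int n) = x' t" "x'' (t + of_int n) = x'' t"
proof -
  have 1: "x' (t + of_int n) = x' t" for t by (rule deriv_shift_invariant) simp
  then show "x' (t + of_int n) = x' t" .
  show "x'' (t + of_int n) = x'' t" using deriv_shift_invariant[of x', OF 1] by (simp add: numeral_2_eq_2)
qed

lemma gamma_frac: "\<gamma> (frac t) = \<gamma> t"
  using periodic[of t "- \<lfloor>t\<rfloor>"] by (simp add: frac_def)

lemma gamma_eqD: "\<gamma> s = \<gamma> t \<Longrightarrow> \<exists>n::int. s = t + of_int n"
proof -
  assume "\<gamma> s = \<gamma> t"
  then have "frac s = frac t"
    using legendrian by (auto simp: legendrian_knot_def gamma_frac frac_lt_1 elim!: inj_onD)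
  then have "s = t + of_int (\<lfloor>s\<rfloor> - \<lfloor>t\<rfloor>)" by (simp add: frac_def)
  then show ?thesis by blast
qed

lemma range_gamma: "range \<gamma> = \<gamma> ` {0..1}"
proof -
  have "\<gamma> t \<in> \<gamma> ` {0..1}" for t
    using gamma_frac[of t] by (intro image_eqI[of _ _ "frac t"]) (auto simp: frac_lt_1 less_imp_le)
  then show ?thesis by auto
qed

subsection \<open>Finiteness of fibres\<close>

lemma Rolle_x: "\<lbrakk>a < b; x a = x b\<rbrakk> \<Longrightarrow> \<exists>s. a < s \<and> s < b \<and> x' s = 0"
proof -
  assume ab: "a < b" "x a = x b"
  have "x differentiable (at s)" for s using has_deriv(1)[of s] real_differentiable_def by blast
  from Rolle[OF ab cont(1) this] obtain s where "a < s" "s < b" "DERIV x s :> 0" by blast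
  then show ?thesis using DERIV_unique[OF has_deriv(1)] by blast
qed

text \<open>At an accumulation point \<open>t\<close> of a fibre, the theorem of Rolle produces zeros of \<open>x'\<close> arbitrarily close to
\<open>t\<close> and different from it, contrary to the isolation of cusps.\<close>

lemma finite_fibre_params: "finite {t \<in> {0..1}. x t = w}"
proof (rule ccontr)
  let ?T = "{t \<in> {0..1}. x t = w}"
  assume "infinite ?T"
  moreover have "compact {0..1::real}" by simp
  ultimately obtain t where lim: "t islimpt ?T"
    unfolding compact_eq_Bolzano_Weierstrass by blast
  have "closed ?T"
    using continuous_closed_preimage_constant[OF cont(1), of "{0..1}" w] by simp
  with lim have xt: "x t = w" using closed_limpt by fastforce
  obtain e where e: "e > 0" "\<And>s. s \<noteq> t \<Longrightarrow> \<bar>s - t\<bar> < e \<Longrightarrow> x' s \<noteq> 0" using cusps_isolated by blast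
  obtain s where s: "x s = w" "s \<noteq> t" "\<bar>s - t\<bar> < e"
    using lim e(1) unfolding islimpt_approachable by (fastforce simp: dist_real_def)
  show False
  proof (cases "s < t")
    case True
    then obtain r where "s < r" "r < t" "x' r = 0" using Rolle_x[of s t] s xt by auto
    then show False using e(2)[of r] s by auto
  next
    case False
    then obtain r where "t < r" "r < s" "x' r = 0" using Rolle_x[of t s] s xt by auto
    then show False using e(2)[of r] s by auto
  qed
qed

lemma front_set_iff: "(w, h) \<in> front_set \<gamma> \<longleftrightarrow> (\<exists>t. x t = w \<and> z t = h)"
  unfolding front_set_def image_image front_gamma by auto

lemma finite_front_fibre: "finite {h. (w, h) \<in> front_set \<gamma>}"
proof -
  have "{h. (w, h) \<in> front_set \<gamma>} \<subseteq> z ` {t \<in> {0..1}. x t = w}"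
  proof
    fix h assume "h \<in> {h. (w, h) \<in> front_set \<gamma>}"
    then obtain t where t: "x t = w" "z t = h" by (auto simp: front_set_iff)
    have "x (frac t) = x t" "z (frac t) = z t" using gamma_frac[of t] by (simp_all add: gamma_eq)
    with t show "h \<in> z ` {t \<in> {0..1}. x t = w}"
      by (intro image_eqI[of _ _ "frac t"]) (auto simp: frac_lt_1 less_imp_le)
  qed
  then show ?thesis by (rule finite_subset) (rule finite_imageI[OF finite_fibre_params])
qed

lemma finite_above: "finite {h. h > h0 \<and> (w, h) \<in> front_set \<gamma>}"
  by (rule finite_subset[OF _ finite_front_fibre[of w]]) auto

lemma strand_less:
  assumes "(w, h) \<in> front_set \<gamma>" "h' < h"
  shows "strand \<gamma> (w, h) < strand \<gamma> (w, h')"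
proof -
  have "{k. k > h \<and> (w, k) \<in> front_set \<gamma>} \<subset> {k. k > h' \<and> (w, k) \<in> front_set \<gamma>}"
    using assms by auto
  from psubset_card_mono[OF finite_above this] show ?thesis by (simp add: strand_def)
qed

subsection \<open>Leftmost and rightmost points\<close>

lemma x_frac [simp]: "x (frac t) = x t"
  using gamma_frac[of t] by (simp add: gamma_eq)

text \<open>At a minimum of \<open>x\<close> the derivative vanishes; if the second derivative were negative, then \<open>x\<close>
would decrease further.\<close>

lemma leftmost: "\<exists>t. left_cusp_at \<gamma> t \<and> (\<forall>s. x t \<le> x s)"
proof -
  obtain t where t: "\<And>s. s \<in> {0..1} \<Longrightarrow> x t \<le> x s"
    using continuous_attains_inf[of "{0..1}" x] cont(1) by (metis atLeastAtMost_iff compact_Icc empty_iff order_refl zero_le_one)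
  then have min: "x t \<le> x s" for s using t[of "frac s"] by (simp add: frac_lt_1 less_imp_le)
  have 0: "x' t = 0" by (rule DERIV_local_min[OF has_deriv(1), of 1]) (simp_all add: min)
  have "\<not> x'' t < 0"
  proof
    assume "x'' t < 0"
    from DERIV_neg_dec_right[OF has_deriv(4) this] obtain e where
      e: "e > 0" "\<And>h. 0 < h \<Longrightarrow> h < e \<Longrightarrow> x' (t + h) < 0" by (auto simp: 0)
    have "x (t + e/2) < x t"
    proof (rule DERIV_neg_imp_decreasing_open[of t "t + e/2" x])
      fix s assume "t < s" "s < t + e/2"
      then have "x' s < 0" using e(2)[of "s - t"] e(1) by simp
      then show "\<exists>D. (x has_real_derivative D) (at s) \<and> D < 0" using has_deriv(1) by blast
    qed (use e cont in auto)
    with min[of "t + e/2"] show False by simp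
  qed
  then show ?thesis using 0 min second_deriv_nonzero[OF 0] by (auto simp: left_cusp_iff)
qed

lemma rightmost: "\<exists>t. right_cusp_at \<gamma> t \<and> (\<forall>s. x s \<le> x t)"
proof -
  obtain t where t: "\<And>s. s \<in> {0..1} \<Longrightarrow> x s \<le> x t"
    using continuous_attains_sup[of "{0..1}" x] cont(1) by (metis atLeastAtMost_iff compact_Icc empty_iff order_refl zero_le_one)
  then have max: "x s \<le> x t" for s using t[of "frac s"] by (simp add: frac_lt_1 less_imp_le)
  have 0: "x' t = 0" by (rule DERIV_local_max[OF has_deriv(1), of 1]) (simp_all add: max)
  have "\<not> x'' t > 0"
  proof
    assume "x'' t > 0"
    from DERIV_pos_inc_right[OF has_deriv(4) this] obtain e where
      e: "e > 0" "\<And>h. 0 < h \<Longrightarrow> h < e \<Longrightarrow> x' (t + h) > 0" by (auto simp: 0)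
    have "x t < x (t + e/2)"
    proof (rule DERIV_pos_imp_increasing_open[of t "t + e/2" x])
      fix s assume "t < s" "s < t + e/2"
      then have "x' s > 0" using e(2)[of "s - t"] e(1) by simp
      then show "\<exists>D. (x has_real_derivative D) (at s) \<and> 0 < D" using has_deriv(1) by blast
    qed (use e cont in auto)
    with max[of "t + e/2"] show False by simp
  qed
  then show ?thesis using 0 max second_deriv_nonzero[OF 0] by (auto simp: right_cusp_iff)
qed

subsection \<open>Branches between consecutive cusps\<close>

text \<open>A branch is the part of the knot between consecutive cusps. On it \<open>x\<close> is strictly monotone,
so it projects to the graph of a function over an \<open>x\<close>-interval.\<close>

definition branch :: "real \<Rightarrow> real \<Rightarrow> bool" where
  "branch a b \<longleftrightarrow> a < b \<and> x' a = 0 \<and> x' b = 0 \<and> (\<forall>s. a < s \<and> s < b \<longrightarrow> x' s \<noteq> 0)"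

text \<open>Cusp parameters are isolated and recur with period 1, so the infimum of those beyond \<open>t\<close> is
attained.\<close>

lemma next_cusp: "\<exists>b>t. x' b = 0 \<and> (\<forall>s. t < s \<and> s < b \<longrightarrow> x' s \<noteq> 0)"
proof -
  define S where "S = {s. s > t \<and> x' s = 0}"
  obtain c where "x' c = 0" using leftmost by (auto simp: left_cusp_iff)
  then have "c + of_int (\<lceil>t - c\<rceil> + 1) \<in> S"
    unfolding S_def by (simp add: less_le_trans[OF _ add_mono] del: of_int_add) linarith
  then have ne: "S \<noteq> {}" by blast
  have bdd: "bdd_below S" by (rule bdd_belowI[of _ t]) (simp add: S_def)
  define b where "b = Inf S"
  have low: "s \<in> S \<Longrightarrow> b \<le> s" for s unfolding b_def by (rule cInf_lower[OF _ bdd])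
  have "b \<in> S"
  proof (rule ccontr)
    assume nb: "b \<notin> S"
    obtain e where e: "e > 0" "\<And>s. s \<noteq> b \<Longrightarrow> \<bar>s - b\<bar> < e \<Longrightarrow> x' s \<noteq> 0" using cusps_isolated by blast
    obtain s where s: "s \<in> S" "s < b + e" using cInf_lessD[OF ne, of "b + e"] e(1) by (auto simp: b_def)
    then have "s \<noteq> b" "\<bar>s - b\<bar> < e" using nb low[of s] by auto
    with e(2) s(1) show False by (simp add: S_def)
  qed
  then show ?thesis using low by (intro exI[of _ b]) (force simp: S_def)
qed

lemma previous_cusp: "\<exists>a<t. x' a = 0 \<and> (\<forall>s. a < s \<and> s < t \<longrightarrow> x' s \<noteq> 0)"
proof -
  define S where "S = {s. s < t \<and> x' s = 0}"
  obtain c where "x' c = 0" using leftmost by (auto simp: left_cusp_iff)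
  then have "c + of_int (\<lfloor>t - c\<rfloor> - 1) \<in> S"
    unfolding S_def by (simp del: of_int_diff) linarith
  then have ne: "S \<noteq> {}" by blast
  have bdd: "bdd_above S" by (rule bdd_aboveI[of _ t]) (simp add: S_def)
  define b where "b = Sup S"
  have low: "s \<in> S \<Longrightarrow> s \<le> b" for s unfolding b_def by (rule cSup_upper[OF _ bdd])
  have "b \<in> S"
  proof (rule ccontr)
    assume nb: "b \<notin> S"
    obtain e where e: "e > 0" "\<And>s. s \<noteq> b \<Longrightarrow> \<bar>s - b\<bar> < e \<Longrightarrow> x' s \<noteq> 0" using cusps_isolated by blast
    obtain s where s: "s \<in> S" "b - e < s" using less_cSupD[OF ne, of "b - e"] e(1) by (auto simp: b_def)
    then have "s \<noteq> b" "\<bar>s - b\<bar> < e" using nb low[of s] by auto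
    with e(2) s(1) show False by (simp add: S_def)
  qed
  then show ?thesis using low by (intro exI[of _ b]) (force simp: S_def)
qed

lemma branch_around: "x' t \<noteq> 0 \<Longrightarrow> \<exists>a b. branch a b \<and> a < t \<and> t < b"
proof -
  assume t: "x' t \<noteq> 0"
  obtain a b where "a < t" "x' a = 0" "\<forall>s. a < s \<and> s < t \<longrightarrow> x' s \<noteq> 0"
    "t < b" "x' b = 0" "\<forall>s. t < s \<and> s < b \<longrightarrow> x' s \<noteq> 0"
    using next_cusp previous_cusp by metis
  then show ?thesis using t
    by (intro exI[of _ a] exI[of _ b]) (auto simp: branch_def, metis linorder_neqE)
qed

lemma sign_constant:
  assumes "\<And>s. a < s \<Longrightarrow> s < b \<Longrightarrow> x' s \<noteq> 0" "a < s" "s < b" "a < t" "t < b"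
  shows "x' s > 0 \<longleftrightarrow> x' t > 0"
proof -
  have no: "\<not> (x' s < 0 \<and> x' t > 0)" if "a < s" "s < b" "a < t" "t < b" for s t
  proof
    assume *: "x' s < 0 \<and> x' t > 0"
    have "connected (x' ` {a<..<b})" by (intro connected_continuous_image cont) auto
    moreover have "x' s \<in> x' ` {a<..<b}" "x' t \<in> x' ` {a<..<b}" using that by auto
    ultimately have "0 \<in> x' ` {a<..<b}"
      using * unfolding connected_iff_interval by (meson less_imp_le)
    then show False using assms(1) by auto
  qed
  show ?thesis using no[of s t] no[of t s] assms by (metis linorder_neqE)
qed

lemma branch_increasing:
  assumes b: "\<And>s. a < s \<Longrightarrow> s < b \<Longrightarrow> x' s > 0" and st: "a \<le> s" "s < t" "t \<le> b"
  shows "x s < x t"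
proof (rule DERIV_pos_imp_increasing_open[OF st(2)])
  fix r assume "s < r" "r < t"
  then show "\<exists>D. (x has_real_derivative D) (at r) \<and> 0 < D" using b[of r] st has_deriv(1) by force
qed (rule cont)

lemma branch_decreasing:
  assumes b: "\<And>s. a < s \<Longrightarrow> s < b \<Longrightarrow> x' s < 0" and st: "a \<le> s" "s < t" "t \<le> b"
  shows "x t < x s"
proof (rule DERIV_neg_imp_decreasing_open[OF st(2)])
  fix r assume "s < r" "r < t"
  then show "\<exists>D. (x has_real_derivative D) (at r) \<and> D < 0" using b[of r] st has_deriv(1) by force
qed (rule cont)

lemma near_left_cusp:
  assumes "left_cusp_at \<gamma> t"
  shows "\<exists>e>0. \<forall>s. (t < s \<and> s < t + e \<longrightarrow> x' s > 0) \<and> (t - e < s \<and> s < t \<longrightarrow> x' s < 0)"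
proof -
  have t: "x' t = 0" "x'' t > 0" using assms by (auto simp: left_cusp_iff)
  obtain e1 where e1: "e1 > 0" "\<And>h. 0 < h \<Longrightarrow> h < e1 \<Longrightarrow> 0 < x' (t + h)"
    using DERIV_pos_inc_right[OF has_deriv(4) t(2)] by (auto simp: t)
  obtain e2 where e2: "e2 > 0" "\<And>h. 0 < h \<Longrightarrow> h < e2 \<Longrightarrow> x' (t - h) < 0"
    using DERIV_pos_inc_left[OF has_deriv(4) t(2)] by (auto simp: t)
  show ?thesis
    by (rule exI[of _ "min e1 e2"]) (use e1 e2(1) e1(2)[of "s - t" for s] e2(2)[of "t - s" for s] in auto)
qed

lemma near_right_cusp:
  assumes "right_cusp_at \<gamma> t"
  shows "\<exists>e>0. \<forall>s. (t < s \<and> s < t + e \<longrightarrow> x' s < 0) \<and> (t - e < s \<and> s < t \<longrightarrow> x' s > 0)"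
proof -
  have t: "x' t = 0" "x'' t < 0" using assms by (auto simp: right_cusp_iff)
  obtain e1 where e1: "e1 > 0" "\<And>h. 0 < h \<Longrightarrow> h < e1 \<Longrightarrow> x' (t + h) < 0"
    using DERIV_neg_dec_right[OF has_deriv(4) t(2)] by (auto simp: t)
  obtain e2 where e2: "e2 > 0" "\<And>h. 0 < h \<Longrightarrow> h < e2 \<Longrightarrow> x' (t - h) > 0"
    using DERIV_neg_dec_left[OF has_deriv(4) t(2)] by (auto simp: t)
  show ?thesis
    by (rule exI[of _ "min e1 e2"]) (use e1 e2(1) e1(2)[of "s - t" for s] e2(2)[of "t - s" for s] in auto)
qed

text \<open>The sign of \<open>x'\<close> is constant on a branch and is prescribed near each end by the type of the
cusp, so left and right cusps alternate along the knot.\<close>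

lemma branch_cases:
  assumes "branch a b"
  shows "(left_cusp_at \<gamma> a \<and> right_cusp_at \<gamma> b \<and> (\<forall>s. a < s \<and> s < b \<longrightarrow> x' s > 0)) \<or>
    (right_cusp_at \<gamma> a \<and> left_cusp_at \<gamma> b \<and> (\<forall>s. a < s \<and> s < b \<longrightarrow> x' s < 0))"
proof -
  have ab: "a < b" "x' a = 0" "x' b = 0" and ns: "\<And>s. a < s \<Longrightarrow> s < b \<Longrightarrow> x' s \<noteq> 0"
    using assms by (auto simp: branch_def)
  define m where "m = (a + b) / 2"
  have m: "a < m" "m < b" using ab by (auto simp: m_def)
  have sg: "x' s > 0 \<longleftrightarrow> x' m > 0" if "a < s" "s < b" for s
    using sign_constant[OF ns that m] by simp
  have near_a: "\<exists>s. a < s \<and> s < b \<and> s < a + e" and near_b: "\<exists>s. a < s \<and> s < b \<and> b - e < s"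
    if "e > 0" for e
    using that dense[of a "min b (a + e)"] dense[of "max a (b - e)" b] ab(1) by auto
  have nega: "\<not> x' m > 0" if "right_cusp_at \<gamma> a"
    using near_right_cusp[OF that] near_a sg by (metis order_less_asym)
  have posa: "x' m > 0" if "left_cusp_at \<gamma> a"
    using near_left_cusp[OF that] near_a sg by metis
  have negb: "\<not> x' m > 0" if "left_cusp_at \<gamma> b"
    using near_left_cusp[OF that] near_b sg by (metis order_less_asym)
  have posb: "x' m > 0" if "right_cusp_at \<gamma> b"
    using near_right_cusp[OF that] near_b sg by metis
  show ?thesis
  proof (cases "x' m > 0")
    case True
    then have "left_cusp_at \<gamma> a" "right_cusp_at \<gamma> b"
      using cusp_cases[OF ab(2)] cusp_cases[OF ab(3)] nega negb by auto
    then show ?thesis using True sg by blast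
  next
    case False
    then have "right_cusp_at \<gamma> a" "left_cusp_at \<gamma> b"
      using cusp_cases[OF ab(2)] cusp_cases[OF ab(3)] posa posb by auto
    moreover have "x' s < 0" if "a < s" "s < b" for s using sg[OF that] False ns[OF that] by auto
    ultimately show ?thesis by blast
  qed
qed

end

context generic_knot
begin

section \<open>Transport along branches\<close>

definition same_branch :: "real \<Rightarrow> real \<Rightarrow> bool" where
  "same_branch s t \<longleftrightarrow> (\<forall>r. min s t \<le> r \<and> r \<le> max s t \<longrightarrow> x' r \<noteq> 0)"

text \<open>Over an interval without cusps the front consists of graphs, and a point of the knot
over one line has a unique continuation over every other line of the interval.\<close>

definition cusp_free :: "real \<Rightarrow> real \<Rightarrow> bool" where
  "cusp_free v u \<longleftrightarrow> (\<forall>s. x' s = 0 \<longrightarrow> x s \<notin> {v..u})"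

text \<open>The parameter over \<open>w\<close> on the branch through \<open>t\<close>. The definition is meaningful if \<open>w\<close> and \<open>x t\<close>
lie in a cusp-free interval. Branches live on the real line, not on the circle, so that
\<open>transport\<close> commutes with integer shifts.\<close>

definition transport :: "real \<Rightarrow> real \<Rightarrow> real" where
  "transport w t = (THE t'. same_branch t t' \<and> x t' = w)"

lemma same_branch_sym: "same_branch s t \<Longrightarrow> same_branch t s"
  by (simp add: same_branch_def min.commute max.commute)

lemma same_branch_trans: "same_branch s t \<Longrightarrow> same_branch t r \<Longrightarrow> same_branch s r"
  unfolding same_branch_def by (metis le_max_iff_disj linorder_le_cases min_le_iff_disj)

lemma same_branch_shift: "same_branch s t \<Longrightarrow> same_branch (s + of_int n) (t + of_int n)"
  unfolding same_branch_def
proof (intro allI impI)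
  fix r assume *: "\<forall>r. min s t \<le> r \<and> r \<le> max s t \<longrightarrow> x' r \<noteq> 0"
    and r: "min (s + of_int n) (t + of_int n) \<le> r \<and> r \<le> max (s + of_int n) (t + of_int n)"
  have "min s t \<le> r - of_int n" "r - of_int n \<le> max s t" using r by auto
  with * have "x' (r - of_int n) \<noteq> 0" by blast
  then show "x' r \<noteq> 0" using periodic_derivs(1)[of "r - of_int n" n] by simp
qed

lemma same_branch_inj: "same_branch s t \<Longrightarrow> x s = x t \<Longrightarrow> s = t"
  using Rolle_x[of s t] Rolle_x[of t s] unfolding same_branch_def
  by (cases s t rule: linorder_cases) (force+)

lemma transport_eqI: "same_branch t t' \<Longrightarrow> x t' = w \<Longrightarrow> transport w t = t'"
  unfolding transport_def
proof (rule the_equality)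
  fix s assume "same_branch t t'" "x t' = w" "same_branch t s \<and> x s = w"
  then show "s = t'" using same_branch_inj[of s t'] same_branch_trans same_branch_sym by blast
qed simp

lemma transport_exists:
  assumes cf: "cusp_free v u" and t: "x t \<in> {v..u}" and w: "w \<in> {v..u}"
  shows "\<exists>t'. same_branch t t' \<and> x t' = w"
proof -
  have "x' t \<noteq> 0" using cf t by (auto simp: cusp_free_def)
  then obtain a b where ab: "branch a b" "a < t" "t < b" using branch_around by blast
  have ends: "x a \<notin> {v..u}" "x b \<notin> {v..u}" using ab(1) cf by (auto simp: cusp_free_def branch_def)
  have "\<exists>t'. a \<le> t' \<and> t' \<le> b \<and> x t' = w"
    using branch_cases[OF ab(1)]
  proof
    assume "left_cusp_at \<gamma> a \<and> right_cusp_at \<gamma> b \<and> (\<forall>s. a < s \<and> s < b \<longrightarrow> x' s > 0)"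
    then have "x a < x t" "x t < x b" using branch_increasing[of a b] ab by auto
    then have "x a \<le> w" "w \<le> x b" using ends t w by auto
    then show ?thesis using IVT'[of x a w b] ab cont(1) by auto
  next
    assume "right_cusp_at \<gamma> a \<and> left_cusp_at \<gamma> b \<and> (\<forall>s. a < s \<and> s < b \<longrightarrow> x' s < 0)"
    then have "x t < x a" "x b < x t" using branch_decreasing[of a b] ab by auto
    then have "w \<le> x a" "x b \<le> w" using ends t w by auto
    then show ?thesis using IVT2'[of x b w a] ab cont(1) by auto
  qed
  then obtain t' where t': "a \<le> t'" "t' \<le> b" "x t' = w" by blast
  then have "a < t'" "t' < b" using ends w by (auto simp: less_le)
  then have "a < r \<and> r < b" if "min t t' \<le> r \<and> r \<le> max t t'" for r using that ab by auto
  then have "same_branch t t'" using ab(1) unfolding same_branch_def branch_def by blast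
  with t' show ?thesis by blast
qed

lemma transport:
  assumes "cusp_free v u" "x t \<in> {v..u}" "w \<in> {v..u}"
  shows "same_branch t (transport w t)" "x (transport w t) = w"
proof -
  obtain t' where "same_branch t t'" "x t' = w" using transport_exists[OF assms] by blast
  with transport_eqI[OF this] show "same_branch t (transport w t)" "x (transport w t) = w" by simp_all
qed

lemma same_branch_refl: "cusp_free v u \<Longrightarrow> x t \<in> {v..u} \<Longrightarrow> same_branch t t"
  by (auto simp: same_branch_def cusp_free_def)

lemma transport_self: "cusp_free v u \<Longrightarrow> w \<in> {v..u} \<Longrightarrow> x t = w \<Longrightarrow> transport w t = t"
  by (rule transport_eqI) (auto intro: same_branch_refl)

lemma transport_shift:
  assumes "cusp_free v u" "x t \<in> {v..u}" "w \<in> {v..u}"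
  shows "transport w (t + of_int n) = transport w t + of_int n"
  using transport[OF assms] by (intro transport_eqI) (auto intro: same_branch_shift)

lemma transport_back:
  assumes "cusp_free v u" "x t \<in> {v..u}" "w \<in> {v..u}"
  shows "transport (x t) (transport w t) = t"
  using transport[OF assms] by (intro transport_eqI) (auto intro: same_branch_sym)

text \<open>Points of the knot are parameters modulo integers. Two branches that meet in a point of
the knot differ by an integer shift, hence agree as curves.\<close>

lemma transport_gamma_inj:
  assumes "cusp_free v u" "x s \<in> {v..u}" "x t = x s" "w \<in> {v..u}"
    and "\<gamma> (transport w s) = \<gamma> (transport w t)"
  shows "\<gamma> s = \<gamma> t"
proof -
  obtain n :: int where n: "transport w s = transport w t + of_int n" using gamma_eqD[OF assms(5)] by blast
  have "s = transport (x s) (transport w t + of_int n)"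
    using transport_back[OF assms(1,2,4)] n by simp
  also have "\<dots> = transport (x s) (transport w t) + of_int n"
    using transport(2)[OF assms(1) _ assms(4), of t] assms by (intro transport_shift) auto
  also have "\<dots> = t + of_int n"
    using transport_back[OF assms(1) _ assms(4), of t] assms by simp
  finally show ?thesis by (simp add: periodic)
qed

text \<open>On the compact parameter interval swept out by the branch, \<open>transport\<close> is the inverse of the
continuous injection \<open>x\<close>.\<close>

lemma transport_continuous:
  assumes cf: "cusp_free v u" and t: "x t \<in> {v..u}"
  shows "continuous_on {v..u} (\<lambda>w. transport w t)"
proof -
  have vu: "v \<in> {v..u}" "u \<in> {v..u}" using t by auto
  define p q where "p = min (transport v t) (transport u t)" and "q = max (transport v t) (transport u t)"
  have "continuous_on (x ` {p..q}) (\<lambda>w. transport w t)"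
  proof (rule continuous_on_inv[OF cont(1)])
    have sb: "same_branch t (transport v t)" "same_branch t (transport u t)"
      using transport(1)[OF cf t] vu by auto
    show "\<forall>s\<in>{p..q}. transport (x s) t = s"
    proof
      fix s assume s: "s \<in> {p..q}"
      have "same_branch t s"
        unfolding same_branch_def
      proof (intro allI impI)
        fix r assume r: "min t s \<le> r \<and> r \<le> max t s"
        then have "(min t (transport v t) \<le> r \<and> r \<le> max t (transport v t)) \<or>
            (min t (transport u t) \<le> r \<and> r \<le> max t (transport u t))"
          using s by (auto simp: p_def q_def)
        then show "x' r \<noteq> 0" using sb unfolding same_branch_def by blast
      qed
      then show "transport (x s) t = s" by (rule transport_eqI) simp
    qed
  qed simp
  moreover have "{v..u} \<subseteq> x ` {p..q}"
  proof (rule connected_contains_Icc)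
    show "connected (x ` {p..q})" by (intro connected_continuous_image cont) auto
    have "transport v t \<in> {p..q}" "transport u t \<in> {p..q}" by (auto simp: p_def q_def)
    then show "v \<in> x ` {p..q}" "u \<in> x ` {p..q}"
      using transport(2)[OF cf t] vu by (metis imageI)+
  qed
  ultimately show ?thesis by (rule continuous_on_subset)
qed

text \<open>The parameters between \<open>s\<close> and \<open>t\<close> form a connected set on which the potential is locally
constant.\<close>

lemma maslov_same_branch:
  assumes mu: "maslov_potential \<gamma> \<mu>" and b: "same_branch s t"
  shows "\<mu> (\<gamma> s) = \<mu> (\<gamma> t)"
proof (rule connected_local_const[of "{min s t..max s t}" s t "\<lambda>r. \<mu> (\<gamma> r)"])
  show "\<forall>a\<in>{min s t..max s t}. \<forall>\<^sub>F b in at a within {min s t..max s t}. \<mu> (\<gamma> a) = \<mu> (\<gamma> b)"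
  proof
    fix a assume "a \<in> {min s t..max s t}"
    then have "\<not> singular \<gamma> a" using b by (auto simp: singular_iff same_branch_def)
    then obtain e where e: "e > 0" "\<And>q. q \<in> range \<gamma> \<inter> ball (\<gamma> a) e \<Longrightarrow> \<mu> q = \<mu> (\<gamma> a)"
      using mu unfolding maslov_potential_def by blast
    have "(\<gamma> \<longlongrightarrow> \<gamma> a) (at a within {min s t..max s t})"
      using isCont_gamma[of a] unfolding isCont_def by (rule tendsto_within_subset) simp
    from tendstoD[OF this e(1)]
    show "\<forall>\<^sub>F b in at a within {min s t..max s t}. \<mu> (\<gamma> a) = \<mu> (\<gamma> b)"
      by eventually_elim (use e(2) in \<open>auto simp: dist_commute\<close>)
  qed
qed auto

subsection \<open>Heights of branches\<close>

lemma crossingI: "\<lbrakk>\<gamma> s \<noteq> \<gamma> t; x s = x t; z s = z t\<rbrakk> \<Longrightarrow> (x t, z t) \<in> crossings \<gamma>"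
  unfolding crossings_def crosses_def by (force simp: front_gamma)

definition crossing_free :: "real set \<Rightarrow> bool" where
  "crossing_free W \<longleftrightarrow> (\<forall>q\<in>crossings \<gamma>. fst q \<notin> W)"

lemma crossing_free_gamma_eq:
  "\<lbrakk>crossing_free W; x s = x t; x t \<in> W; z s = z t\<rbrakk> \<Longrightarrow> \<gamma> s = \<gamma> t"
  using crossingI[of s t] unfolding crossing_free_def by force

lemma transport_heights_ne:
  assumes "cusp_free v u" "crossing_free W" "x s = u" "x t = u" "\<gamma> s \<noteq> \<gamma> t" "w \<in> {v..u}" "w \<in> W"
  shows "z (transport w s) \<noteq> z (transport w t)"
proof
  assume z: "z (transport w s) = z (transport w t)"
  have "x (transport w s) = w" "x (transport w t) = w" using transport(2) assms by auto
  then have "\<gamma> (transport w s) = \<gamma> (transport w t)" using crossing_free_gamma_eq assms z by simp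
  then show False using transport_gamma_inj[of v u s t w] assms by auto
qed

lemma height_continuous:
  "cusp_free v u \<Longrightarrow> x t \<in> {v..u} \<Longrightarrow> continuous_on {v..u} (\<lambda>w. z (transport w t))"
  "cusp_free v u \<Longrightarrow> x t \<in> {v..u} \<Longrightarrow> continuous_on {v..u} (\<lambda>w. y (transport w t))"
  using continuous_on_compose2[OF cont(3)[of UNIV] transport_continuous, of v u t]
    continuous_on_compose2[OF cont(2)[of UNIV] transport_continuous, of v u t] by auto

lemma positive_propagates:
  fixes h :: "real \<Rightarrow> real"
  assumes "continuous_on {v..w} h" "\<And>r. r \<in> {v..w} \<Longrightarrow> h r \<noteq> 0" "h w > 0" "v \<le> w"
  shows "h v > 0"
proof (rule ccontr)
  assume "\<not> h v > 0"
  then obtain r where "r \<in> {v..w}" "h r = 0" using IVT'[of h v 0 w] assms by auto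
  then show False using assms(2) by blast
qed

text \<open>Two branches can exchange their order only at a crossing.\<close>

lemma transport_order:
  assumes cf: "cusp_free v u" and nc: "crossing_free {v..<u}" and vu: "v \<le> u"
    and st: "x s = u" "x t = u" "z s > z t"
  shows "z (transport v s) > z (transport v t)"
proof -
  have ne: "\<gamma> s \<noteq> \<gamma> t" using st by (auto simp: gamma_eq)
  have tu: "transport u s = s" "transport u t = t" using transport_self[OF cf, of u] st vu by auto
  have "z (transport v s) - z (transport v t) > 0"
  proof (rule positive_propagates[of v u "\<lambda>w. z (transport w s) - z (transport w t)"])
    show "continuous_on {v..u} (\<lambda>w. z (transport w s) - z (transport w t))"
      by (intro continuous_intros height_continuous cf) (use st vu in auto)
    show "z (transport r s) - z (transport r t) \<noteq> 0" if "r \<in> {v..u}" for r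
    proof (cases "r = u")
      case False
      then show ?thesis using transport_heights_ne[OF cf nc st(1,2) ne, of r] that by auto
    qed (use tu st in simp)
  qed (use tu st vu in auto)
  then show ?thesis by simp
qed

text \<open>Along the knot \<open>dz = y dx\<close>, so \<open>y\<close> is the slope of the front as a graph over \<open>x\<close>.\<close>

lemma height_deriv:
  assumes cf: "cusp_free v u" and t: "x t \<in> {v..u}" and w: "v < w" "w < u"
  shows "((\<lambda>w. z (transport w t)) has_real_derivative y (transport w t)) (at w)"
proof -
  have b: "x (transport r t) = r" "x' (transport r t) \<noteq> 0" if "r \<in> {v..u}" for r
    using transport[OF cf t that] by (auto simp: same_branch_def)
  have "isCont (\<lambda>w. transport w t) w"
    using transport_continuous[OF cf t] w by (intro continuous_on_interior[of "{v..u}"]) auto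
  then have "((\<lambda>w. transport w t) has_real_derivative inverse (x' (transport w t))) (at w)"
    using b w by (intro DERIV_inverse_function[of x _ _ _ v u] has_deriv) auto
  from DERIV_chain2[OF has_deriv(3) this]
  show ?thesis using b(2)[of w] w by (simp add: z_deriv mult.assoc)
qed

text \<open>Near the crossing, and to its left, the difference of the heights has negative derivative
and tends to \<open>0\<close>, so it is positive; further to the left it cannot change sign.\<close>

lemma transport_order_slopes:
  assumes cf: "cusp_free v u" and nc: "crossing_free {v..<u}" and vu: "v < u"
    and st: "x s = u" "x t = u" "z s = z t" "y s < y t"
  shows "z (transport v s) > z (transport v t)"
proof -
  have ne: "\<gamma> s \<noteq> \<gamma> t" using st by (auto simp: gamma_eq)
  have xu: "x s \<in> {v..u}" "x t \<in> {v..u}" using st vu by auto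
  have tu: "transport u s = s" "transport u t = t" using transport_self[OF cf, of u] st vu by auto
  let ?h = "\<lambda>w. z (transport w s) - z (transport w t)"
  let ?g = "\<lambda>w. y (transport w s) - y (transport w t)"
  have ch: "continuous_on {v..u} ?h" and cg: "continuous_on {v..u} ?g"
    by (intro continuous_intros height_continuous cf xu)+
  have "(?g \<longlongrightarrow> ?g u) (at u within {v..u})"
    using cg vu by (simp add: continuous_on_def)
  moreover have "?g u < 0" using tu st by simp
  ultimately have "\<forall>\<^sub>F w in at u within {v..u}. ?g w < 0" by (rule order_tendstoD(2))
  then obtain e where e: "e > 0" "\<And>w. w \<in> {v..u} \<Longrightarrow> w \<noteq> u \<Longrightarrow> \<bar>w - u\<bar> < e \<Longrightarrow> ?g w < 0"
    by (auto simp: eventually_at dist_real_def)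
  \<comment> \<open>A line close enough to the crossing for the slopes to be ordered, but still to the right of \<open>v\<close>.\<close>
  define w where "w = max ((v + u) / 2) (u - e / 2)"
  have w: "v < w" "w < u" "u - e < w" using vu e(1) by (auto simp: w_def max_def)
  have "?h u < ?h w"
  proof (rule DERIV_neg_imp_decreasing_open[of w u ?h])
    fix r assume r: "w < r" "r < u"
    have "(?h has_real_derivative ?g r) (at r)"
      using r w by (intro DERIV_diff height_deriv[OF cf]) (use xu in auto)
    moreover have "?g r < 0" using e(2)[of r] r w by auto
    ultimately show "\<exists>D. (?h has_real_derivative D) (at r) \<and> D < 0" by blast
  next
    show "continuous_on {w..u} ?h" using ch by (rule continuous_on_subset) (use w in auto)
  qed (use w in simp)
  then have hw: "?h w > 0" using tu st by simp
  have "?h v > 0"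
  proof (rule positive_propagates[of v w ?h])
    show "continuous_on {v..w} ?h" using ch by (rule continuous_on_subset) (use w in auto)
    show "?h r \<noteq> 0" if "r \<in> {v..w}" for r
      using transport_heights_ne[OF cf nc st(1,2) ne, of r] that w by auto
  qed (use hw w in auto)
  then show ?thesis by simp
qed

subsection \<open>The strands of a crossing\<close>

lemma finite_fibre: "finite {p \<in> range \<gamma>. fst p = w}"
proof -
  have "{p \<in> range \<gamma>. fst p = w} = \<gamma> ` {t \<in> {0..1}. x t = w}"
    unfolding range_gamma by (auto simp: xc_def)
  then show ?thesis using finite_fibre_params[of w] by simp
qed

lemma strand_le_num_strands: "strand \<gamma> (x t, z t) \<le> num_strands \<gamma> (x t)"
proof -
  let ?A = "{h. h > z t \<and> (x t, h) \<in> front_set \<gamma>}"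
  have "strand \<gamma> (x t, z t) = card (insert (z t) ?A)"
    using finite_above[of "z t" "x t"] by (simp add: strand_def)
  also have "\<dots> \<le> card ((\<lambda>p. snd (snd p)) ` {p \<in> range \<gamma>. fst p = x t})"
  proof (rule card_mono)
    have "h \<in> (\<lambda>p. snd (snd p)) ` {p \<in> range \<gamma>. fst p = x t}" if "(x t, h) \<in> front_set \<gamma>" for h
      using that unfolding front_set_iff xc_def zc_def by force
    moreover have "(x t, z t) \<in> front_set \<gamma>" by (auto simp: front_set_iff)
    ultimately show "insert (z t) ?A \<subseteq> (\<lambda>p. snd (snd p)) ` {p \<in> range \<gamma>. fst p = x t}" by blast
  qed (use finite_fibre in simp)
  also have "\<dots> \<le> num_strands \<gamma> (x t)"
    unfolding num_strands_def by (rule card_image_le[OF finite_fibre])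
  finally show ?thesis .
qed

lemma strand_point_eq:
  assumes nc: "crossing_free {x t}"
  shows "strand_point \<gamma> (x t) (strand \<gamma> (x t, z t)) = \<gamma> t"
  unfolding strand_point_def
proof (rule the_equality)
  show "\<gamma> t \<in> range \<gamma> \<and> fst (\<gamma> t) = x t \<and> strand \<gamma> (front (\<gamma> t)) = strand \<gamma> (x t, z t)"
    by (simp add: front_gamma) (simp add: xc_def)
next
  fix p assume p: "p \<in> range \<gamma> \<and> fst p = x t \<and> strand \<gamma> (front p) = strand \<gamma> (x t, z t)"
  then obtain s where s: "p = \<gamma> s" by blast
  with p have xs: "x s = x t" and eq: "strand \<gamma> (x t, z s) = strand \<gamma> (x t, z t)"
    by (auto simp: front_gamma xc_def)
  have "(x t, z s) \<in> front_set \<gamma>" "(x t, z t) \<in> front_set \<gamma>" using xs by (auto simp: front_set_iff)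
  then have "z s = z t"
    using strand_less[of "x t" "z s" "z t"] strand_less[of "x t" "z t" "z s"] eq
    by (cases "z s" "z t" rule: linorder_cases) auto
  then show "p = \<gamma> t" using crossing_free_gamma_eq[OF nc xs] s by simp
qed

text \<open>Transport to the line \<open>x = v\<close> preserves the order of all branches. The points above the
crossing stay above both of its branches, those below stay below, and the two branches
become adjacent strands, the one of smaller slope on top.\<close>

lemma crossing_strands:
  assumes cr: "crosses \<gamma> s t" "y s < y t" "x s = u"
    and vu: "v < u" and cf: "cusp_free v u" and nc: "crossing_free {v..<u}"
    and uniq: "\<And>q. q \<in> crossings \<gamma> \<Longrightarrow> fst q = u \<Longrightarrow> q = (u, z s)"
  shows "strand \<gamma> (v, z (transport v s)) = strand \<gamma> (u, z s)"
    and "strand \<gamma> (v, z (transport v t)) = Suc (strand \<gamma> (u, z s))"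
proof -
  have xt: "x t = u" and zt: "z t = z s"
    using cr by (auto simp: crosses_def front_gamma)
  \<comment> \<open>Parameters of the points above the crossing, one for each point of the knot.\<close>
  define U where "U = {r \<in> {0..<1}. x r = u \<and> z r > z s}"
  have finU: "finite U" by (rule finite_subset[OF _ finite_fibre_params[of u]]) (auto simp: U_def)
  have vin: "v \<in> {v..u}" "u \<in> {v..u}" using vu by auto
  have rU: "x r \<in> {v..u}" if "x r = u" for r using that vu by auto
  have injg: "r = r'" if "r \<in> U" "r' \<in> U" "\<gamma> r = \<gamma> r'" for r r'
    using that legendrian by (auto simp: U_def legendrian_knot_def dest: inj_onD)
  have inj1: "inj_on z U"
  proof (rule inj_onI)
    fix r r' assume r: "r \<in> U" "r' \<in> U" "z r = z r'"
    have "\<gamma> r = \<gamma> r'"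
    proof (rule ccontr)
      assume "\<gamma> r \<noteq> \<gamma> r'"
      from crossingI[OF this] r have "(u, z r') \<in> crossings \<gamma>" by (auto simp: U_def)
      from uniq[OF this] r show False by (auto simp: U_def)
    qed
    with r show "r = r'" by (intro injg)
  qed
  have inj2: "inj_on (\<lambda>r. z (transport v r)) U"
  proof (rule inj_onI)
    fix r r' assume r: "r \<in> U" "r' \<in> U" "z (transport v r) = z (transport v r')"
    have "\<gamma> r = \<gamma> r'"
      using transport_heights_ne[OF cf nc, of r r' v] r vu by (auto simp: U_def)
    with r show "r = r'" by (intro injg)
  qed
  have gamma_norm: "\<exists>r'. r' \<in> {0..<1} \<and> \<gamma> r' = \<gamma> r" for r
    using gamma_frac[of r] frac_ge_0 frac_lt_1 by (metis atLeastLessThan_iff)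
  have A: "{h. h > z s \<and> (u, h) \<in> front_set \<gamma>} = z ` U"
  proof (intro set_eqI iffI)
    fix h assume "h \<in> {h. h > z s \<and> (u, h) \<in> front_set \<gamma>}"
    then obtain r where r: "x r = u" "z r = h" "h > z s" by (auto simp: front_set_iff)
    obtain r' where "r' \<in> {0..<1}" "\<gamma> r' = \<gamma> r" using gamma_norm by blast
    with r show "h \<in> z ` U" by (intro image_eqI[of _ _ r']) (auto simp: U_def gamma_eq)
  qed (auto simp: U_def front_set_iff)
  have top: "z (transport v s) > z (transport v t)"
    using transport_order_slopes[OF cf nc vu cr(3) xt] zt cr(2) by simp
  have above: "z (transport v r) > z (transport v s)" if "r \<in> U" for r
    using transport_order[OF cf nc, of r s] that vu cr by (auto simp: U_def)
  have classify: "h \<in> (\<lambda>r. z (transport v r)) ` U \<or> h = z (transport v s) \<or> h \<le> z (transport v t)"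
    if h: "(v, h) \<in> front_set \<gamma>" for h
  proof -
    obtain r0 where r0: "x r0 = v" "z r0 = h" using h by (auto simp: front_set_iff)
    define r where "r = transport u r0"
    have xr: "x r = u" and ret: "transport v r = r0"
      using transport(2)[OF cf _ vin(2), of r0] transport_back[OF cf _ vin(2), of r0] r0 vin
      by (auto simp: r_def)
    obtain r' where r': "r' \<in> {0..<1}" "\<gamma> r' = \<gamma> r" using gamma_norm by blast
    have hz: "z (transport v r'') = h" if g: "\<gamma> r'' = \<gamma> r" for r''
    proof -
      obtain n :: int where "r'' = r + of_int n" using gamma_eqD[OF g] by blast
      then show ?thesis using transport_shift[OF cf rU[OF xr] vin(1)] ret r0 by simp
    qed
    \<comment> \<open>A point over \<open>v\<close> comes from above the crossing, from below it, or from one of its two branches.\<close>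
    consider "z r > z s" | "z r < z s" | "z r = z s" by linarith
    then show ?thesis
    proof cases
      case 1
      then have "r' \<in> U" using r' xr by (auto simp: U_def gamma_eq)
      then show ?thesis using hz[OF r'(2)] by blast
    next
      case 2
      then show ?thesis using transport_order[OF cf nc _ xt xr] zt vu hz[OF refl] by auto
    next
      case 3
      have "\<gamma> r = \<gamma> s \<or> \<gamma> r = \<gamma> t"
      proof (rule ccontr)
        assume "\<not> ?thesis"
        then have "crosses \<gamma> s t \<and> crosses \<gamma> t r \<and> crosses \<gamma> s r"
          using cr(1) 3 xr xt zt cr(3) by (auto simp: crosses_def front_gamma)
        then show False using generic unfolding generic_front_def by blast
      qed
      then show ?thesis using hz[of s] hz[of t] by auto
    qed
  qed
  have onfront: "(v, z (transport v r)) \<in> front_set \<gamma>" if "x r = u" for r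
    using transport(2)[OF cf rU[OF that] vin(1)] by (auto simp: front_set_iff)
  have As: "{h. h > z (transport v s) \<and> (v, h) \<in> front_set \<gamma>} = (\<lambda>r. z (transport v r)) ` U"
    using classify above top onfront by (fastforce simp: U_def)
  have At: "{h. h > z (transport v t) \<and> (v, h) \<in> front_set \<gamma>} = insert (z (transport v s)) ((\<lambda>r. z (transport v r)) ` U)"
    using classify above top onfront[of s] onfront cr(3) by (fastforce simp: U_def)
  show "strand \<gamma> (v, z (transport v s)) = strand \<gamma> (u, z s)"
    unfolding strand_def fst_conv snd_conv A As by (simp add: card_image inj1 inj2)
  have "z (transport v s) \<notin> (\<lambda>r. z (transport v r)) ` U" using above by force
  then show "strand \<gamma> (v, z (transport v t)) = Suc (strand \<gamma> (u, z s))"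
    unfolding strand_def fst_conv snd_conv A At by (simp add: card_image inj1 inj2 finU)
qed

text \<open>There are no triple points, so exactly two slopes occur at a crossing.\<close>

lemma gen_degree_crossing:
  assumes cr: "crosses \<gamma> s t" "y s < y t" and nr: "(x s, z s) \<notin> right_cusps \<gamma>"
  shows "gen_degree \<gamma> \<mu> (x s, z s) = \<mu> (\<gamma> s) - \<mu> (\<gamma> t)"
proof -
  have xt: "x t = x s" and zt: "z t = z s" using cr by (auto simp: crosses_def front_gamma)
  have "{h. (x s, h, z s) \<in> range \<gamma>} = {y s, y t}"
  proof (intro set_eqI iffI)
    fix h assume "h \<in> {h. (x s, h, z s) \<in> range \<gamma>}"
    then obtain r where r: "x r = x s" "y r = h" "z r = z s" by (auto simp: gamma_eq)
    have "\<gamma> r = \<gamma> s \<or> \<gamma> r = \<gamma> t"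
    proof (rule ccontr)
      assume "\<not> ?thesis"
      then have "crosses \<gamma> s t \<and> crosses \<gamma> t r \<and> crosses \<gamma> s r"
        using cr(1) r xt zt by (auto simp: crosses_def front_gamma)
      then show False using generic unfolding generic_front_def by blast
    qed
    then show "h \<in> {y s, y t}" using r by (auto simp: gamma_eq)
  next
    fix h assume "h \<in> {y s, y t}"
    then show "h \<in> {h. (x s, h, z s) \<in> range \<gamma>}"
      using gamma_eq[of s] gamma_eq[of t] xt zt by (metis (mono_tags) insertE mem_Collect_eq rangeI singletonD)
  qed
  then show ?thesis
    using nr cr(2) gamma_eq[of s] gamma_eq[of t] xt zt
    by (simp add: gen_degree_def Let_def min_def max_def)
qed

lemma crossing_data:
  assumes p: "p \<in> crossings \<gamma>" and vu: "v < fst p" and cf: "cusp_free v (fst p)"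
    and nc: "crossing_free {v..<fst p}"
    and uniq: "\<And>q. q \<in> crossings \<gamma> \<Longrightarrow> fst q = fst p \<Longrightarrow> q = p"
    and mu: "maslov_potential \<gamma> \<mu>"
  shows "Suc (strand \<gamma> p) \<le> num_strands \<gamma> v"
    and "gen_degree \<gamma> \<mu> p = \<mu> (strand_point \<gamma> v (strand \<gamma> p)) - \<mu> (strand_point \<gamma> v (Suc (strand \<gamma> p)))"
proof -
  obtain s t where cr: "crosses \<gamma> s t" and ps: "p = (x s, z s)" and yst: "y s < y t"
  proof -
    obtain s t where st: "crosses \<gamma> s t" "p = (x t, z t)"
      using p by (auto simp: crossings_def front_gamma)
    then have eqs: "x s = x t" "z s = z t" "\<gamma> s \<noteq> \<gamma> t" and "crosses \<gamma> t s"
      by (auto simp: crosses_def front_gamma)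
    moreover have "y s \<noteq> y t" using eqs gamma_eq[of s] gamma_eq[of t] by auto
    ultimately show ?thesis using that[of s t] that[of t s] st by (cases "y s < y t") auto
  qed
  have xs: "x s = fst p" and xt: "x t = fst p" using cr ps by (auto simp: crosses_def front_gamma)
  let ?S = "transport v s" and ?T = "transport v t"
  have xin: "x s \<in> {v..fst p}" "x t \<in> {v..fst p}" "v \<in> {v..fst p}" using vu xs xt by auto
  note S = transport[OF cf xin(1,3)] and T = transport[OF cf xin(2,3)]
  have st: "strand \<gamma> (v, z ?S) = strand \<gamma> p" "strand \<gamma> (v, z ?T) = Suc (strand \<gamma> p)"
    using crossing_strands[OF cr yst xs vu cf nc] uniq ps by auto
  then show "Suc (strand \<gamma> p) \<le> num_strands \<gamma> v"
    using strand_le_num_strands[of ?T] T(2) by simp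
  have ncv: "crossing_free {v}" using nc vu by (auto simp: crossing_free_def)
  have pts: "strand_point \<gamma> v (strand \<gamma> p) = \<gamma> ?S" "strand_point \<gamma> v (Suc (strand \<gamma> p)) = \<gamma> ?T"
    using strand_point_eq[of ?S] strand_point_eq[of ?T] ncv S(2) T(2) st by auto
  have "p \<notin> right_cusps \<gamma>"
    using cf xin unfolding right_cusps_def
    by (auto simp: right_cusp_iff front_gamma cusp_free_def)
  then show "gen_degree \<gamma> \<mu> p = \<mu> (strand_point \<gamma> v (strand \<gamma> p)) - \<mu> (strand_point \<gamma> v (Suc (strand \<gamma> p)))"
    using gen_degree_crossing[OF cr yst, of \<mu>] ps maslov_same_branch[OF mu S(1)] maslov_same_branch[OF mu T(1)] pts
    by simp
qed

end

lemma nonvanishing_sign: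
  fixes h :: "real \<Rightarrow> real"
  assumes "continuous_on {a..b} h" "\<And>r. r \<in> {a..b} \<Longrightarrow> h r \<noteq> 0" "h a > 0" "a \<le> b"
  shows "h b > 0"
proof (rule ccontr)
  assume "\<not> h b > 0"
  then obtain r where "r \<in> {a..b}" "h r = 0" using IVT2'[of h b 0 a] assms by auto
  then show False using assms(2) by blast
qed

text \<open>The graph of \<open>g\<close> is closed, being the zero set of a continuous function, and \<open>g\<close> takes
values in a compact interval.\<close>

lemma continuous_root:
  fixes X :: "real \<Rightarrow> real \<Rightarrow> real"
  assumes X: "continuous_on ({0..1} \<times> UNIV) (\<lambda>(s, t). X s t)" and c: "continuous_on {0..1} c"
    and g: "\<And>s. s \<in> {0..1} \<Longrightarrow> g s \<in> {a..b} \<and> X s (g s) = c s"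
    and uniq: "\<And>s t. s \<in> {0..1} \<Longrightarrow> t \<in> {a..b} \<Longrightarrow> X s t = c s \<Longrightarrow> t = g s"
  shows "continuous_on {0..1} g"
proof (rule continuous_from_closed_graph[of "{a..b}"])
  let ?f = "\<lambda>st :: real \<times> real. X (fst st) (snd st) - c (fst st)"
  have "continuous_on ({0..1} \<times> {a..b}) (\<lambda>st. X (fst st) (snd st))"
    using continuous_on_subset[OF X, of "{0..1} \<times> {a..b}"] by (simp add: case_prod_beta Sigma_mono)
  moreover have "continuous_on ({0..1} \<times> {a..b}) (\<lambda>st. c (fst st))"
    by (rule continuous_on_compose2[OF c continuous_on_fst[OF continuous_on_id]]) auto
  ultimately have "continuous_on ({0..1} \<times> {a..b}) ?f" by (rule continuous_on_diff)
  then have "closed {st \<in> {0..1} \<times> {a..b}. ?f st = 0}"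
    by (rule continuous_closed_preimage_constant) (simp add: closed_Times)
  moreover have "(\<lambda>s. (s, g s)) ` {0..1} = {st \<in> {0..1} \<times> {a..b}. ?f st = 0}"
    using g uniq by (auto simp: image_iff)
  ultimately show "closed ((\<lambda>s. (s, g s)) ` {0..1})" by simp
qed (use g in auto)

context generic_knot
begin

text \<open>The tangent vector of the front vanishes at a cusp, so a crossing there would not be transverse.\<close>

lemma cusp_not_crossing:
  assumes "x' s = 0" "x s = x t" "z s = z t"
  shows "\<gamma> s = \<gamma> t"
proof (rule ccontr)
  assume "\<gamma> s \<noteq> \<gamma> t"
  then have "crosses \<gamma> s t" using assms by (simp add: crosses_def front_gamma)
  then have "x' s * deriv z t \<noteq> x' t * deriv z s" using generic by (simp add: generic_front_def)
  then show False using assms by (simp add: z_deriv)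
qed

lemma branch_neighbours:
  assumes "right_cusp_at \<gamma> r"
  shows "\<exists>a b. branch a r \<and> branch r b"
  using next_cusp[of r] previous_cusp[of r] assms unfolding branch_def right_cusp_iff by metis

lemma left_of_right_cusp:
  "right_cusp_at \<gamma> r \<Longrightarrow> branch a r \<Longrightarrow> left_cusp_at \<gamma> a \<and> (\<forall>s. a < s \<and> s < r \<longrightarrow> x' s > 0)"
  using branch_cases[of a r] by (auto simp: right_cusp_iff left_cusp_iff)

lemma right_of_right_cusp:
  "right_cusp_at \<gamma> r \<Longrightarrow> branch r b \<Longrightarrow> left_cusp_at \<gamma> b \<and> (\<forall>s. r < s \<and> s < b \<longrightarrow> x' s < 0)"
  using branch_cases[of r b] by (auto simp: right_cusp_iff left_cusp_iff)

lemma unique_on_left_branch: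
  assumes r: "right_cusp_at \<gamma> r" "branch a r" and w: "x a \<le> w" "w \<le> x r"
  shows "\<exists>!t. t \<in> {a..r} \<and> x t = w"
proof -
  have ar: "a < r" using r by (simp add: branch_def)
  obtain t where "a \<le> t" "t \<le> r" "x t = w" using IVT'[of x a w r] ar w cont(1) by auto
  moreover have "x t1 < x t2" if "t1 \<in> {a..r}" "t2 \<in> {a..r}" "t1 < t2" for t1 t2
    using branch_increasing[of a r t1 t2] left_of_right_cusp[OF r] that by auto
  ultimately show ?thesis by (metis atLeastAtMost_iff linorder_neqE less_irrefl)
qed

lemma unique_on_right_branch:
  assumes r: "right_cusp_at \<gamma> r" "branch r b" and w: "x b \<le> w" "w \<le> x r"
  shows "\<exists>!t. t \<in> {r..b} \<and> x t = w"
proof -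
  have rb: "r < b" using r by (simp add: branch_def)
  obtain t where "r \<le> t" "t \<le> b" "x t = w" using IVT2'[of x b w r] rb w cont(1) by auto
  moreover have "x t2 < x t1" if "t1 \<in> {r..b}" "t2 \<in> {r..b}" "t1 < t2" for t1 t2
    using branch_decreasing[of r b t1 t2] right_of_right_cusp[OF r] that by auto
  ultimately show ?thesis by (metis atLeastAtMost_iff linorder_neqE less_irrefl)
qed

end

section \<open>Nearly plat fronts\<close>

locale plat_perturbation =
  fixes \<Gamma> :: "real \<Rightarrow> real \<Rightarrow> space"
  assumes perturbation: "slight_perturbation \<Gamma>" and plat: "plat (\<Gamma> 0)"
begin

abbreviation "X s \<equiv> xc (\<Gamma> s)"
abbreviation "Z s \<equiv> zc (\<Gamma> s)"

lemma knot: "s \<in> {0..1} \<Longrightarrow> generic_knot (\<Gamma> s)"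
  using perturbation unfolding slight_perturbation_def generic_knot_def by blast

lemma cusps_constant:
  assumes "s \<in> {0..1}"
  shows "left_cusp_at (\<Gamma> s) t \<longleftrightarrow> left_cusp_at (\<Gamma> 0) t"
    and "right_cusp_at (\<Gamma> s) t \<longleftrightarrow> right_cusp_at (\<Gamma> 0) t"
    and "crosses (\<Gamma> s) t t' \<longleftrightarrow> crosses (\<Gamma> 0) t t'"
  using perturbation assms unfolding slight_perturbation_def by blast+

lemma critical_constant: "s \<in> {0..1} \<Longrightarrow> deriv (X s) t = 0 \<longleftrightarrow> deriv (X 0) t = 0"
  using cusps_constant[of s t] generic_knot.cusp_cases[OF knot, of s t] generic_knot.cusp_cases[OF knot, of 0 t]
    generic_knot.left_cusp_iff[OF knot, of s t] generic_knot.left_cusp_iff[OF knot, of 0 t]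
    generic_knot.right_cusp_iff[OF knot, of s t] generic_knot.right_cusp_iff[OF knot, of 0 t]
  by auto

lemma branch_constant: "s \<in> {0..1} \<Longrightarrow> generic_knot.branch (\<Gamma> s) a b \<longleftrightarrow> generic_knot.branch (\<Gamma> 0) a b"
  using critical_constant[of s] generic_knot.branch_def[OF knot, of s] generic_knot.branch_def[OF knot, of 0]
  by simp

lemma X_continuous: "continuous_on ({0..1} \<times> UNIV) (\<lambda>(s, t). X s t)"
  and Z_continuous: "continuous_on ({0..1} \<times> UNIV) (\<lambda>(s, t). Z s t)"
proof -
  have "continuous_on ({0..1} \<times> UNIV) (\<lambda>(s, t). \<Gamma> s t)"
    using perturbation unfolding slight_perturbation_def by blast
  then have c: "continuous_on ({0..1} \<times> UNIV) (\<lambda>st. \<Gamma> (fst st) (snd st))" by (simp add: case_prod_beta)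
  show "continuous_on ({0..1} \<times> UNIV) (\<lambda>(s, t). X s t)" "continuous_on ({0..1} \<times> UNIV) (\<lambda>(s, t). Z s t)"
    unfolding xc_def zc_def case_prod_beta by (intro continuous_intros c)+
qed

lemma continuous_along:
  assumes "continuous_on {0..1} g"
  shows "continuous_on {0..1} (\<lambda>s. X s (g s))" and "continuous_on {0..1} (\<lambda>s. Z s (g s))"
proof -
  have g: "continuous_on {0..1} (\<lambda>s. (s, g s))" by (intro continuous_intros assms)
  show "continuous_on {0..1} (\<lambda>s. X s (g s))" "continuous_on {0..1} (\<lambda>s. Z s (g s))"
    using continuous_on_compose2[OF X_continuous g] continuous_on_compose2[OF Z_continuous g] by auto
qed

lemma crossing_cusp_x_ne:
  assumes "s \<in> {0..1}" "crosses (\<Gamma> 0) c c'" "left_cusp_at (\<Gamma> 0) t \<or> right_cusp_at (\<Gamma> 0) t"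
  shows "X s c \<noteq> X s t"
proof -
  interpret K: generic_knot "\<Gamma> s" by (rule knot[OF assms(1)])
  have "crosses (\<Gamma> s) c c'" using assms cusps_constant by blast
  then have "crosses (\<Gamma> s) c' c" by (auto simp: crosses_def)
  then have "front (\<Gamma> s c) \<in> crossings (\<Gamma> s)" by (auto simp: crossings_def)
  moreover have "front (\<Gamma> s t) \<in> left_cusps (\<Gamma> s) \<union> right_cusps (\<Gamma> s)"
    using assms cusps_constant(1,2)[OF assms(1), of t] by (auto simp: left_cusps_def right_cusps_def)
  ultimately have "fst (front (\<Gamma> s c)) \<noteq> fst (front (\<Gamma> s t))"
    using perturbation assms(1) unfolding slight_perturbation_def by blast
  then show ?thesis by (simp add: K.front_gamma)
qed

lemma plat_left: "\<lbrakk>left_cusp_at (\<Gamma> 0) t; left_cusp_at (\<Gamma> 0) t'\<rbrakk> \<Longrightarrow> X 0 t = X 0 t'"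
  and plat_right: "\<lbrakk>right_cusp_at (\<Gamma> 0) t; right_cusp_at (\<Gamma> 0) t'\<rbrakk> \<Longrightarrow> X 0 t = X 0 t'"
proof -
  interpret K: generic_knot "\<Gamma> 0" by (rule knot) simp
  have fx: "fst (front (\<Gamma> 0 t)) = X 0 t" for t by (simp add: K.front_gamma)
  have "fst (front (\<Gamma> 0 t)) = fst (front (\<Gamma> 0 t'))"
    if "left_cusp_at (\<Gamma> 0) t" "left_cusp_at (\<Gamma> 0) t'"
    using plat that unfolding plat_def left_cusps_def by blast
  then show "\<lbrakk>left_cusp_at (\<Gamma> 0) t; left_cusp_at (\<Gamma> 0) t'\<rbrakk> \<Longrightarrow> X 0 t = X 0 t'"
    unfolding fx .
  have "fst (front (\<Gamma> 0 t)) = fst (front (\<Gamma> 0 t'))"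
    if "right_cusp_at (\<Gamma> 0) t" "right_cusp_at (\<Gamma> 0) t'"
    using plat that unfolding plat_def right_cusps_def by blast
  then show "\<lbrakk>right_cusp_at (\<Gamma> 0) t; right_cusp_at (\<Gamma> 0) t'\<rbrakk> \<Longrightarrow> X 0 t = X 0 t'"
    unfolding fx .
qed

text \<open>In the plat front all left cusps share the smallest \<open>x\<close>-coordinate. During the perturbation
the \<open>x\<close>-coordinates of a crossing and of a cusp never coincide, so their order persists.\<close>

lemma left_cusp_before_crossing:
  assumes s: "s \<in> {0..1}" and c: "crosses (\<Gamma> 0) c c'" and t: "left_cusp_at (\<Gamma> 0) t"
  shows "X s t < X s c"
proof -
  have "X s c - X s t > 0"
  proof (rule nonvanishing_sign[of 0 s "\<lambda>s. X s c - X s t"])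
    show "continuous_on {0..s} (\<lambda>s. X s c - X s t)"
      by (rule continuous_on_subset[of "{0..1}"]) (use s in \<open>auto intro!: continuous_intros continuous_along\<close>)
    show "X r c - X r t \<noteq> 0" if "r \<in> {0..s}" for r
      using crossing_cusp_x_ne[of r c c' t] that s c t by auto
    interpret K: generic_knot "\<Gamma> 0" by (rule knot) simp
    obtain m where "left_cusp_at (\<Gamma> 0) m" "\<And>r. X 0 m \<le> X 0 r" using K.leftmost by blast
    then have "X 0 t \<le> X 0 c" using plat_left[OF t] by metis
    then show "X 0 c - X 0 t > 0" using crossing_cusp_x_ne[of 0 c c' t] c t by auto
  qed (use s in auto)
  then show ?thesis by simp
qed

lemma crossing_before_right_cusp:
  assumes s: "s \<in> {0..1}" and c: "crosses (\<Gamma> 0) c c'" and t: "right_cusp_at (\<Gamma> 0) t"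
  shows "X s c < X s t"
proof -
  have "X s t - X s c > 0"
  proof (rule nonvanishing_sign[of 0 s "\<lambda>s. X s t - X s c"])
    show "continuous_on {0..s} (\<lambda>s. X s t - X s c)"
      by (rule continuous_on_subset[of "{0..1}"]) (use s in \<open>auto intro!: continuous_intros continuous_along\<close>)
    show "X r t - X r c \<noteq> 0" if "r \<in> {0..s}" for r
      using crossing_cusp_x_ne[of r c c' t] that s c t by auto
    interpret K: generic_knot "\<Gamma> 0" by (rule knot) simp
    obtain m where "right_cusp_at (\<Gamma> 0) m" "\<And>r. X 0 r \<le> X 0 m" using K.rightmost by blast
    then have "X 0 c \<le> X 0 t" using plat_right[OF t] by metis
    then show "X 0 t - X 0 c > 0" using crossing_cusp_x_ne[of 0 c c' t] c t by auto
  qed (use s in auto)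
  then show ?thesis by simp
qed

lemma gamma_eq_constant: "\<lbrakk>s \<in> {0..1}; \<Gamma> s t = \<Gamma> s t'\<rbrakk> \<Longrightarrow> r \<in> {0..1} \<Longrightarrow> \<Gamma> r t = \<Gamma> r t'"
  using generic_knot.gamma_eqD[OF knot, of s t t'] generic_knot.periodic[OF knot, of r t'] by auto

text \<open>The two branches ending at the right cusp \<open>r\<close> do not enclose another right cusp \<open>p\<close>. Let \<open>F s\<close> be the product
of the signed heights of these branches above \<open>p\<close>, at time \<open>s\<close> of the perturbation and over
the line through \<open>p\<close>. At the last time \<open>s0\<close> at which \<open>p\<close> and \<open>r\<close> have equal \<open>x\<close>-coordinate,
which exists because they do at time \<open>0\<close>, both points are \<open>r\<close> itself and \<open>F s0\<close> is a square.
Afterwards \<open>F\<close> does not vanish, as no branch runs through a cusp. Hence \<open>F 1 > 0\<close>.\<close>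

lemma right_cusps_not_nested:
  assumes c: "crosses (\<Gamma> 0) c c'"
    and p: "right_cusp_at (\<Gamma> 0) p" and r: "right_cusp_at (\<Gamma> 0) r"
    and br: "generic_knot.branch (\<Gamma> 0) a r" "generic_knot.branch (\<Gamma> 0) r b"
    and pr: "X 1 p < X 1 r"
    and \<alpha>: "\<alpha> \<in> {a..r}" "X 1 \<alpha> = X 1 p" and \<beta>: "\<beta> \<in> {r..b}" "X 1 \<beta> = X 1 p"
  shows "(Z 1 \<alpha> - Z 1 p) * (Z 1 \<beta> - Z 1 p) > 0"
proof -
  \<comment> \<open>Taking the minimum keeps the two points defined when \<open>p\<close> is to the right of \<open>r\<close>.\<close>
  define w where "w s = min (X s p) (X s r)" for s
  have one: "(1::real) \<in> {0..1}" by simp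
  have bs: "generic_knot.branch (\<Gamma> s) a r" "generic_knot.branch (\<Gamma> s) r b"
    and rs: "right_cusp_at (\<Gamma> s) r" "right_cusp_at (\<Gamma> s) p" if "s \<in> {0..1}" for s
    using br r p branch_constant[OF that] cusps_constant[OF that] by auto
  have lc: "left_cusp_at (\<Gamma> 0) a" "left_cusp_at (\<Gamma> 0) b"
    using generic_knot.left_of_right_cusp[OF knot rs(1) bs(1), of 0]
      generic_knot.right_of_right_cusp[OF knot rs(1) bs(2), of 0] by auto
  have low: "X s a < w s" "X s b < w s" if "s \<in> {0..1}" for s
    using left_cusp_before_crossing[OF that c lc(1)] left_cusp_before_crossing[OF that c lc(2)]
      crossing_before_right_cusp[OF that c p] crossing_before_right_cusp[OF that c r] by (auto simp: w_def)
  define A where "A s = (THE t. t \<in> {a..r} \<and> X s t = w s)" for s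
  define B where "B s = (THE t. t \<in> {r..b} \<and> X s t = w s)" for s
  have exA: "\<exists>!t. t \<in> {a..r} \<and> X s t = w s" and exB: "\<exists>!t. t \<in> {r..b} \<and> X s t = w s" if s: "s \<in> {0..1}" for s
    using generic_knot.unique_on_left_branch[OF knot[OF s] rs(1)[OF s] bs(1)[OF s], of "w s"]
      generic_knot.unique_on_right_branch[OF knot[OF s] rs(1)[OF s] bs(2)[OF s], of "w s"] low[OF s]
    by (auto simp: w_def)
  have A: "A s \<in> {a..r} \<and> X s (A s) = w s" "B s \<in> {r..b} \<and> X s (B s) = w s" if s: "s \<in> {0..1}" for s
    unfolding A_def B_def using theI'[OF exA[OF s]] theI'[OF exB[OF s]] by auto
  have uA: "t = A s" if "s \<in> {0..1}" "t \<in> {a..r}" "X s t = w s" for s t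
    using exA[OF that(1)] A(1)[OF that(1)] that by blast
  have uB: "t = B s" if "s \<in> {0..1}" "t \<in> {r..b}" "X s t = w s" for s t
    using exB[OF that(1)] A(2)[OF that(1)] that by blast
  have cw: "continuous_on {0..1} w"
    unfolding w_def by (intro continuous_intros continuous_along)
  have cA: "continuous_on {0..1} A" by (rule continuous_root[OF X_continuous cw A(1) uA])
  have cB: "continuous_on {0..1} B" by (rule continuous_root[OF X_continuous cw A(2) uB])
  define F where "F s = (Z s (A s) - Z s p) * (Z s (B s) - Z s p)" for s
  have cF: "continuous_on {0..1} F"
    unfolding F_def by (intro continuous_intros continuous_along cA cB)
  have cD: "continuous_on {0..1} (\<lambda>s. X s r - X s p)" by (intro continuous_intros continuous_along)
  define S where "S = {s \<in> {0..1}. X s r - X s p = 0}"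
  have "closed S" unfolding S_def by (rule continuous_closed_preimage_constant[OF cD]) simp
  moreover have "bounded S" by (rule bounded_subset[of "{0..1}"]) (auto simp: S_def)
  ultimately have "compact S" by (simp add: compact_eq_bounded_closed)
  moreover have "0 \<in> S" using plat_right[OF p r] by (simp add: S_def)
  ultimately obtain s0 where s0: "s0 \<in> S" "\<And>s. s \<in> S \<Longrightarrow> s \<le> s0"
    using compact_attains_sup[of S] by blast
  have s01: "s0 \<in> {0..1}" "s0 < 1" using s0(1) pr by (auto simp: S_def less_le)
  have less: "X s p < X s r" if s: "s0 < s" "s \<le> 1" for s
  proof -
    have "X s r - X s p > 0"
    proof (rule generic_knot.positive_propagates[OF knot[OF one], of s 1 "\<lambda>s. X s r - X s p"])
      show "continuous_on {s..1} (\<lambda>s. X s r - X s p)"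
        by (rule continuous_on_subset[OF cD]) (use s s01 in auto)
      show "X q r - X q p \<noteq> 0" if "q \<in> {s..1}" for q
        using s0(2)[of q] that s s01 by (auto simp: S_def)
    qed (use pr s in auto)
    then show ?thesis by simp
  qed
  have same: "\<Gamma> 1 p = \<Gamma> 1 q" if s: "s \<in> {0..1}" and q: "X s p = X s q" "Z s p = Z s q" for s q
  proof -
    interpret K: generic_knot "\<Gamma> s" by (rule knot[OF s])
    have "K.x' p = 0" using rs(2)[OF s] by (simp add: K.right_cusp_iff)
    from K.cusp_not_crossing[OF this q] show ?thesis by (rule gamma_eq_constant[OF s _ one])
  qed
  have X_same: "X 1 p = X 1 q \<and> (deriv (X 1) q = 0 \<longleftrightarrow> deriv (X 1) p = 0)" if g: "\<Gamma> 1 p = \<Gamma> 1 q" for q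
  proof -
    interpret K: generic_knot "\<Gamma> 1" by (rule knot) simp
    obtain n :: int where "p = q + of_int n" using K.gamma_eqD[OF g] by blast
    then show ?thesis by simp
  qed
  have crit: "deriv (X 1) p = 0" "deriv (X 1) r = 0"
    using rs[OF one] generic_knot.right_cusp_iff[OF knot[OF one]] by auto
  have no_crit: "q = a \<or> q = r" if "q \<in> {a..r}" "deriv (X 1) q = 0" for q
    using bs(1)[OF one] that generic_knot.branch_def[OF knot[OF one]] by (auto simp: less_le)
  have no_crit': "q = r \<or> q = b" if "q \<in> {r..b}" "deriv (X 1) q = 0" for q
    using bs(2)[OF one] that generic_knot.branch_def[OF knot[OF one]] by (auto simp: less_le)
  have low1: "X 1 a < X 1 p" "X 1 b < X 1 p" using low[OF one] pr by (auto simp: w_def)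
  have F_ne: "F s \<noteq> 0" if s: "s \<in> {s0..1}" for s
  proof (cases "s = s0")
    case True
    have "X s p = X s r" using True s0(1) by (simp add: S_def)
    then have "X s r = w s" by (simp add: w_def)
    moreover have "r \<in> {a..r}" "r \<in> {r..b}"
      using A[OF s01(1)] by auto
    ultimately have "A s = r" "B s = r" using uA[of s r] uB[of s r] s s01 by auto
    moreover have "Z s p \<noteq> Z s r"
      using same[of s r] X_same[of r] pr \<open>X s p = X s r\<close> s s01 by auto
    ultimately show ?thesis by (simp add: F_def)
  next
    case False
    then have s': "s \<in> {0..1}" "X s p < X s r" using s s01 less by auto
    then have ws: "w s = X s p" by (simp add: w_def)
    have "Z s p \<noteq> Z s (A s)"
    proof
      assume "Z s p = Z s (A s)"
      then have "\<Gamma> 1 p = \<Gamma> 1 (A s)" using same[of s "A s"] A[OF s'(1)] ws s' by simp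
      from X_same[OF this] crit no_crit[of "A s"] A[OF s'(1)] pr low1 show False by auto
    qed
    moreover have "Z s p \<noteq> Z s (B s)"
    proof
      assume "Z s p = Z s (B s)"
      then have "\<Gamma> 1 p = \<Gamma> 1 (B s)" using same[of s "B s"] A[OF s'(1)] ws s' by simp
      from X_same[OF this] crit no_crit'[of "B s"] A[OF s'(1)] pr low1 show False by auto
    qed
    ultimately show ?thesis by (simp add: F_def)
  qed
  have "F s0 > 0"
  proof -
    have "X s0 p = X s0 r" using s0(1) by (simp add: S_def)
    then have "X s0 r = w s0" by (simp add: w_def)
    moreover have "r \<in> {a..r}" "r \<in> {r..b}" using A[OF s01(1)] by auto
    ultimately have "A s0 = r" "B s0 = r" using uA[of s0 r] uB[of s0 r] s01 by auto
    then have "F s0 \<ge> 0" by (simp add: F_def)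
    then show ?thesis using F_ne[of s0] s01 by auto
  qed
  moreover have "continuous_on {s0..1} F" by (rule continuous_on_subset[OF cF]) (use s01 in auto)
  ultimately have "F 1 > 0" using s01 F_ne by (intro nonvanishing_sign[of s0 1 F]) auto
  moreover have "A 1 = \<alpha>" "B 1 = \<beta>"
    using uA[OF one \<alpha>(1)] uB[OF one \<beta>(1)] \<alpha>(2) \<beta>(2) pr by (auto simp: w_def)
  ultimately show ?thesis by (simp add: F_def)
qed

end

lemma crosses_sym: "crosses \<gamma> s t \<Longrightarrow> crosses \<gamma> t s"
  by (auto simp: crosses_def)

context generic_knot
begin

text \<open>The points with parameters \<open>t\<close> and \<open>t'\<close> over \<open>u\<close> are the ends of the arc of the knot through the
right cusp \<open>r\<close>, with no further cusp in between.\<close>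

definition joined :: "real \<Rightarrow> real \<Rightarrow> real \<Rightarrow> real \<Rightarrow> bool" where
  "joined u r t t' \<longleftrightarrow> right_cusp_at \<gamma> r \<and> t < r \<and> r < t' \<and>
     (\<forall>s. t \<le> s \<and> s \<le> t' \<and> s \<noteq> r \<longrightarrow> x' s \<noteq> 0) \<and> x t = u \<and> x t' = u"

lemma joined_branches:
  assumes j: "joined u r t t'" and b: "branch a r" "branch r b"
  shows "a < t" "t' < b"
proof -
  have "\<not> (t \<le> a \<and> a \<le> t' \<and> a \<noteq> r)" "\<not> (t \<le> b \<and> b \<le> t' \<and> b \<noteq> r)"
    using j b unfolding joined_def branch_def by blast+
  then show "a < t" "t' < b" using j b unfolding joined_def branch_def by auto
qed

lemma joined_signs:
  assumes j: "joined u r t t'"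
  shows "x' t > 0" "x' t' < 0" "u < x r"
proof -
  have r: "right_cusp_at \<gamma> r" using j by (simp add: joined_def)
  obtain a b where b: "branch a r" "branch r b" using branch_neighbours[OF r] by blast
  have t: "a < t" "t < r" "r < t'" "t' < b" "x t = u" using joined_branches[OF j b] j by (auto simp: joined_def)
  have l: "\<And>s. a < s \<Longrightarrow> s < r \<Longrightarrow> x' s > 0" using left_of_right_cusp[OF r b(1)] by blast
  show "x' t > 0" using l t by simp
  show "x' t' < 0" using right_of_right_cusp[OF r b(2)] t by blast
  show "u < x r" using branch_increasing[of a r t r, OF l] t by simp
qed

lemma joined_unique_left:
  assumes "joined u r t t'" "joined u q t q'" shows "r = q \<and> t' = q'"
proof -
  have z: "x' r = 0" "x' q = 0" using assms by (auto simp: joined_def right_cusp_iff)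
  have 1: "\<forall>s. t \<le> s \<and> s \<le> t' \<and> s \<noteq> r \<longrightarrow> x' s \<noteq> 0" "t < r" "r < t'"
    and 2: "\<forall>s. t \<le> s \<and> s \<le> q' \<and> s \<noteq> q \<longrightarrow> x' s \<noteq> 0" "t < q" "q < q'"
    and eq: "x t' = x q'"
    using assms by (auto simp: joined_def)
  have rq: "r = q"
    using 1(1)[rule_format, of q] 2(1)[rule_format, of r] 1(2,3) 2(2,3) z by (cases r q rule: linorder_cases) auto
  moreover have "t' = q'"
  proof (cases t' q' rule: linorder_cases)
    case less
    then obtain s where "t' < s" "s < q'" "x' s = 0" using Rolle_x[OF less eq] by blast
    then show ?thesis using 2(1)[rule_format, of s] 1(2,3) rq by auto
  next
    case greater
    then obtain s where "q' < s" "s < t'" "x' s = 0" using Rolle_x[OF greater] eq by auto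
    then show ?thesis using 1(1)[rule_format, of s] 2(2,3) rq by auto
  qed
  ultimately show ?thesis by simp
qed

lemma joined_unique_right:
  assumes "joined u r t t'" "joined u q s t'" shows "r = q \<and> t = s"
proof -
  have z: "x' r = 0" "x' q = 0" using assms by (auto simp: joined_def right_cusp_iff)
  have 1: "\<forall>h. t \<le> h \<and> h \<le> t' \<and> h \<noteq> r \<longrightarrow> x' h \<noteq> 0" "t < r" "r < t'"
    and 2: "\<forall>h. s \<le> h \<and> h \<le> t' \<and> h \<noteq> q \<longrightarrow> x' h \<noteq> 0" "s < q" "q < t'"
    and eq: "x t = x s"
    using assms by (auto simp: joined_def)
  have rq: "r = q"
    using 1(1)[rule_format, of q] 2(1)[rule_format, of r] 1(2,3) 2(2,3) z by (cases r q rule: linorder_cases) auto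
  moreover have "t = s"
  proof (cases t s rule: linorder_cases)
    case less
    then obtain h where "t < h" "h < s" "x' h = 0" using Rolle_x[OF less eq] by blast
    then show ?thesis using 1(1)[rule_format, of h] 1(2,3) 2(2,3) rq by auto
  next
    case greater
    then obtain h where "s < h" "h < t" "x' h = 0" using Rolle_x[OF greater] eq by auto
    then show ?thesis using 2(1)[rule_format, of h] 1(2,3) 2(2,3) rq by auto
  qed
  ultimately show ?thesis by simp
qed

lemma joined_shift:
  assumes "joined u r t t'" shows "joined u (r + of_int n) (t + of_int n) (t' + of_int n)"
proof -
  have "x' s \<noteq> 0" if "t + of_int n \<le> s \<and> s \<le> t' + of_int n \<and> s \<noteq> r + of_int n" for s
  proof -
    have "x' (s - of_int n) \<noteq> 0" using assms that by (auto simp: joined_def)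
    then show ?thesis using periodic_derivs(1)[of "s - of_int n" n] by simp
  qed
  then show ?thesis using assms by (simp add: joined_def right_cusp_iff)
qed

text \<open>A branch over \<open>u\<close> ends on the right at a right cusp. The other branch at this cusp
extends left to a left cusp, which lies to the left of \<open>u\<close>, so it meets the line again.\<close>

lemma joined_exists:
  assumes left: "\<And>a. left_cusp_at \<gamma> a \<Longrightarrow> x a < u" and t: "x t = u" "x' t \<noteq> 0"
  shows "\<exists>r t0 t1. joined u r t0 t1 \<and> (t = t0 \<or> t = t1)"
proof -
  obtain a b where ab: "branch a b" "a < t" "t < b" using branch_around[OF t(2)] by blast
  from branch_cases[OF ab(1)] show ?thesis
  proof
    assume *: "left_cusp_at \<gamma> a \<and> right_cusp_at \<gamma> b \<and> (\<forall>s. a < s \<and> s < b \<longrightarrow> x' s > 0)"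
    then have r: "right_cusp_at \<gamma> b" and ub: "u < x b"
      using branch_increasing[of a b t b] ab t by auto
    obtain c where c: "branch b c" using branch_neighbours[OF r] by blast
    then have lc: "left_cusp_at \<gamma> c" using right_of_right_cusp[OF r] by blast
    have bc: "b < c" "\<And>s. b < s \<Longrightarrow> s < c \<Longrightarrow> x' s \<noteq> 0" using c by (auto simp: branch_def)
    obtain t1 where t1: "b \<le> t1" "t1 \<le> c" "x t1 = u"
      using IVT2'[of x c u b] left[OF lc] ub bc cont(1) by auto
    then have "b < t1" "t1 < c" using ub left[OF lc] by (auto simp: less_le)
    moreover have "x' s \<noteq> 0" if "t \<le> s \<and> s \<le> t1 \<and> s \<noteq> b" for s
      using ab bc(2)[of s] that \<open>t1 < c\<close> by (cases "s < b") (auto simp: branch_def)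
    ultimately have "joined u b t t1" using r ab t t1 by (simp add: joined_def)
    then show ?thesis by blast
  next
    assume *: "right_cusp_at \<gamma> a \<and> left_cusp_at \<gamma> b \<and> (\<forall>s. a < s \<and> s < b \<longrightarrow> x' s < 0)"
    then have r: "right_cusp_at \<gamma> a" and ub: "u < x a"
      using branch_decreasing[of a b a t] ab t by auto
    obtain c where c: "branch c a" using branch_neighbours[OF r] by blast
    then have lc: "left_cusp_at \<gamma> c" using left_of_right_cusp[OF r] by blast
    have bc: "c < a" "\<And>s. c < s \<Longrightarrow> s < a \<Longrightarrow> x' s \<noteq> 0" using c by (auto simp: branch_def)
    obtain t1 where t1: "c \<le> t1" "t1 \<le> a" "x t1 = u"
      using IVT'[of x c u a] left[OF lc] ub bc cont(1) by auto
    then have "c < t1" "t1 < a" using ub left[OF lc] by (auto simp: less_le)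
    moreover have "x' s \<noteq> 0" if "t1 \<le> s \<and> s \<le> t \<and> s \<noteq> a" for s
      using ab bc(2)[of s] that \<open>c < t1\<close> by (cases "s < a") (auto simp: branch_def)
    ultimately have "joined u a t1 t" using r ab t t1 by (simp add: joined_def)
    then show ?thesis by blast
  qed
qed

text \<open>The points above \<open>h0\<close> are partitioned into the pairs of ends of arcs through right cusps. The
sign of \<open>x'\<close> tells the two ends of an arc apart, also modulo integer shifts.\<close>

lemma even_points_above:
  assumes left: "\<And>a. left_cusp_at \<gamma> a \<Longrightarrow> x a < u"
    and nc: "crossing_free {u}"
    and cusp: "\<And>t. x t = u \<Longrightarrow> x' t = 0 \<Longrightarrow> z t = h0"
    and sides: "\<And>r t t'. joined u r t t' \<Longrightarrow> z t > h0 \<longleftrightarrow> z t' > h0"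
  shows "even (card {h. h > h0 \<and> (u, h) \<in> front_set \<gamma>})"
proof -
  let ?H = "{h. h > h0 \<and> (u, h) \<in> front_set \<gamma>}"
  define \<C> where "\<C> = {{z t, z t'} | r t t'. joined u r t t' \<and> z t > h0}"
  have Un: "\<Union> \<C> = ?H"
  proof (intro set_eqI iffI)
    fix h assume "h \<in> \<Union> \<C>"
    then obtain r t t' where j: "joined u r t t'" "z t > h0" "h = z t \<or> h = z t'" by (auto simp: \<C>_def)
    then have "x t = u" "x t' = u" by (auto simp: joined_def)
    then show "h \<in> ?H" using j sides[OF j(1)] by (auto simp: front_set_iff)
  next
    fix h assume "h \<in> ?H"
    then obtain t where t: "x t = u" "z t = h" "h > h0" by (auto simp: front_set_iff)
    then have "x' t \<noteq> 0" using cusp by auto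
    then obtain r t0 t1 where j: "joined u r t0 t1" "t = t0 \<or> t = t1" using joined_exists[OF left t(1)] by blast
    then have "z t0 > h0" using t sides[OF j(1)] by auto
    then have "{z t0, z t1} \<in> \<C>" using j(1) by (auto simp: \<C>_def)
    then show "h \<in> \<Union> \<C>" using j(2) t by blast
  qed
  have shift: "\<exists>n::int. t = t' + of_int n" if "x t = u" "x t' = u" "z t = z t'" for t t'
    using gamma_eqD[OF crossing_free_gamma_eq[OF nc]] that by auto
  have "2 dvd card (\<Union> \<C>)"
  proof (rule dvd_partition)
    show "finite (\<Union> \<C>)" unfolding Un by (rule finite_above)
    show "\<forall>c\<in>\<C>. 2 dvd card c"
    proof
      fix c assume "c \<in> \<C>"
      then obtain r t t' where j: "joined u r t t'" "c = {z t, z t'}" by (auto simp: \<C>_def)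
      have "z t \<noteq> z t'"
      proof
        assume "z t = z t'"
        then obtain n :: int where "t = t' + of_int n" using shift[of t t'] j(1) by (auto simp: joined_def)
        then show False using joined_signs[OF j(1)] by simp
      qed
      then show "2 dvd card c" using j(2) by simp
    qed
    show "\<forall>c1\<in>\<C>. \<forall>c2\<in>\<C>. c1 \<noteq> c2 \<longrightarrow> c1 \<inter> c2 = {}"
    proof (intro ballI impI, rule ccontr)
      fix c1 c2 assume c: "c1 \<in> \<C>" "c2 \<in> \<C>" "c1 \<noteq> c2" "c1 \<inter> c2 \<noteq> {}"
      obtain r t t' where j1: "joined u r t t'" "c1 = {z t, z t'}" using c by (auto simp: \<C>_def)
      obtain q s s' where j2: "joined u q s s'" "c2 = {z s, z s'}" using c by (auto simp: \<C>_def)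
      have xs: "x t = u" "x t' = u" "x s = u" "x s' = u" using j1 j2 by (auto simp: joined_def)
      consider "z t = z s" | "z t = z s'" | "z t' = z s" | "z t' = z s'" using c(4) j1 j2 by auto
      then have "c1 = c2"
      proof cases
        case 1
        then obtain n :: int where n: "t = s + of_int n" using shift xs by blast
        have "t' = s' + of_int n" using joined_unique_left[OF j1(1)] joined_shift[OF j2(1), of n] n by simp
        then show ?thesis using n j1 j2 by simp
      next
        case 2
        then obtain n :: int where n: "t = s' + of_int n" using shift xs by blast
        then show ?thesis using joined_signs[OF j1(1)] joined_signs[OF j2(1)] by simp
      next
        case 3
        then obtain n :: int where n: "t' = s + of_int n" using shift xs by blast
        then show ?thesis using joined_signs[OF j1(1)] joined_signs[OF j2(1)] by simp
      next
        case 4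
        then obtain n :: int where n: "t' = s' + of_int n" using shift xs by blast
        have "t = s + of_int n" using joined_unique_right[OF j1(1)] joined_shift[OF j2(1), of n] n by simp
        then show ?thesis using n j1 j2 by simp
      qed
      with c(3) show False by simp
    qed
  qed
  then show ?thesis unfolding Un .
qed

end

context plat_perturbation
begin

lemma right_cusp_strand_odd:
  assumes inj: "inj_on fst (left_cusps (\<Gamma> 1) \<union> right_cusps (\<Gamma> 1))"
    and c: "crosses (\<Gamma> 1) c c'" and p: "right_cusp_at (\<Gamma> 1) p"
  shows "odd (strand (\<Gamma> 1) (front (\<Gamma> 1 p)))"
proof -
  have one: "(1::real) \<in> {0..1}" by simp
  interpret K: generic_knot "\<Gamma> 1" by (rule knot[OF one])
  let ?u = "K.x p"
  note const = cusps_constant[OF one]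
  have c0: "crosses (\<Gamma> 0) c c'" using c const by simp
  have p0: "right_cusp_at (\<Gamma> 0) p" using p const by simp
  have left: "K.x a < ?u" if "left_cusp_at (\<Gamma> 1) a" for a
    using left_cusp_before_crossing[OF one c0, of a] crossing_before_right_cusp[OF one c0 p0] that const by simp
  have nc: "K.crossing_free {?u}"
    unfolding K.crossing_free_def
  proof
    fix q assume "q \<in> crossings (\<Gamma> 1)"
    then obtain s t where "crosses (\<Gamma> 1) s t" and q: "q = front (\<Gamma> 1 t)" by (auto simp: crossings_def)
    then have "crosses (\<Gamma> 0) t s" using const(3) crosses_sym by blast
    with q show "fst q \<notin> {?u}"
      using crossing_before_right_cusp[OF one \<open>crosses (\<Gamma> 0) t s\<close> p0] by (simp add: K.front_gamma)
  qed
  have cusp: "K.z t = K.z p" if t: "K.x t = ?u" "K.x' t = 0" for t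
  proof -
    have "right_cusp_at (\<Gamma> 1) t" using K.cusp_cases[OF t(2)] left[of t] t(1) by auto
    then have "front (\<Gamma> 1 t) \<in> right_cusps (\<Gamma> 1)" "front (\<Gamma> 1 p) \<in> right_cusps (\<Gamma> 1)"
      using p by (auto simp: right_cusps_def)
    moreover have "fst (front (\<Gamma> 1 t)) = fst (front (\<Gamma> 1 p))"
      using t(1) by (simp add: K.front_gamma)
    ultimately have "front (\<Gamma> 1 t) = front (\<Gamma> 1 p)"
      using inj by (meson UnI2 inj_onD)
    then show ?thesis by (simp add: K.front_gamma)
  qed
  have sides: "K.z t > K.z p \<longleftrightarrow> K.z t' > K.z p" if j: "K.joined ?u r t t'" for r t t'
  proof -
    have r: "right_cusp_at (\<Gamma> 1) r" using j by (simp add: K.joined_def)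
    obtain a b where b: "K.branch a r" "K.branch r b" using K.branch_neighbours[OF r] by blast
    have t: "t \<in> {a..r}" "t' \<in> {r..b}" "K.x t = ?u" "K.x t' = ?u"
      using K.joined_branches[OF j b] j by (auto simp: K.joined_def)
    have "(K.z t - K.z p) * (K.z t' - K.z p) > 0"
      using right_cusps_not_nested[OF c0 p0 _ _ _ K.joined_signs(3)[OF j] t(1,3,2,4)]
        r b const branch_constant[OF one] by simp
    then show ?thesis by (auto simp: zero_less_mult_iff)
  qed
  have "even (card {h. h > K.z p \<and> (?u, h) \<in> front_set (\<Gamma> 1)})"
    by (rule K.even_points_above[OF left nc cusp sides])
  then show ?thesis unfolding strand_def K.front_gamma by simp
qed

end

context generic_knot
begin

lemma nearly_plat_facts:
  assumes "nearly_plat \<gamma>"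
  shows "\<lbrakk>b \<in> crossings \<gamma>; p \<in> right_cusps \<gamma>\<rbrakk> \<Longrightarrow> fst b < fst p"
    and "\<lbrakk>crossings \<gamma> \<noteq> {}; p \<in> right_cusps \<gamma>\<rbrakk> \<Longrightarrow> odd (strand \<gamma> p)"
proof -
  obtain \<Gamma> where G: "slight_perturbation \<Gamma>" "plat (\<Gamma> 0)" and 1: "\<Gamma> 1 = \<gamma>"
    and inj: "inj_on fst (left_cusps \<gamma> \<union> right_cusps \<gamma>)"
    using assms unfolding nearly_plat_def by blast
  interpret N: plat_perturbation \<Gamma> by standard (rule G)+
  have one: "(1::real) \<in> {0..1}" by simp
  note const = N.cusps_constant[OF one, unfolded 1]
  show "fst b < fst p" if b: "b \<in> crossings \<gamma>" and p: "p \<in> right_cusps \<gamma>"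
  proof -
    obtain s t where st: "crosses \<gamma> s t" "b = front (\<gamma> t)" using b by (auto simp: crossings_def)
    then have c: "crosses (\<Gamma> 0) t s" using const(3) crosses_sym by blast
    obtain r where "right_cusp_at \<gamma> r" "p = front (\<gamma> r)" using p by (auto simp: right_cusps_def)
    then show ?thesis
      using N.crossing_before_right_cusp[OF one c, of r] const(2) st by (simp add: front_gamma 1)
  qed
  show "odd (strand \<gamma> p)" if ne: "crossings \<gamma> \<noteq> {}" and p: "p \<in> right_cusps \<gamma>"
  proof -
    obtain s t where "crosses (\<Gamma> 1) s t" using ne by (auto simp: crossings_def 1)
    moreover obtain r where "right_cusp_at (\<Gamma> 1) r" "p = front (\<Gamma> 1 r)"
      using p by (auto simp: right_cusps_def 1)
    ultimately show ?thesis
      using N.right_cusp_strand_odd[of s t r] inj by (simp add: 1)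
  qed
qed

end

section \<open>The differential graded algebra of a nearly plat front\<close>

theorem theorem5p4:
  fixes \<gamma> :: "real \<Rightarrow> space" and \<mu> :: "space \<Rightarrow> int" and C :: mcs
  assumes "legendrian_knot \<gamma>" and "generic_front \<gamma>" and "nearly_plat \<gamma>"
    and "maslov_potential \<gamma> \<mu>"
    and "is_mcs \<gamma> \<mu> C"
  shows "is_dga (mcs_algebra \<gamma>) (mcs_algebra_deg \<gamma> \<mu>) (mcs_d \<gamma> \<mu> C)"
proof -
  interpret K: generic_knot \<gamma>
    using assms by unfold_locales
  interpret S: morse_complex_sequence \<gamma> \<mu> C
    using assms by unfold_locales
  \<comment> \<open>No event other than the crossing lies between the line \<open>x\<^sub>m\<close> and the crossing.\<close>
  have only: "e = Crossing p"
    if m: "m \<in> {1..mcs_len C}" "piece_event \<gamma> C m = Crossing p"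
      and e: "e \<in> events \<gamma> C" "mcs_x C m \<le> event_x e" "event_x e \<le> fst p" for m p e
  proof -
    have "in_piece C m (fst p)" using S.piece_event_CrossingD[of m p] m by simp
    moreover have "mcs_x C m < event_x e" using S.event_off_lines[OF e(1) m(1)] e(2) by simp
    ultimately have "in_piece C m (event_x e)" using e(3) by (auto simp: in_piece_def)
    from S.piece_event_eqI[OF e(1) this] m(2) show ?thesis by simp
  qed
  have data: "Suc (strand \<gamma> p) \<le> num_strands \<gamma> (mcs_x C m)" (is ?A)
    "gen_degree \<gamma> \<mu> p = \<mu> (strand_point \<gamma> (mcs_x C m) (strand \<gamma> p))
       - \<mu> (strand_point \<gamma> (mcs_x C m) (Suc (strand \<gamma> p)))" (is ?B)
    if m: "m \<in> {1..mcs_len C}" "piece_event \<gamma> C m = Crossing p" for m p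
  proof -
    have p: "p \<in> crossings \<gamma>" "in_piece C m (fst p)"
      using S.piece_event_CrossingD[of m p] m by auto
    have v: "mcs_x C m < fst p" using p(2) m(1) by (simp add: in_piece_def)
    have cf: "K.cusp_free (mcs_x C m) (fst p)"
      unfolding K.cusp_free_def
    proof (intro allI impI notI)
      fix s assume s: "K.x' s = 0" "K.x s \<in> {mcs_x C m..fst p}"
      have "Left_Cusp (front (\<gamma> s)) \<in> events \<gamma> C \<or> Right_Cusp (front (\<gamma> s)) \<in> events \<gamma> C"
        using K.cusp_cases[OF s(1)] by (auto simp: events_def left_cusps_def right_cusps_def)
      then show False
        using only[OF m, of "Left_Cusp (front (\<gamma> s))"] only[OF m, of "Right_Cusp (front (\<gamma> s))"] s(2)
        by (auto simp: K.front_gamma)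
    qed
    have eq: "q = p" if "q \<in> crossings \<gamma>" "mcs_x C m \<le> fst q" "fst q \<le> fst p" for q
      using only[OF m, of "Crossing q"] that by (simp add: events_def)
    have nc: "K.crossing_free {mcs_x C m..<fst p}"
      unfolding K.crossing_free_def using eq by force
    have uniq: "q = p" if "q \<in> crossings \<gamma>" "fst q = fst p" for q
      using eq[OF that(1)] that(2) v by simp
    show ?A ?B by (rule K.crossing_data[OF p(1) v cf nc uniq assms(4)]; assumption)+
  qed
  interpret N: nearly_plat_mcs \<gamma> \<mu> C
  proof
    show "piece_event \<gamma> C 0 \<noteq> Crossing p" for p
    proof
      assume e: "piece_event \<gamma> C 0 = Crossing p"
      then have p: "p \<in> crossings \<gamma>" "in_piece C 0 (fst p)" using S.piece_event_CrossingD[of 0 p] by auto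
      \<comment> \<open>The leftmost point of the knot is a left cusp and would share the first piece.\<close>
      obtain t where t: "left_cusp_at \<gamma> t" "\<And>s. K.x t \<le> K.x s" using K.leftmost by blast
      obtain s where "p = front (\<gamma> s)" using p(1) by (auto simp: crossings_def)
      then have "in_piece C 0 (K.x t)" using p(2) t(2)[of s] by (auto simp: in_piece_def K.front_gamma)
      then have "piece_event \<gamma> C 0 = Left_Cusp (front (\<gamma> t))"
        using t(1) by (intro S.piece_event_eqI) (auto simp: events_def left_cusps_def K.front_gamma)
      with e show False by simp
    qed
    show "strand \<gamma> (u, z) < strand \<gamma> (u, z')"
      if "m \<le> mcs_len C" "piece_event \<gamma> C m = Handleslide (u, z, z')" for m u z z'
    proof -
      from S.piece_event_HandleslideD[OF that] have "z' < z" and "\<exists>q\<in>range \<gamma>. front q = (u, z)"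
        by (auto simp: handleslide_mark_def)
      then have "(u, z) \<in> front_set \<gamma>" by (force simp: front_set_def)
      then show ?thesis using \<open>z' < z\<close> by (rule K.strand_less)
    qed
  qed (use data K.nearly_plat_facts[OF assms(3)] in blast)+
  show ?thesis by (rule N.is_dga)
qed

end
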